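(* Let $(T_n)$ be a consistent sequence of uniform spanning trees, $\bar\alpha=\frac43+\frac1{15}\sqrt{205}$, and let $X$ be the almost sure uniform limit on $[0,\infty]$ of $X_n(t)=\mathrm{LI}(u_1T_nu_2)(\bar\alpha^nt)$. Then almost surely $X$ is self-avoiding, i.e. $X(s)\neq X(t)$ for all $0\le s<t\le\mathsf h(X)$, where $\mathsf h(X)=\inf\{t:X(s)=u_2\text{ for all }s\ge t\}$.
   Context: Let $u_1=(0,0)$, $u_2=(1,0)$, $u_3=(\tfrac12,\tfrac{\sqrt3}2)$ in $\mathbb R^2$ and $\psi_i(x)=\tfrac12(x-u_i)+u_i$ for $i\in\{1,2,3\}$. The Sierpiński gasket $K$ is the unique nonempty compact set with $K=\psi_1(K)\cup\psi_2(K)\cup\psi_3(K)$. The Sierpiński graphs $G_n$ (embedded in the plane, all edges as straight segments lie in $K$) are defined recursively: $G_0$ has vertex set $VG_0=\{u_1,u_2,u_3\}$ and edge set $\{\{u_1,u_2\},\{u_2,u_3\},\{u_3,u_1\}\}$; $G_{n+1}$ has vertex set $\psi_1(VG_n)\cup\psi_2(VG_n)\cup\psi_3(VG_n)$ and edge set $\psi_1(EG_n)\cup\psi_2(EG_n)\cup\psi_3(EG_n)$ (edges mapped vertexwise). For a word $w=w_1\cdots w_k\in\{1,2,3\}^k$ put $\psi_w=\psi_{w_1}\circ\cdots\circ\psi_{w_k}$; then $G_n=\bigcup_{w\in\{1,2,3\}^k}\psi_w(G_{n-k})$. For a spanning subgraph $H\subseteq G_n$ and $w\in\{1,2,3\}^k$,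 $\pi_w(H)=\psi_w^{-1}(H\cap\psi_w(G_{n-k}))$. $\mathcal T_n$ denotes the set of spanning trees of $G_n$; $\mathcal S_n^i$ the set of spanning forests of $G_n$ with two components, one containing $u_i$ and the other containing $\{u_1,u_2,u_3\}\setminus\{u_i\}$; $\mathcal R_n$ the set of spanning forests with three components each containing exactly one of $u_1,u_2,u_3$; $\mathcal Q_n=\mathcal T_n\cup\mathcal S_n^1\cup\mathcal S_n^2\cup\mathcal S_n^3\cup\mathcal R_n$. For $g\in\mathcal Q_1$, $\mathrm{Tr}\,g$ is the spanning subgraph of $G_0$ equal to: the two edges at $u_i$ if $g$ is a spanning tree of $G_1$ in which for both $j\neq i$ the path from $u_i$ to $u_j$ lies in $\psi_i(G_0)\cup\psi_j(G_0)$ (every spanning tree of $G_1$ satisfies this for exactly one $i$); the single edge not containing $u_i$ if $g\in\mathcal S_1^i$; the edgeless graph if $g\in\mathcal R_1$. For $f\in\mathcal Q_{n+1}$, $\mathrm{Tr}\,f=\bigcup_{w\in\{1,2,3\}^n}\psi_w(\mathrm{Tr}\,\pi_w(f))$; Tr maps spanning trees of $G_{n+1}$ to spanning trees of $G_n$. A consistent sequence of uniform spanning trees is a sequence $(T_n)_{n\ge0}$ of random spanning trees defined on a common probability space such that $T_n$ is uniformly distributed on $\mathcal T_n$ and $\mathrm{Tr}\,T_{n+1}=T_n$ for all $n$. For a tree $t$ and vertices $x,y$, $xty$ denotes the unique self-avoiding walk in $t$ from $x$ to $y$. For a walk $x=(x_0,\dots,x_r)$, $\mathrm{LI}(x):[0,\infty]\to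 K$ is the linear interpolation $\mathrm{LI}(x)(t)=(k+1-t)x_k+(t-k)x_{k+1}$ for $k\le t<k+1$, $k<r$, and $\mathrm{LI}(x)(t)=x_r$ for $t\ge r$. It is known that $X_n$ converges almost surely uniformly to a continuous curve $X$ with $X(0)=u_1$, $X(\infty)=u_2$. *)

theory Defs
  imports "HOL-Probability.Probability"
begin

definition u :: "nat \<Rightarrow> complex" where
  "u i = (if i = 1 then 0 else if i = 2 then 1
          else if i = 3 then Complex (1/2) (sqrt 3 / 2) else 0)"

definition idx :: "nat set" where "idx = {1, 2, 3}"

definition psi :: "nat \<Rightarrow> complex \<Rightarrow> complex" where
  "psi i x = (1/2) * (x - u i) + u i"

fun psiw :: "nat list \<Rightarrow> complex \<Rightarrow> complex" where
  "psiw [] = id"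
| "psiw (i # w) = psi i \<circ> psiw w"

definition words :: "nat \<Rightarrow> nat list set" where
  "words k = {w. length w = k \<and> set w \<subseteq> idx}"

text \<open>Edges are two-element vertex sets; a spanning subgraph of G_n is given by its
  edge set (a subset of EG n), the vertex set being VG n.\<close>

fun VG :: "nat \<Rightarrow> complex set" where
  "VG 0 = {u 1, u 2, u 3}"
| "VG (Suc n) = (\<Union>i\<in>idx. psi i ` VG n)"

fun EG :: "nat \<Rightarrow> complex set set" where
  "EG 0 = {{u 1, u 2}, {u 2, u 3}, {u 3, u 1}}"
| "EG (Suc n) = (\<Union>i\<in>idx. (\<lambda>e. psi i ` e) ` EG n)"

definition walk :: "complex set set \<Rightarrow> complex list \<Rightarrow> bool" where
  "walk E xs \<longleftrightarrow> xs \<noteq> [] \<and> (\<forall>i. Suc i < length xs \<longrightarrow> {xs ! i, xs ! Suc i} \<in> E)"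

definition reach :: "complex set set \<Rightarrow> complex \<Rightarrow> complex \<Rightarrow> bool" where
  "reach E x y \<longleftrightarrow> (\<exists>xs. walk E xs \<and> hd xs = x \<and> last xs = y)"

definition acyclic_graph :: "complex set set \<Rightarrow> bool" where
  "acyclic_graph E \<longleftrightarrow>
     \<not> (\<exists>xs. length xs \<ge> 3 \<and> distinct xs \<and> walk E xs \<and> {last xs, hd xs} \<in> E)"

definition STrees :: "nat \<Rightarrow> complex set set set" where
  "STrees n = {E. E \<subseteq> EG n \<and> acyclic_graph E \<and>
                  (\<forall>x\<in>VG n. \<forall>y\<in>VG n. reach E x y)}"

definition SForests :: "nat \<Rightarrow> nat \<Rightarrow> complex set set set" where
  "SForests n i = {E. E \<subseteq> EG n \<and> acyclic_graph E \<and>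
      (\<forall>j\<in>idx - {i}. \<forall>k\<in>idx - {i}. reach E (u j) (u k)) \<and>
      (\<forall>j\<in>idx - {i}. \<not> reach E (u i) (u j)) \<and>
      (\<forall>x\<in>VG n. \<exists>j\<in>idx. reach E x (u j))}"

definition RForests :: "nat \<Rightarrow> complex set set set" where
  "RForests n = {E. E \<subseteq> EG n \<and> acyclic_graph E \<and>
      (\<forall>j\<in>idx. \<forall>k\<in>idx. j \<noteq> k \<longrightarrow> \<not> reach E (u j) (u k)) \<and>
      (\<forall>x\<in>VG n. \<exists>j\<in>idx. reach E x (u j))}"

definition tpath :: "complex set set \<Rightarrow> complex \<Rightarrow> complex \<Rightarrow> complex list" where
  "tpath E x y = (THE xs. walk E xs \<and> distinct xs \<and> hd xs = x \<and> last xs = y)"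

definition walk_edges :: "complex list \<Rightarrow> complex set set" where
  "walk_edges xs = {{xs ! i, xs ! Suc i} | i. Suc i < length xs}"

text \<open>Tr on Q_1 (value on graphs outside Q_1 is irrelevant and set to the empty graph).\<close>
definition Tr1 :: "complex set set \<Rightarrow> complex set set" where
  "Tr1 g =
    (if g \<in> STrees 1 then
       (let i = (SOME i. i \<in> idx \<and> (\<forall>j\<in>idx - {i}.
                   walk_edges (tpath g (u i) (u j))
                     \<subseteq> (\<lambda>e. psi i ` e) ` EG 0 \<union> (\<lambda>e. psi j ` e) ` EG 0))
        in {{u i, u j} | j. j \<in> idx \<and> j \<noteq> i})
     else if g \<in> SForests 1 1 then {{u 2, u 3}}
     else if g \<in> SForests 1 2 then {{u 1, u 3}}
     else if g \<in> SForests 1 3 then {{u 1, u 2}}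
     else {})"

definition piw :: "nat list \<Rightarrow> complex set set \<Rightarrow> complex set set" where
  "piw w H = {e \<in> EG 1. psiw w ` e \<in> H}"

text \<open>Tr n maps spanning subgraphs of G_{n+1} to spanning subgraphs of G_n.\<close>
definition Tr :: "nat \<Rightarrow> complex set set \<Rightarrow> complex set set" where
  "Tr n f = (\<Union>w\<in>words n. (\<lambda>e. psiw w ` e) ` Tr1 (piw w f))"

definition LI :: "complex list \<Rightarrow> ereal \<Rightarrow> complex" where
  "LI xs t =
    (if t \<ge> ereal (real (length xs - 1)) then last xs
     else (let \<tau> = real_of_ereal t; k = nat \<lfloor>\<tau>\<rfloor> in
           of_real (real k + 1 - \<tau>) * xs ! k + of_real (\<tau> - real k) * xs ! Suc k))"

definition alpha_bar :: real where
  "alpha_bar = 4/3 + sqrt 205 / 15"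

definition hX :: "(ereal \<Rightarrow> complex) \<Rightarrow> ereal" where
  "hX X = Inf {t. 0 \<le> t \<and> (\<forall>s. t \<le> s \<longrightarrow> X s = u 2)}"

definition consistent_UST :: "'a measure \<Rightarrow> (nat \<Rightarrow> 'a \<Rightarrow> complex set set) \<Rightarrow> bool" where
  "consistent_UST M T \<longleftrightarrow> prob_space M \<and>
     (\<forall>n. T n \<in> measurable M (count_space UNIV) \<and>
          distr M (count_space UNIV) (T n) = measure_pmf (pmf_of_set (STrees n))) \<and>
     (\<forall>n. \<forall>\<omega>\<in>space M. Tr n (T (Suc n) \<omega>) = T n \<omega>)"

end

theory Submission
  imports Defs
begin

text \<open>Given \<open>T_n\<close>, the spanning tree \<open>T_{n+1}\<close> arises by filling the cells of level n
  independently and uniformly with preimages under the trace. Hence the crossings of cells by the path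
  from \<open>u_1\<close> to \<open>u_2\<close> form a branching process with three types, whose matrix of mean offspring
  has the eigenvalue \<open>alpha_bar\<close>. The order in which the path crosses the cells of level k is the
  same for all \<open>T_n\<close> with n at least k.

  Suppose that X(s) = X(t) = p with s < t. If, at all large levels k, the only cells of level k crossed by
  the path and containing p are one cell or two consecutive ones, then for all large n the path spends
  the whole time from s to t in at most two cells of level k, so one of them contains a proportion of
  steps bounded below by a multiple of \<open>alpha_bar^n\<close>, uniformly in k. A second moment bound for
  the branching process excludes this almost surely: the expected sum, over the cells of level k, of the
  squared numbers of steps is of order \<open>alpha_bar^(2n - k)\<close>. The condition on p can fail only at
  a corner p of some cell which the path approaches at all levels without touching it; at each level
  this has conditional probability bounded away from 1.\<close>

section \<open>Graphs\<close>

text \<open>Nearness in the plane gives no control of time along the path, since only numbers of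
  steps are known. The proof therefore turns a self-intersection into a statement on counts: at
  every large level k some cell holds a fixed proportion of \<open>alpha_bar ^ n\<close> for all
  large n. The limits are taken in this order: for fixed k the probability is bounded uniformly in
  n, and then k grows. The independence of fillings rests on an exchange argument. Inside one cell a
  filling may be replaced by any other with the same nonempty trace, because both connect the same
  corners. The numbers of such fillings come from evaluating all spanning subgraphs of
  \<open>G_1\<close>. Two properties of the trace, that it maps spanning trees to spanning trees and
  that all spanning trees of \<open>G_n\<close> have equally many extensions, are read off from the
  law of the sequence instead of being proved combinatorially. Crossings are counted with the
  entries of an eigenvector of the mean matrix as weights. Then conditional means are exact
  multiples, and powers of the matrix never appear.\<close>

definition adj :: "complex set set \<Rightarrow> (complex \<times> complex) set" where
  "adj E = {(a, b). {a, b} \<in> E}"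

lemma adj_iff [simp]: "(a, b) \<in> adj E \<longleftrightarrow> {a, b} \<in> E"
  by (simp add: adj_def)

lemma walk_snoc:
  assumes "xs \<noteq> []"
  shows "walk E (xs @ [y]) \<longleftrightarrow> walk E xs \<and> {last xs, y} \<in> E"
proof -
  have 1: "last xs = xs ! (length xs - 1)" using assms by (simp add: last_conv_nth)
  show ?thesis
  proof
    assume h: "walk E (xs @ [y])"
    have "{(xs@[y]) ! i, (xs@[y]) ! Suc i} \<in> E" if "i < length xs" for i
      using h that by (auto simp: walk_def)
    note h2 = this
    have "walk E xs" unfolding walk_def
    proof (intro conjI allI impI)
      fix i assume "Suc i < length xs"
      then show "{xs ! i, xs ! Suc i} \<in> E" using h2[of i] by (simp add: nth_append)
    qed (rule assms)
    moreover have "{last xs, y} \<in> E"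
      using h2[of "length xs - 1"] assms by (simp add: nth_append 1)
    ultimately show "walk E xs \<and> {last xs, y} \<in> E" ..
  next
    assume h: "walk E xs \<and> {last xs, y} \<in> E"
    show "walk E (xs @ [y])" unfolding walk_def
    proof (intro conjI allI impI)
      fix i assume "Suc i < length (xs @ [y])"
      then consider "Suc i < length xs" | "i = length xs - 1" "Suc i = length xs" by fastforce
      then show "{(xs @ [y]) ! i, (xs @ [y]) ! Suc i} \<in> E"
        using h assms by cases (auto simp: walk_def nth_append 1)
    qed simp
  qed
qed

lemma walk_Cons:
  assumes "xs \<noteq> []"
  shows "walk E (x # xs) \<longleftrightarrow> {x, hd xs} \<in> E \<and> walk E xs"
proof
  assume h: "walk E (x # xs)"
  then have h2: "{(x # xs) ! i, (x # xs) ! Suc i} \<in> E" if "i < length xs" for i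
    using that by (auto simp: walk_def)
  show "{x, hd xs} \<in> E \<and> walk E xs"
    using h2[of 0] h2[of "Suc i" for i] assms by (auto simp: walk_def hd_conv_nth)
next
  assume h: "{x, hd xs} \<in> E \<and> walk E xs"
  show "walk E (x # xs)" unfolding walk_def
  proof (intro conjI allI impI)
    fix i assume "Suc i < length (x # xs)"
    then show "{(x # xs) ! i, (x # xs) ! Suc i} \<in> E"
      using h assms by (cases i) (auto simp: walk_def hd_conv_nth)
  qed simp
qed

lemma walk_single [simp]: "walk E [x]"
  by (simp add: walk_def)

lemma walk_take: "walk E xs \<Longrightarrow> 0 < k \<Longrightarrow> walk E (take k xs)"
  by (auto simp: walk_def)

lemma walk_drop: "walk E xs \<Longrightarrow> k < length xs \<Longrightarrow> walk E (drop k xs)"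
  by (auto simp: walk_def)

lemma walk_rev: "walk E xs \<Longrightarrow> walk E (rev xs)"
proof (induction xs)
  case (Cons x xs)
  show ?case
  proof (cases "xs = []")
    case False
    then show ?thesis using Cons by (simp add: walk_Cons walk_snoc last_rev insert_commute)
  qed simp
qed (simp add: walk_def)

lemma walk_append:
  "walk E xs \<Longrightarrow> walk E ys \<Longrightarrow> {last xs, hd ys} \<in> E \<Longrightarrow> walk E (xs @ ys)"
proof (induction xs)
  case (Cons x xs)
  show ?case
  proof (cases "xs = []")
    case True
    moreover have "ys \<noteq> []" using Cons.prems by (auto simp: walk_def)
    ultimately show ?thesis using Cons.prems by (simp add: walk_Cons)
  next
    case False
    then show ?thesis using Cons by (simp add: walk_Cons)
  qed
qed simp

lemma walk_mono: "walk E xs \<Longrightarrow> E \<subseteq> F \<Longrightarrow> walk F xs"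
  by (auto simp: walk_def)

lemma rtrancl_adj_path:
  assumes "(x, y) \<in> (adj E)\<^sup>*"
  shows "\<exists>xs. walk E xs \<and> distinct xs \<and> hd xs = x \<and> last xs = y"
  using assms
proof (induction rule: rtrancl_induct)
  case base
  show ?case by (rule exI[of _ "[x]"]) simp
next
  case (step y z)
  then obtain xs where xs: "walk E xs" "distinct xs" "hd xs = x" "last xs = y" by blast
  then have ne: "xs \<noteq> []" by (auto simp: walk_def)
  show ?case
  proof (cases "z \<in> set xs")
    case True
    \<comment> \<open>The new vertex is already on the path: cutting the path at its earlier visit
      keeps it simple.\<close>
    then obtain ys zs where yz: "xs = ys @ z # zs" by (meson split_list)
    then have "take (Suc (length ys)) xs = ys @ [z]" by simp
    then have "walk E (ys @ [z])" using walk_take[OF xs(1), of "Suc (length ys)"] by simp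
    then show ?thesis using xs yz by (intro exI[of _ "ys @ [z]"]) (auto simp: hd_append)
  next
    case False
    then show ?thesis using xs ne step
      by (intro exI[of _ "xs @ [z]"]) (auto simp: walk_snoc)
  qed
qed

lemma walk_rtrancl:
  assumes "walk E xs" shows "(hd xs, last xs) \<in> (adj E)\<^sup>*"
  using assms
proof (induction xs)
  case (Cons x xs)
  then show ?case
    by (cases "xs = []") (auto simp: walk_Cons intro: converse_rtrancl_into_rtrancl)
qed (simp add: walk_def)

lemma reach_rtrancl: "reach E x y \<longleftrightarrow> (x, y) \<in> (adj E)\<^sup>*"
  using walk_rtrancl rtrancl_adj_path unfolding reach_def by blast

lemma reach_path: "reach E x y \<Longrightarrow> \<exists>xs. walk E xs \<and> distinct xs \<and> hd xs = x \<and> last xs = y"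
  using rtrancl_adj_path by (simp add: reach_rtrancl)

lemma reach_refl [simp]: "reach E x x"
  by (simp add: reach_rtrancl)

lemma reach_trans: "reach E x y \<Longrightarrow> reach E y z \<Longrightarrow> reach E x z"
  by (simp add: reach_rtrancl)

lemma reach_sym: "reach E x y \<Longrightarrow> reach E y x"
proof -
  have "sym (adj E)" by (auto simp: sym_def insert_commute)
  then show "reach E x y \<Longrightarrow> reach E y x" by (meson reach_rtrancl sym_rtrancl symD)
qed

lemma reach_edge: "{x, y} \<in> E \<Longrightarrow> reach E x y"
  by (simp add: reach_rtrancl r_into_rtrancl)

lemma reach_mono: "reach E x y \<Longrightarrow> E \<subseteq> F \<Longrightarrow> reach F x y"
  unfolding reach_def using walk_mono by blast

lemma reach_induct [consumes 1, case_names refl step]: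
  assumes "reach E x y" "P x" "\<And>y z. reach E x y \<Longrightarrow> P y \<Longrightarrow> {y, z} \<in> E \<Longrightarrow> P z"
  shows "P y"
proof -
  have "(x, y) \<in> (adj E)\<^sup>*" using assms(1) by (simp add: reach_rtrancl)
  then show ?thesis
  proof (induction rule: rtrancl_induct)
    case base
    show ?case by (rule assms(2))
  next
    case (step y z)
    then show ?case using assms(3)[of y z] by (simp add: reach_rtrancl)
  qed
qed

lemma reach_segment:
  assumes "i \<le> j" "j < length xs" "\<And>k. i \<le> k \<Longrightarrow> k < j \<Longrightarrow> {xs ! k, xs ! Suc k} \<in> E"
  shows "reach E (xs ! i) (xs ! j)"
  using assms
proof (induction j)
  case (Suc j)
  show ?case
  proof (cases "i = Suc j")
    case False
    then have "reach E (xs ! i) (xs ! j)" using Suc by simp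
    moreover have "{xs ! j, xs ! Suc j} \<in> E" using Suc.prems False by simp
    ultimately show ?thesis using reach_edge reach_trans by blast
  qed simp
qed simp

lemma reach_insert:
  "reach (insert {x, y} E) a b \<longleftrightarrow>
    reach E a b \<or> (reach E a x \<and> reach E y b) \<or> (reach E a y \<and> reach E x b)"
proof
  assume "reach (insert {x, y} E) a b"
  then show "reach E a b \<or> (reach E a x \<and> reach E y b) \<or> (reach E a y \<and> reach E x b)"
  proof (induction rule: reach_induct)
    case (step b c)
    show ?case
    proof (cases "{b, c} \<in> E")
      case True
      then show ?thesis using step.IH reach_edge reach_trans by blast
    next
      case False
      then have "{b, c} = {x, y}" using step.hyps by auto
      then have "(b = x \<and> c = y) \<or> (b = y \<and> c = x)" by (auto simp: doubleton_eq_iff)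
      then show ?thesis using step.IH
        by (elim disjE conjE) (auto intro: reach_sym reach_trans)
    qed
  qed simp
next
  have m: "reach E p q \<Longrightarrow> reach (insert {x, y} E) p q" for p q
    using reach_mono by (metis subset_insertI)
  have e: "reach (insert {x, y} E) x y" by (simp add: reach_edge)
  assume "reach E a b \<or> (reach E a x \<and> reach E y b) \<or> (reach E a y \<and> reach E x b)"
  then show "reach (insert {x, y} E) a b" using m e reach_sym reach_trans by meson
qed

section \<open>Cycles, bridges and the uniqueness of paths in forests\<close>

lemma acyclic_graph_mono: "acyclic_graph F \<Longrightarrow> E \<subseteq> F \<Longrightarrow> acyclic_graph E"
  unfolding acyclic_graph_def using walk_mono by blast

lemma distinct_edge_eq:
  assumes "distinct xs" "Suc i < length xs" "Suc j < length xs"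
    "{xs ! i, xs ! Suc i} = {xs ! j, xs ! Suc j}"
  shows "i = j"
  using assms by (auto simp: doubleton_eq_iff nth_eq_iff_index_eq)

text \<open>A simple path between the ends that avoids the edge has at least three vertices, so the
  edge closes it to a cycle.\<close>

lemma acyclic_graph_bridge:
  assumes ac: "acyclic_graph E" and e: "{x, y} \<in> E" "x \<noteq> y"
  shows "\<not> reach (E - {{x, y}}) x y"
proof
  assume "reach (E - {{x, y}}) x y"
  then obtain xs where xs: "walk (E - {{x,y}}) xs" "distinct xs" "hd xs = x" "last xs = y"
    using reach_path by blast
  have "length xs \<ge> 3"
  proof (rule ccontr)
    assume "\<not> 3 \<le> length xs"
    then consider "xs = []" | a where "xs = [a]" | a b where "xs = [a, b]"
      by (cases xs; cases "tl xs"; cases "tl (tl xs)") auto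
    then show False using xs e(2) by cases (auto simp: walk_def)
  qed
  moreover have "walk E xs" using xs(1) walk_mono by blast
  ultimately show False
    using ac xs e unfolding acyclic_graph_def by (metis insert_commute)
qed

text \<open>\<open>C\<close> is the edge set of one cycle. Besides the fact that none of its edges
  is a bridge, the statement records that \<open>C\<close> itself is not acyclic. Hence
  \<open>C\<close> cannot lie inside an acyclic part of \<open>E\<close>, and an edge of the cycle
  outside that part can be chosen.\<close>

lemma not_acyclic_cycle_edge:
  assumes na: "\<not> acyclic_graph E"
  obtains C where "C \<subseteq> E" "\<not> acyclic_graph C"
    "\<And>e. e \<in> C \<Longrightarrow> \<exists>x y. e = {x, y} \<and> x \<noteq> y \<and> reach (E - {e}) x y"
proof -
  obtain xs where xs: "length xs \<ge> 3" "distinct xs" "walk E xs" "{last xs, hd xs} \<in> E"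
    using na unfolding acyclic_graph_def by blast
  define C where "C = insert {last xs, hd xs} (walk_edges xs)"
  have ne: "xs \<noteq> []" using xs(1) by auto
  let ?n = "length xs"
  have hl: "hd xs = xs ! 0" "last xs = xs ! (?n - 1)" using ne by (auto simp: hd_conv_nth last_conv_nth)
  \<comment> \<open>This uses that there are at least three vertices: with two, the closing edge
    would be the edge of the path.\<close>
  have closing: "{last xs, hd xs} \<noteq> {xs ! i, xs ! Suc i}" if "Suc i < ?n" for i
  proof -
    have "xs ! i \<noteq> xs ! (?n - 1)" "xs ! 0 \<noteq> xs ! i \<or> xs ! (?n - 1) \<noteq> xs ! Suc i"
      using that xs(1) ne nth_eq_iff_index_eq[OF xs(2), of i "?n - 1"]
        nth_eq_iff_index_eq[OF xs(2), of 0 i] nth_eq_iff_index_eq[OF xs(2), of "?n - 1" "Suc i"]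
      by auto
    then show ?thesis unfolding hl by (auto simp: doubleton_eq_iff)
  qed
  have wE: "walk_edges xs \<subseteq> E" using xs(3) by (auto simp: walk_edges_def walk_def)
  have "C \<subseteq> E" using wE xs(4) by (simp add: C_def)
  moreover have "\<not> acyclic_graph C"
  proof -
    have "walk C xs" using ne by (auto simp: walk_def C_def walk_edges_def)
    then show ?thesis unfolding acyclic_graph_def using xs(1,2) C_def by blast
  qed
  moreover have "\<exists>x y. e = {x, y} \<and> x \<noteq> y \<and> reach (E - {e}) x y" if eC: "e \<in> C" for e
  proof -
    consider "e = {last xs, hd xs}" | i where "Suc i < ?n" "e = {xs ! i, xs ! Suc i}"
      using eC unfolding C_def walk_edges_def by blast
    then show ?thesis
    proof cases
      case 1
      have "reach (E - {e}) (xs ! 0) (xs ! (?n - 1))"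
      proof (rule reach_segment)
        fix k assume k: "k < ?n - 1"
        then have "{xs ! k, xs ! Suc k} \<noteq> e" using closing[of k] 1 ne by fastforce
        then show "{xs ! k, xs ! Suc k} \<in> E - {e}" using xs(3) k by (auto simp: walk_def)
      qed (use ne in auto)
      moreover have "xs ! 0 \<noteq> xs ! (?n - 1)" using xs(1,2) by (subst nth_eq_iff_index_eq) auto
      ultimately show ?thesis using 1 unfolding hl by (metis insert_commute)
    next
      case 2
      have seg: "{xs ! k, xs ! Suc k} \<in> E - {e}" if "k \<noteq> i" "Suc k < ?n" for k
        using distinct_edge_eq[OF xs(2), of k i] 2 that xs(3) by (auto simp: walk_def)
      have r1: "reach (E - {e}) (xs ! Suc i) (xs ! (?n - 1))"
        by (rule reach_segment) (use 2 seg in auto)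
      have r2: "reach (E - {e}) (xs ! 0) (xs ! i)"
        by (rule reach_segment) (use 2 seg in auto)
      have "{last xs, hd xs} \<in> E - {e}" using closing[of i] xs(4) 2 by auto
      then have "reach (E - {e}) (xs ! (?n - 1)) (xs ! 0)" unfolding hl by (rule reach_edge)
      then have "reach (E - {e}) (xs ! i) (xs ! Suc i)"
        using r1 r2 reach_trans reach_sym by meson
      moreover have "xs ! i \<noteq> xs ! Suc i" using 2 xs(2) by (simp add: nth_eq_iff_index_eq)
      ultimately show ?thesis using 2 by blast
    qed
  qed
  ultimately show ?thesis using that by blast
qed

lemma acyclic_graph_insert:
  assumes "x \<noteq> y" "{x, y} \<notin> E"
  shows "acyclic_graph (insert {x, y} E) \<longleftrightarrow> acyclic_graph E \<and> \<not> reach E x y"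
proof
  assume h: "acyclic_graph (insert {x, y} E)"
  have "insert {x, y} E - {{x, y}} = E" using assms by auto
  then show "acyclic_graph E \<and> \<not> reach E x y"
    using acyclic_graph_bridge[OF h _ assms(1)] acyclic_graph_mono[OF h] by auto
next
  assume h: "acyclic_graph E \<and> \<not> reach E x y"
  show "acyclic_graph (insert {x, y} E)"
  proof (rule ccontr)
    assume "\<not> ?thesis"
    then obtain C where C: "C \<subseteq> insert {x, y} E" "\<not> acyclic_graph C"
      "\<And>e. e \<in> C \<Longrightarrow> \<exists>p q. e = {p, q} \<and> p \<noteq> q \<and> reach (insert {x, y} E - {e}) p q"
      using not_acyclic_cycle_edge by blast
    have "{x, y} \<in> C" using C(1,2) h acyclic_graph_mono by blast
    then obtain p q where "{x, y} = {p, q}" "reach (insert {x, y} E - {{x, y}}) p q"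
      using C(3) by blast
    moreover have "insert {x, y} E - {{x, y}} = E" using assms by auto
    ultimately have "reach E x y" using reach_sym by (auto simp: doubleton_eq_iff)
    then show False using h by simp
  qed
qed

text \<open>A repetition \<open>xs ! i = xs ! (i + d)\<close> with the smallest possible positive d
  encloses a closed walk without further repetition. Here d = 1 would be a loop, d = 2 a
  backtracking, and d at least 3 gives a cycle.\<close>

lemma nonbacktracking_distinct:
  assumes ac: "acyclic_graph E" and loop: "\<And>x. {x} \<notin> E" and w: "walk E xs"
    and nb: "\<And>i. i + 2 < length xs \<Longrightarrow> xs ! i \<noteq> xs ! (i + 2)"
  shows "distinct xs"
proof (rule ccontr)
  assume "\<not> distinct xs"
  then have ex: "\<exists>d. \<exists>i. i + d < length xs \<and> 0 < d \<and> xs ! i = xs ! (i + d)"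
  proof -
    obtain i j where "i < length xs" "j < length xs" "i \<noteq> j" "xs ! i = xs ! j"
      using \<open>\<not> distinct xs\<close> unfolding distinct_conv_nth by blast
    then have "\<exists>i j. i < j \<and> j < length xs \<and> xs ! i = xs ! j" by (metis linorder_neqE_nat)
    then obtain i j where "i < j" "j < length xs" "xs ! i = xs ! j" by blast
    then show ?thesis by (intro exI[of _ "j - i"] exI[of _ i]) simp
  qed
  define d where "d = (LEAST d. \<exists>i. i + d < length xs \<and> 0 < d \<and> xs ! i = xs ! (i + d))"
  obtain i where i: "i + d < length xs" "0 < d" "xs ! i = xs ! (i + d)"
    using LeastI_ex[OF ex] unfolding d_def by blast
  have least: "xs ! j \<noteq> xs ! (j + d')" if "d' < d" "0 < d'" "j + d' < length xs" for d' j
    using not_less_Least[of d' "\<lambda>d. \<exists>i. i + d < length xs \<and> 0 < d \<and> xs ! i = xs ! (i + d)"]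
      that unfolding d_def by blast
  have edge: "{xs ! j, xs ! Suc j} \<in> E" if "Suc j < length xs" for j
    using w that by (auto simp: walk_def)
  have "d \<noteq> 1" using edge[of i] i loop by (auto)
  moreover have "d \<noteq> 2" using nb[of i] i by auto
  ultimately have d3: "d \<ge> 3" using i(2) by linarith
  define ys where "ys = take d (drop i xs)"
  have len: "length ys = d" using i by (simp add: ys_def)
  have nth: "ys ! j = xs ! (i + j)" if "j < d" for j using that i by (simp add: ys_def)
  have "distinct ys" unfolding distinct_conv_nth len
  proof (intro allI impI)
    fix a b assume ab: "a < d" "b < d" "a \<noteq> b"
    have *: "xs ! (i + a) \<noteq> xs ! (i + b)" if "a < b" "b < d" for a b
      using least[of "b - a" "i + a"] that i by auto
    show "ys ! a \<noteq> ys ! b" using *[of a b] *[of b a] ab nth by (metis linorder_neqE_nat)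
  qed
  moreover have "walk E ys" unfolding ys_def using w i d3 walk_take walk_drop by auto
  moreover have "{last ys, hd ys} \<in> E"
  proof -
    have "ys \<noteq> []" using len d3 by auto
    then have "last ys = xs ! (i + (d - 1))" "hd ys = xs ! i"
      using nth[of "d-1"] nth[of 0] d3 len by (auto simp: last_conv_nth hd_conv_nth)
    moreover have "{xs ! (i + (d - 1)), xs ! Suc (i + (d - 1))} \<in> E" using edge[of "i + (d-1)"] i d3 by simp
    moreover have "Suc (i + (d - 1)) = i + d" using d3 by simp
    ultimately show ?thesis using i(3) by simp
  qed
  ultimately show False using ac len d3 unfolding acyclic_graph_def by blast
qed

text \<open>Strip the common beginning. Where the paths separate, the reversed rest of one followed
  by the rest of the other is a walk without backtracking, hence simple, although the common end
  occurs in it twice.\<close>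

lemma path_unique:
  assumes ac: "acyclic_graph E" and loop: "\<And>x. {x} \<notin> E"
  shows "walk E ps \<Longrightarrow> distinct ps \<Longrightarrow> walk E qs \<Longrightarrow> distinct qs \<Longrightarrow>
    hd ps = hd qs \<Longrightarrow> last ps = last qs \<Longrightarrow> ps = qs"
proof (induction ps arbitrary: qs)
  case Nil
  then show ?case by (simp add: walk_def)
next
  case (Cons x ps)
  then obtain qs' where q: "qs = x # qs'" by (cases qs) (auto simp: walk_def)
  show ?case
  proof (cases "ps = [] \<or> qs' = []")
    case True
    then show ?thesis using Cons.prems q by (cases ps; cases qs') (auto split: if_splits)
  next
    case False
    then have ne: "ps \<noteq> []" "qs' \<noteq> []" by auto
    show ?thesis
    proof (cases "hd ps = hd qs'")
      case True
      then show ?thesis using Cons ne q by (simp add: walk_Cons)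
    next
      case neq: False
      let ?z = "rev ps @ x # qs'"
      have wz: "walk E ?z"
        using Cons.prems ne q by (intro walk_append walk_rev) (auto simp: walk_Cons last_rev insert_commute)
      have dd: "distinct (rev ps @ [x])" "distinct (x # qs')" using Cons.prems q by auto
      have "distinct ?z"
      proof (rule nonbacktracking_distinct[OF ac loop wz])
        fix i assume i: "i + 2 < length ?z"
        let ?m = "length ps"
        consider "i + 2 \<le> ?m" | "i \<ge> ?m" | "i + 1 = ?m" by linarith
        then show "?z ! i \<noteq> ?z ! (i + 2)"
        proof cases
          case 1
          have "?z ! j = (rev ps @ [x]) ! j" if "j \<le> ?m" for j
            using that by (auto simp: nth_append)
          then show ?thesis using 1 dd(1) by (simp add: nth_eq_iff_index_eq del: distinct_append)
        next
          case 2
          have "?z ! j = (x # qs') ! (j - ?m)" if "j \<ge> ?m" for j using that by (auto simp: nth_append)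
          then show ?thesis using 2 i nth_eq_iff_index_eq[OF dd(2), of "i - ?m" "i + 2 - ?m"] by auto
        next
          case 3
          then have "?z ! i = hd ps" using ne by (auto simp: nth_append rev_nth hd_conv_nth)
          moreover have "i + 2 = ?m + 1" using 3 by simp
          then have "?z ! (i + 2) = hd qs'" using ne by (simp add: nth_append hd_conv_nth)
          ultimately show ?thesis using neq by simp
        qed
      qed
      moreover have "last ps = last qs'" using Cons.prems q ne by simp
      moreover have "last ps \<in> set ps" "last qs' \<in> set qs'" using ne by auto
      ultimately show ?thesis by auto
    qed
  qed
qed

lemma tpath_eq:
  assumes "acyclic_graph E" "\<And>x. {x} \<notin> E" "walk E xs" "distinct xs"
  shows "tpath E (hd xs) (last xs) = xs"
  unfolding tpath_def
proof (rule the_equality)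
  fix ys assume "walk E ys \<and> distinct ys \<and> hd ys = hd xs \<and> last ys = last xs"
  then show "ys = xs" using path_unique[OF assms(1,2), of ys xs] assms(3,4) by blast
qed (use assms in blast)

section \<open>Cells of the gasket\<close>

text \<open>Barycentric coordinates with respect to \<open>u 1\<close>, \<open>u 2\<close>,
  \<open>u 3\<close>.\<close>

definition bary :: "nat \<Rightarrow> complex \<Rightarrow> real" where
  "bary j x = (if j = 3 then 2 / sqrt 3 * Im x
     else if j = 2 then Re x - Im x / sqrt 3
     else 1 - Re x - Im x / sqrt 3)"

definition Tri :: "complex set" where
  "Tri = {x. \<forall>j\<in>idx. bary j x \<ge> 0}"

text \<open>Cells are filled closed triangles instead of pieces of K. Being convex, they contain the
  edges between their points; being closed, they contain the limits of curve points lying in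
  them.\<close>

definition cell :: "nat list \<Rightarrow> complex set" where
  "cell w = psiw w ` Tri"

lemma idx_cases: "i \<in> idx \<Longrightarrow> (i = 1 \<Longrightarrow> P) \<Longrightarrow> (i = 2 \<Longrightarrow> P) \<Longrightarrow> (i = 3 \<Longrightarrow> P) \<Longrightarrow> P"
  by (auto simp: idx_def)

lemma sqrt3_sqrt3 [simp]: "sqrt 3 * (sqrt 3 * x) = 3 * x"
  by (simp flip: mult.assoc)

lemma bary_u: "i \<in> idx \<Longrightarrow> j \<in> idx \<Longrightarrow> bary j (u i) = of_bool (i = j)"
  by (elim idx_cases) (simp_all add: bary_def u_def field_simps)

lemma bary_psi: "i \<in> idx \<Longrightarrow> j \<in> idx \<Longrightarrow> bary j (psi i x) = bary j x / 2 + of_bool (i = j) / 2"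
  by (elim idx_cases) (simp_all add: bary_def u_def psi_def field_simps)

lemma bary_sum: "bary 1 x + bary 2 x + bary 3 x = 1"
  by (simp add: bary_def field_simps)

lemma bary_inj: "(\<And>j. j \<in> idx \<Longrightarrow> bary j x = bary j y) \<Longrightarrow> x = y"
proof -
  assume h: "\<And>j. j \<in> idx \<Longrightarrow> bary j x = bary j y"
  have "bary 3 x = bary 3 y" "bary 2 x = bary 2 y" using h by (simp_all add: idx_def)
  then show "x = y" by (simp add: bary_def complex_eq_iff)
qed

lemma u_in_Tri: "i \<in> idx \<Longrightarrow> u i \<in> Tri"
  by (auto simp: Tri_def bary_u)

lemma u_inj: "i \<in> idx \<Longrightarrow> j \<in> idx \<Longrightarrow> u i = u j \<longleftrightarrow> i = j"
proof -
  assume "i \<in> idx" "j \<in> idx"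
  then have "bary i (u i) = 1" "bary i (u j) = of_bool (j = i)" by (simp_all add: bary_u)
  then show ?thesis by (cases "i = j") auto
qed

lemma psi_in_Tri: "i \<in> idx \<Longrightarrow> x \<in> Tri \<Longrightarrow> psi i x \<in> Tri"
  by (auto simp: Tri_def bary_psi)

lemma psi_inj: "psi i x = psi i y \<longleftrightarrow> x = y"
  by (simp add: psi_def)

lemma psi_u_commute: "psi i (u j) = psi j (u i)"
  by (simp add: psi_def field_simps)

lemma psi_u_self [simp]: "psi i (u i) = u i"
  by (simp add: psi_def)

lemma psiw_inj: "psiw w x = psiw w y \<longleftrightarrow> x = y"
  by (induction w arbitrary: x y) (simp_all add: psi_inj)

lemma psiw_image_inj: "psiw w ` A = psiw w ` B \<longleftrightarrow> A = B"
  by (rule inj_image_eq_iff) (simp add: inj_def psiw_inj)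

lemma psiw_append: "psiw (v @ w) x = psiw v (psiw w x)"
  by (induction v) simp_all

lemma psiw_affine: "\<exists>c. \<forall>x. psiw w x = (1 / 2) ^ length w *\<^sub>R x + c"
proof (induction w)
  case Nil
  show ?case by (rule exI[of _ 0]) simp
next
  case (Cons i w)
  then obtain c where "\<forall>x. psiw w x = (1 / 2) ^ length w *\<^sub>R x + c" by blast
  then show ?case
    by (intro exI[of _ "(c + u i) / 2"]) (simp add: psi_def field_simps scaleR_conv_of_real)
qed

lemma psiw_in_Tri: "set w \<subseteq> idx \<Longrightarrow> x \<in> Tri \<Longrightarrow> psiw w x \<in> Tri"
  by (induction w) (auto simp: psi_in_Tri)

lemma cell_append: "set v \<subseteq> idx \<Longrightarrow> cell (w @ v) \<subseteq> cell w"
  by (auto simp: cell_def psiw_append psiw_in_Tri)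

lemma cell_corner: "c \<in> idx \<Longrightarrow> psiw w (u c) \<in> cell w"
  by (simp add: cell_def u_in_Tri)

lemma convex_Tri: "convex Tri"
proof -
  have "bary j (a *\<^sub>R x + b *\<^sub>R y) = a * bary j x + b * bary j y" if "a + b = 1" for j a b x y
  proof -
    have b: "b = 1 - a" using that by simp
    show ?thesis unfolding b by (simp add: bary_def field_simps)
  qed
  then show ?thesis unfolding convex_def Tri_def by (auto)
qed

lemma continuous_on_bary: "continuous_on UNIV (bary j)"
  by (cases "j = 3"; cases "j = 2") (auto simp: bary_def[abs_def] intro!: continuous_intros)

lemma closed_Tri: "closed Tri"
proof -
  have "Tri = (\<Inter>j\<in>idx. {x. 0 \<le> bary j x})" by (auto simp: Tri_def)
  also have "closed \<dots>"
    by (intro closed_INT ballI closed_Collect_le continuous_on_const continuous_on_bary)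
  finally show ?thesis .
qed

lemma cell_affine: "\<exists>c. cell w = (\<lambda>x. c + (1 / 2) ^ length w *\<^sub>R x) ` Tri"
proof -
  obtain c where "\<forall>x. psiw w x = (1 / 2) ^ length w *\<^sub>R x + c" using psiw_affine by blast
  then show ?thesis by (intro exI[of _ c]) (auto simp: cell_def add.commute)
qed

lemma convex_cell: "convex (cell w)"
  using cell_affine[of w] convex_affinity[OF convex_Tri] by metis

lemma closed_cell: "closed (cell w)"
proof -
  obtain c where c: "cell w = (\<lambda>x. c + (1 / 2) ^ length w *\<^sub>R x) ` Tri" using cell_affine by blast
  have "cell w = (+) c ` ((*\<^sub>R) ((1 / 2) ^ length w) ` Tri)" unfolding c by (simp add: image_image)
  then show ?thesis using closed_translation closed_scaling closed_Tri by metis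
qed

lemma corner_in_cell:
  assumes "set v \<subseteq> idx" "j \<in> idx" "u j \<in> cell v"
  shows "psiw v (u j) = u j"
  using assms
proof (induction v)
  case (Cons i v)
  then obtain x where x: "x \<in> Tri" "u j = psi i (psiw v x)" by (auto simp: cell_def)
  have z: "psiw v x \<in> Tri" using Cons x psiw_in_Tri by auto
  have i: "i \<in> idx" using Cons by simp
  \<comment> \<open>For i different from j, every point in the image of \<open>Tri\<close> under
    \<open>psi i\<close> has coordinate j at most 1/2, whereas that coordinate of \<open>u j\<close>
    is 1.\<close>
  have "bary j (psiw v x) / 2 + of_bool (i = j) / 2 = 1"
    using bary_psi[OF i \<open>j \<in> idx\<close>, of "psiw v x"] bary_u[of j j] x(2) Cons.prems by simp
  moreover have "bary j (psiw v x) \<le> 1"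
    using z bary_sum[of "psiw v x"] \<open>j \<in> idx\<close> by (auto simp: Tri_def idx_def)
  ultimately have ij: "i = j" by (cases "i = j") auto
  then have "psiw v x = u j" using x(2) psi_inj psi_u_self by metis
  then have "u j \<in> cell v" using x by (auto simp: cell_def)
  then show ?case using Cons ij by simp
qed simp

text \<open>A common point of the two half-size triangles has coordinates i and j both at least 1/2.
  As the coordinates are nonnegative with sum 1, it is the midpoint of the side from
  \<open>u i\<close> to \<open>u j\<close>.\<close>

lemma psi_Tri_inter:
  assumes "i \<in> idx" "j \<in> idx" "i \<noteq> j" "x \<in> Tri" "y \<in> Tri" "psi i x = psi j y"
  shows "x = u j \<and> y = u i"
proof -
  have b: "bary k x + of_bool (i = k) = bary k y + of_bool (j = k)" if "k \<in> idx" for k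
    using bary_psi[OF assms(1) that, of x] bary_psi[OF assms(2) that, of y] assms(6) by simp
  have nn: "bary k x \<ge> 0 \<and> bary k y \<ge> 0" if "k \<in> idx" for k using assms that by (auto simp: Tri_def)
  have le: "bary 1 x \<ge> 0" "bary 2 x \<ge> 0" "bary 3 x \<ge> 0" "bary 1 y \<ge> 0" "bary 2 y \<ge> 0" "bary 3 y \<ge> 0"
    using nn by (simp_all add: idx_def)
  have e: "bary 1 x + of_bool (i = 1) = bary 1 y + of_bool (j = 1)"
    "bary 2 x + of_bool (i = 2) = bary 2 y + of_bool (j = 2)"
    "bary 3 x + of_bool (i = 3) = bary 3 y + of_bool (j = 3)"
    using b by (simp_all add: idx_def)
  have "bary k x = of_bool (j = k) \<and> bary k y = of_bool (i = k)" if "k \<in> idx" for k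
    using assms(1-3) that le e bary_sum[of x] bary_sum[of y]
    by (elim idx_cases) (simp_all add: of_bool_def)
  then have "bary k x = bary k (u j)" "bary k y = bary k (u i)" if "k \<in> idx" for k
    using assms(1,2) that by (simp_all add: bary_u)
  then show ?thesis using bary_inj by blast
qed

text \<open>Up to the first letter where the words differ, both cells are images under the same map.
  From there on they lie in two half-size triangles meeting only in a midpoint, and by
  \<open>corner_in_cell\<close> this point can belong to the smaller cell only as a corner.\<close>

lemma cell_inter:
  assumes "length v = length w" "set v \<subseteq> idx" "set w \<subseteq> idx" "v \<noteq> w"
  shows "\<exists>p. cell v \<inter> cell w \<subseteq> {p} \<and> (cell v \<inter> cell w \<noteq> {} \<longrightarrow>
    (\<exists>c\<in>idx. p = psiw v (u c)))"
  using assms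
proof (induction v w rule: list_induct2)
  case (Cons i v j w)
  show ?case
  proof (cases "i = j")
    case True
    then have vw: "v \<noteq> w" using Cons.prems by auto
    obtain p where p: "cell v \<inter> cell w \<subseteq> {p}"
      "cell v \<inter> cell w \<noteq> {} \<longrightarrow> (\<exists>c\<in>idx. p = psiw v (u c))"
      using Cons.IH Cons.prems vw by auto
    have eq: "cell (i # v) \<inter> cell (j # w) = psi i ` (cell v \<inter> cell w)"
      using True by (auto simp: cell_def psi_inj)
    show ?thesis unfolding eq using p by (intro exI[of _ "psi i p"]) auto
  next
    case False
    have ij: "i \<in> idx" "j \<in> idx" "set v \<subseteq> idx" "set w \<subseteq> idx" using Cons.prems by auto
    have *: "z = psi i (u j) \<and> u j \<in> cell v" if zi: "z \<in> cell (i # v)" and zj: "z \<in> cell (j # w)" for z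
    proof -
      obtain x where x: "x \<in> Tri" "z = psi i (psiw v x)" using zi by (auto simp: cell_def)
      obtain y where y: "y \<in> Tri" "z = psi j (psiw w y)" using zj by (auto simp: cell_def)
      note xy = x y
      then have "psiw v x = u j"
        using psi_Tri_inter[OF ij(1,2) False] psiw_in_Tri ij by metis
      moreover from this have "u j \<in> cell v" unfolding cell_def using x(1) by (metis imageI)
      ultimately show ?thesis using x(2) by simp
    qed
    show ?thesis
    proof (intro exI[of _ "psi i (u j)"] conjI impI)
      show "cell (i # v) \<inter> cell (j # w) \<subseteq> {psi i (u j)}" using * by blast
      assume "cell (i # v) \<inter> cell (j # w) \<noteq> {}"
      then have "u j \<in> cell v" using * by blast
      then have "psiw v (u j) = u j" using corner_in_cell ij by blast
      then show "\<exists>c\<in>idx. psi i (u j) = psiw (i # v) (u c)" using ij by (intro bexI[of _ j]) auto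
    qed
  qed
qed simp

lemma cell_inter_corner:
  assumes "length v = length w" "set v \<subseteq> idx" "set w \<subseteq> idx" "v \<noteq> w" "x \<in> cell v" "x \<in> cell w"
  shows "\<exists>c\<in>idx. x = psiw v (u c)"
  using cell_inter[OF assms(1-4)] assms(5,6) by blast

lemma cell_inter_unique:
  assumes "length v = length w" "set v \<subseteq> idx" "set w \<subseteq> idx" "v \<noteq> w"
    "x \<in> cell v" "x \<in> cell w" "y \<in> cell v" "y \<in> cell w"
  shows "x = y"
  using cell_inter[OF assms(1-4)] assms(5-) by blast

section \<open>Words and the decomposition of the graphs into cells\<close>

lemma words_Suc: "words (Suc n) = (\<Union>i\<in>idx. (#) i ` words n)"
  by (auto simp: words_def length_Suc_conv)

lemma words_0 [simp]: "words 0 = {[]}"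
  by (auto simp: words_def)

lemma finite_idx [simp]: "finite idx" by (simp add: idx_def)

lemma finite_words [simp]: "finite (words n)"
  by (induction n) (simp_all add: words_Suc)

lemma words_snoc: "w @ [i] \<in> words (Suc n) \<longleftrightarrow> w \<in> words n \<and> i \<in> idx"
  by (auto simp: words_def)

lemma wordsD: "w \<in> words n \<Longrightarrow> length w = n" "w \<in> words n \<Longrightarrow> set w \<subseteq> idx"
  by (auto simp: words_def)

lemma EG_words: "EG (n + m) = (\<Union>w\<in>words n. (`) (psiw w) ` EG m)"
proof (induction n)
  case (Suc n)
  show ?case by (auto simp: Suc words_Suc image_comp image_image image_UN)
qed simp

lemma VG_words: "VG (n + m) = (\<Union>w\<in>words n. psiw w ` VG m)"
proof (induction n)
  case (Suc n)
  show ?case by (auto simp: Suc words_Suc image_comp image_image image_UN)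
qed simp

lemma finite_EG: "finite (EG n)"
  by (induction n) auto

lemma EG0_iff: "e \<in> EG 0 \<longleftrightarrow> (\<exists>a\<in>idx. \<exists>b\<in>idx. a \<noteq> b \<and> e = {u a, u b})"
  by (auto simp: idx_def)

lemma EG_edge:
  assumes "e \<in> EG n"
  shows "\<exists>x y. e = {x, y} \<and> x \<noteq> y \<and> x \<in> VG n \<and> y \<in> VG n \<and> x \<in> Tri \<and> y \<in> Tri"
  using assms
proof (induction n arbitrary: e)
  case 0
  then obtain a b where ab: "a \<in> idx" "b \<in> idx" "a \<noteq> b" "e = {u a, u b}" using EG0_iff by blast
  have "u c \<in> VG 0" if "c \<in> idx" for c using that by (auto simp: idx_def)
  then show ?case using ab u_inj u_in_Tri by blast
next
  case (Suc n)
  then obtain i e' where e': "i \<in> idx" "e' \<in> EG n" "e = psi i ` e'" by auto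
  then obtain x y where "e' = {x, y} \<and> x \<noteq> y \<and> x \<in> VG n \<and> y \<in> VG n \<and> x \<in> Tri \<and> y \<in> Tri"
    using Suc.IH by blast
  then show ?case using e' by (intro exI[of _ "psi i x"] exI[of _ "psi i y"]) (auto simp: psi_inj psi_in_Tri)
qed

lemma EG_no_loop: "{x} \<notin> EG n"
  using EG_edge[of "{x}" n] by (auto simp: doubleton_eq_iff)

text \<open>An edge has two different ends, while two cells of one level share at most one point. So
  the cells split the edges of a graph disjointly.\<close>

lemma edge_cell_unique:
  assumes "v \<in> words k" "w \<in> words k" "e \<in> EG n" "e' \<in> EG m" "psiw v ` e = psiw w ` e'"
  shows "v = w \<and> e = e'"
proof -
  obtain x y where e: "e = {x, y}" "x \<noteq> y" "x \<in> Tri" "y \<in> Tri" using EG_edge assms(3) by blast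
  have e': "e' \<subseteq> Tri" using EG_edge assms(4) by blast
  have "psiw v x \<in> cell v" "psiw v y \<in> cell v" using e by (auto simp: cell_def)
  moreover have "psiw w ` e' \<subseteq> cell w" using e' by (auto simp: cell_def)
  then have "psiw v ` e \<subseteq> cell w" by (simp add: assms(5))
  then have "psiw v x \<in> cell w" "psiw v y \<in> cell w" using e(1) by auto
  ultimately have "v = w"
    using cell_inter_unique[of v w "psiw v x" "psiw v y"] e(2) wordsD[OF assms(1)] wordsD[OF assms(2)]
    by (auto simp: psiw_inj)
  then show ?thesis using assms(5) psiw_image_inj by blast
qed

text \<open>The map \<open>pi_w\<close> with the depth inside the cell as a parameter: m = 1 gives
  the filling of w on which the trace acts, m = 0 the edges of a cell of the last level.\<close>

definition sub :: "nat \<Rightarrow> nat list \<Rightarrow> complex set set \<Rightarrow> complex set set" where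
  "sub m w t = {e \<in> EG m. psiw w ` e \<in> t}"

lemma sub_subset: "sub m w t \<subseteq> EG m"
  by (auto simp: sub_def)

lemma piw_eq: "piw w t = sub 1 w t"
  by (simp add: piw_def sub_def)

lemma sub_Union:
  assumes "w \<in> words n" "\<And>v. v \<in> words n \<Longrightarrow> F v \<subseteq> EG m"
  shows "sub m w (\<Union>v\<in>words n. (`) (psiw v) ` F v) = F w"
proof
  show "sub m w (\<Union>v\<in>words n. (`) (psiw v) ` F v) \<subseteq> F w"
  proof
    fix e assume e: "e \<in> sub m w (\<Union>v\<in>words n. (`) (psiw v) ` F v)"
    then obtain v e' where v: "v \<in> words n" "e' \<in> F v" "psiw w ` e = psiw v ` e'" "e \<in> EG m"
      by (auto simp: sub_def)
    then have "e' \<in> EG m" using assms(2)[OF v(1)] v(2) by blast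
    then show "e \<in> F w" using edge_cell_unique[of w n v e m e' m] assms(1) v by auto
  qed
qed (use assms in \<open>auto simp: sub_def\<close>)

lemma sub_snoc: "i \<in> idx \<Longrightarrow> sub 0 (w @ [i]) t = sub 0 [i] (sub 1 w t)"
proof -
  assume i: "i \<in> idx"
  have "psiw (w @ [i]) ` e = psiw w ` psi i ` e" for e by (auto simp: psiw_append image_image)
  moreover have "psi i ` e \<in> EG 1" if "e \<in> EG 0" for e using that i by (auto simp: numeral_eq_Suc)
  ultimately show ?thesis by (auto simp: sub_def)
qed

section \<open>A finite model of the spanning subgraphs of level one\<close>

datatype vx = V1 | V2 | V3 | V12 | V13 | V23

fun vpos :: "vx \<Rightarrow> complex" where
  "vpos V1 = u 1" | "vpos V2 = u 2" | "vpos V3 = u 3"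
| "vpos V12 = psi 1 (u 2)" | "vpos V13 = psi 1 (u 3)" | "vpos V23 = psi 2 (u 3)"

definition verts :: "vx list" where "verts = [V1, V2, V3, V12, V13, V23]"

lemma set_verts [simp]: "x \<in> set verts"
  by (cases x) (simp_all add: verts_def)

type_synonym lab = "(vx \<times> vx) list"

fun lab_of :: "lab \<Rightarrow> vx \<Rightarrow> vx" where
  "lab_of [] x = x"
| "lab_of ((a, l) # r) x = (if a = x then l else lab_of r x)"

definition lab0 :: lab where "lab0 = map (\<lambda>v. (v, v)) verts"

fun relabel :: "lab \<Rightarrow> vx \<Rightarrow> vx \<Rightarrow> lab" where
  "relabel L p q = map (\<lambda>(v, l). (v, if l = p then q else l)) L"

fun addedge :: "vx \<times> vx \<Rightarrow> lab \<times> bool \<Rightarrow> lab \<times> bool" where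
  "addedge (x, y) (L, ac) = (let p = lab_of L x; q = lab_of L y in
     if p = q then (L, False) else (relabel L p q, ac))"

text \<open>A union-find procedure: every vertex starts as its own component, each edge merges two
  labels, and the flag becomes false when an edge joins vertices with equal labels, that is, closes
  a cycle.\<close>

definition edge_components :: "(vx \<times> vx) list \<Rightarrow> lab \<times> bool" where
  "edge_components es = foldr addedge es (lab0, True)"

definition edges_of :: "(vx \<times> vx) list \<Rightarrow> complex set set" where
  "edges_of es = (\<lambda>(x, y). {vpos x, vpos y}) ` set es"

lemma vpos_inj: "vpos x = vpos y \<longleftrightarrow> x = y"
proof -
  have "(bary 1 (vpos x), bary 2 (vpos x), bary 3 (vpos x)) =
    (case x of V1 \<Rightarrow> (1, 0, 0) | V2 \<Rightarrow> (0, 1, 0) | V3 \<Rightarrow> (0, 0, 1)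
       | V12 \<Rightarrow> (1/2, 1/2, 0) | V13 \<Rightarrow> (1/2, 0, 1/2) | V23 \<Rightarrow> (0, 1/2, 1/2))" for x
    by (cases x) (simp_all add: bary_psi bary_u idx_def)
  note * = this
  show ?thesis using *[of x] *[of y] by (cases x; cases y) auto
qed

lemma lab_of_lab0: "lab_of lab0 x = x"
  by (cases x) (simp_all add: lab0_def verts_def)

lemma lab_of_relabel:
  "v \<in> set (map fst L) \<Longrightarrow> lab_of (relabel L p q) v = (if lab_of L v = p then q else lab_of L v)"
proof (induction L)
  case (Cons e L)
  then show ?case by (cases e; cases "fst e = v") simp_all
qed simp

lemma reach_empty: "reach {} x y \<longleftrightarrow> x = y"
proof
  assume "reach {} x y" then show "x = y" by (induction rule: reach_induct) auto
qed simp

text \<open>A second copy of an undirected edge, in either orientation, would be mistaken by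
  \<open>addedge\<close> for an edge closing a cycle.\<close>

definition simple_edges :: "(vx \<times> vx) list \<Rightarrow> bool" where
  "simple_edges es \<longleftrightarrow> distinct es \<and> (\<forall>(x, y)\<in>set es. x \<noteq> y \<and> (y, x) \<notin> set es)"

lemma edge_components_correct:
  assumes "simple_edges es"
  shows "map fst (fst (edge_components es)) = verts \<and>
    (\<forall>x y. lab_of (fst (edge_components es)) x = lab_of (fst (edge_components es)) y
        \<longleftrightarrow> reach (edges_of es) (vpos x) (vpos y)) \<and>
    (snd (edge_components es) \<longleftrightarrow> acyclic_graph (edges_of es))"
  using assms
proof (induction es)
  case Nil
  have "acyclic_graph {}"
  proof -
    have "\<not> walk {} xs" if "length xs \<ge> 3" for xs using that by (auto simp: walk_def intro!: exI[of _ 0])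
    then show ?thesis unfolding acyclic_graph_def by blast
  qed
  moreover have "map fst lab0 = verts" by (simp add: lab0_def comp_def)
  ultimately show ?case by (simp add: edge_components_def edges_of_def reach_empty lab_of_lab0 vpos_inj)
next
  case (Cons e es)
  obtain x y where e: "e = (x, y)" by (cases e)
  obtain L ac where L: "edge_components es = (L, ac)" by (cases "edge_components es")
  have simple: "simple_edges es" using Cons.prems by (auto simp: simple_edges_def)
  have IH: "map fst L = verts" "\<And>x y. lab_of L x = lab_of L y \<longleftrightarrow> reach (edges_of es) (vpos x) (vpos y)"
    "ac \<longleftrightarrow> acyclic_graph (edges_of es)"
    using Cons.IH[OF simple] L by simp_all
  have xy: "vpos x \<noteq> vpos y" using Cons.prems e by (auto simp: simple_edges_def vpos_inj)
  have new: "{vpos x, vpos y} \<notin> edges_of es"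
    using Cons.prems e by (auto simp: simple_edges_def edges_of_def doubleton_eq_iff vpos_inj)
  have ins: "edges_of (e # es) = insert {vpos x, vpos y} (edges_of es)"
    by (simp add: edges_of_def e)
  have comp: "edge_components (e # es) = addedge (x, y) (L, ac)"
    using L by (simp add: edge_components_def e)
  have lab: "lab_of (relabel L p q) v = (if lab_of L v = p then q else lab_of L v)" for v p q
    by (rule lab_of_relabel) (simp only: IH(1) set_verts)
  show ?case
  proof (cases "lab_of L x = lab_of L y")
    case True
    then have r: "reach (edges_of es) (vpos x) (vpos y)" using IH(2) by simp
    then have "reach (edges_of (e # es)) a b \<longleftrightarrow> reach (edges_of es) a b" for a b
      unfolding ins reach_insert using reach_trans reach_sym by blast
    moreover have "\<not> acyclic_graph (edges_of (e # es))"
      unfolding ins acyclic_graph_insert[OF xy new] using r by simp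
    ultimately show ?thesis using True IH comp by simp
  next
    case False
    then have nr: "\<not> reach (edges_of es) (vpos x) (vpos y)" using IH(2) by simp
    have "map fst (relabel L p q) = map fst L" for p q by (induction L) auto
    moreover have "lab_of (relabel L (lab_of L x) (lab_of L y)) a = lab_of (relabel L (lab_of L x) (lab_of L y)) b
      \<longleftrightarrow> reach (edges_of (e # es)) (vpos a) (vpos b)" for a b
      unfolding ins reach_insert lab IH(2)[symmetric] using False by auto
    moreover have "ac \<longleftrightarrow> acyclic_graph (edges_of (e # es))"
      unfolding ins acyclic_graph_insert[OF xy new] IH(3) using nr by simp
    ultimately show ?thesis using False comp IH(1) by simp
  qed
qed

text \<open>A cell state records, for i = 1, 2, 3, whether the edge opposite to corner i is present.\<close>

type_synonym cs = "bool \<times> bool \<times> bool"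

fun opp :: "cs \<Rightarrow> nat \<Rightarrow> bool" where
  "opp (a, b, c) i = (if i = 1 then a else if i = 2 then b else c)"

fun cell_edges :: "cs \<Rightarrow> vx \<Rightarrow> vx \<Rightarrow> vx \<Rightarrow> (vx \<times> vx) list" where
  "cell_edges (a, b, c) x y z = (if a then [(y, z)] else []) @ (if b then [(x, z)] else []) @
     (if c then [(x, y)] else [])"

definition es1 :: "cs \<Rightarrow> (vx \<times> vx) list" where "es1 s = cell_edges s V1 V12 V13"
definition es2 :: "cs \<Rightarrow> (vx \<times> vx) list" where "es2 s = cell_edges s V12 V2 V23"
definition es3 :: "cs \<Rightarrow> (vx \<times> vx) list" where "es3 s = cell_edges s V13 V23 V3"

fun joined :: "lab \<Rightarrow> vx \<Rightarrow> vx \<Rightarrow> bool" where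
  "joined L x y \<longleftrightarrow> lab_of L x = lab_of L y"

text \<open>\<open>KTree i\<close> and \<open>KForest i\<close> are the preimages under \<open>Tr\<close> of the tree with centre i and of the
  forest separating i. The value \<open>KTree 0\<close> (no centre, or more than one) never occurs.\<close>

datatype kind = KTree nat | KForest nat | KOther

text \<open>In a tree the path between two corners stays in two of the subcells exactly when these
  two alone already connect the corners. So \<open>d12\<close>, \<open>d13\<close>,
  \<open>d23\<close> are connectivity tests, and the centre is the index for which both tests
  succeed while the remaining one fails.\<close>

definition kind_of :: "cs \<times> cs \<times> cs \<Rightarrow> kind" where
  "kind_of c = (case c of (s1, s2, s3) \<Rightarrow> case edge_components (es1 s1 @ es2 s2 @ es3 s3) of (L, ac) \<Rightarrow>
    if \<not> ac then KOther
    else if list_all (joined L V1) verts then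
      (let d12 = joined (fst (edge_components (es1 s1 @ es2 s2))) V1 V2;
           d13 = joined (fst (edge_components (es1 s1 @ es3 s3))) V1 V3;
           d23 = joined (fst (edge_components (es2 s2 @ es3 s3))) V2 V3 in
       if d12 \<and> d13 \<and> \<not> d23 then KTree 1 else if d12 \<and> d23 \<and> \<not> d13 then KTree 2
       else if d13 \<and> d23 \<and> \<not> d12 then KTree 3 else KTree 0)
    else if list_all (\<lambda>v. joined L V1 v \<or> joined L V2 v \<or> joined L V3 v) verts then
      (if joined L V2 V3 \<and> \<not> joined L V1 V2 then KForest 1
       else if joined L V1 V3 \<and> \<not> joined L V1 V2 then KForest 2
       else if joined L V1 V2 \<and> \<not> joined L V1 V3 then KForest 3 else KOther)
    else KOther)"

text \<open>Edges are listed by the opposite corner: the tree with centre i lacks only the edge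
  opposite to i, and the forest separating i consists of that edge alone.\<close>

fun state_of :: "kind \<Rightarrow> cs" where
  "state_of (KTree i) = (i \<noteq> 1, i \<noteq> 2, i \<noteq> 3)"
| "state_of (KForest i) = (i = 1, i = 2, i = 3)"
| "state_of KOther = (False, False, False)"

definition third :: "nat \<Rightarrow> nat \<Rightarrow> nat" where "third a b = 6 - a - b"

definition conn :: "cs \<Rightarrow> nat \<Rightarrow> nat \<Rightarrow> bool" where
  "conn s a b \<longleftrightarrow> opp s (third a b) \<or> opp s a \<and> opp s b"

fun comp_state :: "cs \<times> cs \<times> cs \<Rightarrow> nat \<Rightarrow> cs" where
  "comp_state (s1, s2, s3) i = (if i = 1 then s1 else if i = 2 then s2 else s3)"

text \<open>The triples are subcell, entry corner and exit corner. Subcells i and j meet in the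
  point that is corner j of the first and corner i of the second. A crossing goes directly from
  subcell a to subcell b or makes a detour through the third one.\<close>

definition expand :: "cs \<times> cs \<times> cs \<Rightarrow> nat \<Rightarrow> nat \<Rightarrow> (nat \<times> nat \<times> nat) list" where
  "expand c a b = (if conn (comp_state c a) a b \<and> conn (comp_state c b) a b
     then [(a, a, b), (b, a, b)]
     else [(a, a, third a b), (third a b, a, b), (b, third a b, b)])"

text \<open>Type of a crossing from a to b: 0 through one edge of a spanning tree of the cell,
  1 through two edges, 2 through the edge of a two-component forest.\<close>

definition ctype :: "cs \<Rightarrow> nat \<Rightarrow> nat \<Rightarrow> nat" where
  "ctype s a b = (if \<not> opp s (third a b) then 1 else if opp s a \<or> opp s b then 0 else 2)"

definition bools :: "bool list" where "bools = [False, True]"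
definition states :: "cs list" where
  "states = concat (map (\<lambda>a. concat (map (\<lambda>b. map (\<lambda>c. (a, b, c)) bools) bools)) bools)"
definition configs :: "(cs \<times> cs \<times> cs) list" where
  "configs = concat (map (\<lambda>a. concat (map (\<lambda>b. map (\<lambda>c. (a, b, c)) states) states)) states)"

definition kinded :: "(kind \<times> cs \<times> cs \<times> cs) list" where
  "kinded = filter (\<lambda>(k, c). k \<noteq> KOther) (map (\<lambda>c. (kind_of c, c)) configs)"

definition count_type :: "nat \<Rightarrow> nat \<Rightarrow> nat \<Rightarrow> (cs \<times> cs \<times> cs) list \<Rightarrow> nat" where
  "count_type y a b cs = sum_list (map (\<lambda>c. length (filter (\<lambda>(i, x, z). ctype (comp_state c i) x z = y) (expand c a b))) cs)"

text \<open>By the counts in \<open>check_one\<close>, a crossing of type 1 passes through the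
  subcell at the corner it misses for every filling, and one of type 0 for no filling. An unweighted
  count would therefore not decrease in one step from type 1; giving type 0 half the weight of the
  others makes it decrease.\<close>

definition kappa :: "nat \<Rightarrow> nat" where "kappa y = (if y = 0 then 1 else 2)"

text \<open>A crossing from a to b misses the corner \<open>third a b\<close>. Weighed here is the
  part of it in the subcell at that corner, provided that this part misses the corner again.\<close>

definition corner_weight :: "cs \<times> cs \<times> cs \<Rightarrow> nat \<Rightarrow> nat \<Rightarrow> nat" where
  "corner_weight c a b = sum_list (map (\<lambda>(i, x, z).
     if i = third a b \<and> third a b \<noteq> x \<and> third a b \<noteq> z then kappa (ctype (comp_state c i) x z) else 0) (expand c a b))"

definition pairs :: "(nat \<times> nat) list" where
  "pairs = [(1, 2), (1, 3), (2, 1), (2, 3), (3, 1), (3, 2)]"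

text \<open>A tree of \<open>G_0\<close> has 18 preimages under the trace and a two-component forest has 30; the other
  three numbers are the total offspring of types 0, 1, 2 of a crossing of type y over all preimages.
  The second condition is a drift condition: on average \<open>kappa\<close> shrinks by the factor 2/3.\<close>

definition check_one :: "nat \<Rightarrow> nat \<Rightarrow> nat \<Rightarrow> (cs \<times> cs \<times> cs) list \<Rightarrow> bool" where
  "check_one y a b l \<longleftrightarrow>
     (if y = 2 then (length l, count_type 0 a b l, count_type 1 a b l, count_type 2 a b l) = (30, 24, 12, 30)
      else if y = 1 then (length l, count_type 0 a b l, count_type 1 a b l, count_type 2 a b l) = (18, 24, 12, 18)
      else (length l, count_type 0 a b l, count_type 1 a b l, count_type 2 a b l) = (18, 18, 9, 9)) \<and>
     3 * sum_list (map (\<lambda>c. corner_weight c a b) l) \<le> 2 * kappa y * length l \<and>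
     list_all (\<lambda>c. list_all (\<lambda>(i, x, z). conn (comp_state c i) x z) (expand c a b)) l"

definition check_kind :: "(kind \<times> cs \<times> cs \<times> cs) list \<Rightarrow> cs \<Rightarrow> bool" where
  "check_kind T s \<longleftrightarrow> list_all (\<lambda>(a, b). conn s a b \<longrightarrow>
     check_one (ctype s a b) a b (map snd (filter (\<lambda>(k, c). state_of k = s) T))) pairs"

definition check_all :: "(kind \<times> cs \<times> cs \<times> cs) list \<Rightarrow> bool" where
  "check_all T \<longleftrightarrow> list_all (\<lambda>(k, c). k \<noteq> KTree 0) T \<and>
     list_all (check_kind T) [(False, True, True), (True, False, True), (True, True, False),
        (True, False, False), (False, True, False), (False, False, True)]"

text \<open>An evaluation over the 8^3 = 512 spanning subgraphs of \<open>G_1\<close>. That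
  \<open>KTree 0\<close> does not occur means that every spanning tree of \<open>G_1\<close> has
  exactly one centre.\<close>

lemma check: "check_all kinded"
  by code_simp

section \<open>The trace on level one\<close>

declare One_nat_def [simp del] EG.simps [simp del] VG.simps [simp del]

lemma set_verts_UNIV [simp]: "set verts = UNIV"
  by (auto simp del: UNIV_I intro: UNIV_I)

definition cs_of :: "complex set set \<Rightarrow> cs" where
  "cs_of S = ({u 2, u 3} \<in> S, {u 1, u 3} \<in> S, {u 1, u 2} \<in> S)"

definition config_of :: "complex set set \<Rightarrow> cs \<times> cs \<times> cs" where
  "config_of g = (cs_of (sub 0 [1] g), cs_of (sub 0 [2] g), cs_of (sub 0 [3] g))"

lemma EG0: "EG 0 = {{u 2, u 3}, {u 1, u 3}, {u 1, u 2}}"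
  by (auto simp: insert_commute EG.simps)

lemma u_distinct: "u 1 \<noteq> u 2" "u 1 \<noteq> u 3" "u 2 \<noteq> u 3"
  by (simp_all add: u_inj idx_def)

lemma EG0_distinct: "{u 2, u 3} \<noteq> {u 1, u 3}" "{u 2, u 3} \<noteq> {u 1, u 2}" "{u 1, u 3} \<noteq> {u 1, u 2}"
  using u_distinct by (auto simp: doubleton_eq_iff)

lemma opp_cs_of:
  assumes "a \<in> idx" "b \<in> idx" "a \<noteq> b"
  shows "opp (cs_of S) (third a b) \<longleftrightarrow> {u a, u b} \<in> S"
  using assms by (elim idx_cases) (simp_all add: cs_of_def third_def insert_commute)

lemma third_third:
  assumes "a \<in> idx" "b \<in> idx" "a \<noteq> b"
  shows "third a b \<in> idx" "third a b \<noteq> a" "third a b \<noteq> b" "third a (third a b) = b"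
    "third (third a b) b = a" "third b a = third a b" "idx = {a, b, third a b}"
  using assms by (auto simp: third_def idx_def)

lemma cs_of_inj: "S \<subseteq> EG 0 \<Longrightarrow> T \<subseteq> EG 0 \<Longrightarrow> cs_of S = cs_of T \<Longrightarrow> S = T"
  unfolding cs_of_def EG0 by blast

lemma cs_of_surj: "\<exists>S\<subseteq>EG 0. cs_of S = s"
proof -
  obtain a b c where s: "s = (a, b, c)" by (cases s)
  show ?thesis unfolding s EG0 cs_of_def
    by (rule exI[of _ "(if a then {{u 2, u 3}} else {}) \<union> (if b then {{u 1, u 3}} else {}) \<union> (if c then {{u 1, u 2}} else {})"])
      (use EG0_distinct in \<open>auto\<close>)
qed

lemma edges_of_append: "edges_of (x @ y) = edges_of x \<union> edges_of y"
  by (auto simp: edges_of_def)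

lemma cell_edges_image:
  assumes S: "S \<subseteq> EG 0" and "vpos x = f (u 1)" "vpos y = f (u 2)" "vpos z = f (u 3)"
  shows "edges_of (cell_edges (cs_of S) x y z) = (`) f ` S"
proof -
  define p q r where pqr: "p = ({u 2, u 3} \<in> S)" "q = ({u 1, u 3} \<in> S)" "r = ({u 1, u 2} \<in> S)"
  have "S = (if p then {{u 2, u 3}} else {}) \<union> (if q then {{u 1, u 3}} else {}) \<union> (if r then {{u 1, u 2}} else {})"
    using S unfolding EG0 pqr by auto
  moreover have "cs_of S = (p, q, r)" by (simp add: cs_of_def pqr)
  ultimately show ?thesis by (cases p; cases q; cases r) (simp_all add: edges_of_def assms insert_commute)
qed

lemma edges_of_es:
  assumes "S \<subseteq> EG 0"
  shows "edges_of (es1 (cs_of S)) = (`) (psi 1) ` S" "edges_of (es2 (cs_of S)) = (`) (psi 2) ` S"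
    "edges_of (es3 (cs_of S)) = (`) (psi 3) ` S"
  unfolding es1_def es2_def es3_def
  by (rule cell_edges_image[OF assms];
      simp only: vpos.simps psi_u_self psi_u_commute[of 2 1] psi_u_commute[of 3 1] psi_u_commute[of 3 2])+

definition sector :: "nat \<Rightarrow> complex set set" where
  "sector i = (`) (psi i) ` EG 0"

lemma EG1: "EG 1 = sector 1 \<union> sector 2 \<union> sector 3"
proof -
  have "EG 1 = (\<Union>i\<in>idx. sector i)" unfolding sector_def One_nat_def by (rule EG.simps(2))
  then show ?thesis by (simp add: idx_def Un_assoc)
qed

lemma sector_Int: "i \<in> idx \<Longrightarrow> g \<inter> sector i = (`) (psi i) ` sub 0 [i] g"
  by (auto simp: sub_def sector_def)

lemma config_edges:
  assumes "config_of g = (s1, s2, s3)"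
  shows "edges_of (es1 s1) = g \<inter> sector 1" "edges_of (es2 s2) = g \<inter> sector 2"
    "edges_of (es3 s3) = g \<inter> sector 3"
  using assms[symmetric] edges_of_es[OF sub_subset] by (simp_all add: config_of_def sector_Int idx_def)

lemma simple_es:
  "simple_edges (es1 s1 @ es2 s2 @ es3 s3)"
  "simple_edges (es1 s1 @ es2 s2)" "simple_edges (es1 s1 @ es3 s3)" "simple_edges (es2 s2 @ es3 s3)"
proof -
  have d: "distinct (cell_edges s x y z)" if "distinct [x, y, z]" for s x y z
    using that by (cases s) auto
  have s: "set (es1 s1) \<subseteq> {(V12, V13), (V1, V13), (V1, V12)}"
    "set (es2 s2) \<subseteq> {(V2, V23), (V12, V23), (V12, V2)}"
    "set (es3 s3) \<subseteq> {(V23, V3), (V13, V3), (V13, V23)}" for s1 s2 s3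
    by ((cases s1, auto simp: es1_def; fail), (cases s2, auto simp: es2_def; fail), (cases s3, auto simp: es3_def))
  have ds: "distinct (es1 s1)" "distinct (es2 s2)" "distinct (es3 s3)"
    unfolding es1_def es2_def es3_def by (rule d; simp)+
  have disj: "set (es1 s1) \<inter> set (es2 s2) = {}" "set (es1 s1) \<inter> set (es3 s3) = {}"
    "set (es2 s2) \<inter> set (es3 s3) = {}"
    using s(1)[of s1] s(2)[of s2] s(3)[of s3] by blast+
  have main: "simple_edges es" if "set es \<subseteq> set (es1 s1) \<union> set (es2 s2) \<union> set (es3 s3)" "distinct es" for es
  proof -
    have "set es \<subseteq> {(V12, V13), (V1, V13), (V1, V12), (V2, V23), (V12, V23), (V12, V2),
      (V23, V3), (V13, V3), (V13, V23)}" using that(1) s(1)[of s1] s(2)[of s2] s(3)[of s3] by blast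
    then show ?thesis using that(2) unfolding simple_edges_def by blast
  qed
  show "simple_edges (es1 s1 @ es2 s2 @ es3 s3)"
    "simple_edges (es1 s1 @ es2 s2)" "simple_edges (es1 s1 @ es3 s3)" "simple_edges (es2 s2 @ es3 s3)"
    by (rule main; use ds disj in auto)+
qed

lemma VG1: "VG 1 = range vpos"
proof -
  have U: "UNIV = set verts" by simp
  have "VG 1 = {psi 1 (u 1), psi 1 (u 2), psi 1 (u 3), psi 2 (u 1), psi 2 (u 2), psi 2 (u 3), psi 3 (u 1), psi 3 (u 2), psi 3 (u 3)}"
  proof -
    have "VG 1 = (\<Union>i\<in>idx. psi i ` VG 0)" unfolding One_nat_def by (rule VG.simps(2))
    then show ?thesis by (simp add: idx_def VG.simps) blast
  qed
  also have "\<dots> = range vpos"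
    unfolding U by (simp only: verts_def list.set image_insert image_empty vpos.simps psi_u_self
      psi_u_commute[of 2 1] psi_u_commute[of 3 1] psi_u_commute[of 3 2]) blast
  finally show ?thesis .
qed

lemma u_in_VG1: "j \<in> idx \<Longrightarrow> u j \<in> VG 1"
  using vpos.simps(1-3) unfolding VG1 by (elim idx_cases) (metis rangeI)+

text \<open>In a forest a simple path inside \<open>F\<close> between the two vertices must be the
  path itself. This turns the condition on paths in \<open>Tr1\<close> into reachability, which the
  finite model decides.\<close>

lemma tpath_subgraph:
  assumes ac: "acyclic_graph g" and loop: "\<And>x. {x} \<notin> g" and r: "reach g x y"
  shows "walk_edges (tpath g x y) \<subseteq> F \<longleftrightarrow> reach (g \<inter> F) x y"
proof
  obtain xs where xs: "walk g xs" "distinct xs" "hd xs = x" "last xs = y" using reach_path[OF r] by blast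
  then have eq: "tpath g x y = xs" using tpath_eq[OF ac loop] by blast
  assume "walk_edges (tpath g x y) \<subseteq> F"
  then have "walk (g \<inter> F) xs" using xs(1) unfolding eq walk_def walk_edges_def by blast
  then show "reach (g \<inter> F) x y" using xs unfolding reach_def by blast
next
  assume "reach (g \<inter> F) x y"
  then obtain xs where xs: "walk (g \<inter> F) xs" "distinct xs" "hd xs = x" "last xs = y"
    using reach_path by blast
  then have "walk g xs" using walk_mono by blast
  then have eq: "tpath g x y = xs" using tpath_eq[OF ac loop] xs by blast
  show "walk_edges (tpath g x y) \<subseteq> F" using xs(1) unfolding eq walk_def walk_edges_def by blast
qed

context
  fixes g s1 s2 s3 L ac
  assumes g: "g \<subseteq> EG 1" and cfg: "config_of g = (s1, s2, s3)"
    and L: "edge_components (es1 s1 @ es2 s2 @ es3 s3) = (L, ac)"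
begin

lemma config_all_edges: "edges_of (es1 s1 @ es2 s2 @ es3 s3) = g"
  using g config_edges[OF cfg] unfolding edges_of_append EG1 by blast

lemma config_reach: "joined L x y \<longleftrightarrow> reach g (vpos x) (vpos y)"
  using edge_components_correct[OF simple_es(1)[of s1 s2 s3]] L config_all_edges by simp

lemma config_acyclic: "ac \<longleftrightarrow> acyclic_graph g"
  using edge_components_correct[OF simple_es(1)[of s1 s2 s3]] L config_all_edges by simp

lemma config_STree: "g \<in> STrees 1 \<longleftrightarrow> ac \<and> list_all (joined L V1) verts"
proof -
  have "list_all (joined L V1) verts \<longleftrightarrow> (\<forall>x. reach g (vpos V1) (vpos x))"
    unfolding list_all_iff config_reach[symmetric] by simp
  also have "\<dots> \<longleftrightarrow> (\<forall>x\<in>VG 1. \<forall>y\<in>VG 1. reach g x y)"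
    unfolding VG1 using reach_sym reach_trans by blast
  finally show ?thesis using g config_acyclic by (simp add: STrees_def)
qed

lemma config_spanning:
  "list_all (\<lambda>v. joined L V1 v \<or> joined L V2 v \<or> joined L V3 v) verts \<longleftrightarrow>
     (\<forall>x\<in>VG 1. \<exists>j\<in>idx. reach g x (u j))"
proof -
  have "(\<forall>x\<in>VG 1. \<exists>j\<in>idx. reach g x (u j)) \<longleftrightarrow> (\<forall>x. \<exists>j\<in>idx. reach g (u j) (vpos x))"
    unfolding VG1 using reach_sym by blast
  also have "\<dots> \<longleftrightarrow> (\<forall>x. reach g (vpos V1) (vpos x) \<or> reach g (vpos V2) (vpos x) \<or> reach g (vpos V3) (vpos x))"
    by (simp add: idx_def)
  finally show ?thesis unfolding config_reach[symmetric] by (simp only: list_all_iff set_verts_UNIV ball_UNIV)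
qed

lemma config_SForest:
  assumes "i \<in> idx"
  shows "g \<in> SForests 1 i \<longleftrightarrow> ac \<and>
    list_all (\<lambda>v. joined L V1 v \<or> joined L V2 v \<or> joined L V3 v) verts \<and>
    (if i = 1 then joined L V2 V3 \<and> \<not> joined L V1 V2
     else if i = 2 then joined L V1 V3 \<and> \<not> joined L V1 V2
     else joined L V1 V2 \<and> \<not> joined L V1 V3)"
    (is "_ \<longleftrightarrow> _ \<and> _ \<and> ?R")
proof -
  have s: "reach g (u 2) (u 1) = reach g (u 1) (u 2)" "reach g (u 3) (u 1) = reach g (u 1) (u 3)"
    "reach g (u 3) (u 2) = reach g (u 2) (u 3)" using reach_sym by blast+
  have t: "reach g (u 1) (u 2) \<Longrightarrow> reach g (u 2) (u 3) \<Longrightarrow> reach g (u 1) (u 3)"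
    "reach g (u 1) (u 3) \<Longrightarrow> reach g (u 2) (u 3) \<Longrightarrow> reach g (u 1) (u 2)"
    "reach g (u 1) (u 2) \<Longrightarrow> reach g (u 1) (u 3) \<Longrightarrow> reach g (u 2) (u 3)"
    using reach_sym reach_trans by blast+
  have d: "idx - {1} = {2, 3}" "idx - {2} = {1, 3}" "idx - {3} = {1, 2}" by (auto simp: idx_def)
  have core: "((\<forall>j\<in>idx - {i}. \<forall>k\<in>idx - {i}. reach g (u j) (u k)) \<and>
      (\<forall>j\<in>idx - {i}. \<not> reach g (u i) (u j))) \<longleftrightarrow>
    ?R"
  proof -
    consider "i = 1" | "i = 2" | "i = 3" using assms by (auto simp: idx_def)
    then show ?thesis
    proof cases
    case 1
    have "?R \<longleftrightarrow> reach g (u 2) (u 3) \<and> \<not> reach g (u 1) (u 2)"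
      unfolding 1 config_reach by simp
    then show ?thesis unfolding 1 d by (simp add: s) (use t in blast)
  next
    case 2
    have "?R \<longleftrightarrow> reach g (u 1) (u 3) \<and> \<not> reach g (u 1) (u 2)"
      unfolding 2 config_reach by simp
    then show ?thesis unfolding 2 d by (simp add: s) (use t in blast)
  next
    case 3
    have "?R \<longleftrightarrow> reach g (u 1) (u 2) \<and> \<not> reach g (u 1) (u 3)"
      unfolding 3 config_reach by simp
    then show ?thesis unfolding 3 d by (simp add: s) (use t in blast)
    qed
  qed
  show ?thesis unfolding SForests_def mem_Collect_eq config_spanning core[symmetric] config_acyclic
    using g by blast
qed

end

lemma set_configs: "c \<in> set configs"
proof -
  have b: "x \<in> set bools" for x by (simp add: bools_def)
  have s: "x \<in> set states" for x by (cases x) (use b in \<open>auto simp: states_def\<close>)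
  obtain s1 s2 s3 where "c = (s1, s2, s3)" by (cases c)
  then show ?thesis using s[of s1] s[of s2] s[of s3] unfolding configs_def by auto
qed

lemma distinct_configs: "distinct configs"
proof -
  have p: "distinct (concat (map (\<lambda>x. map (Pair x) ys) xs))" if "distinct xs" "distinct ys"
    for xs :: "'a list" and ys :: "'b list"
    using that by (induction xs) (auto simp: distinct_map inj_on_def)
  have b: "distinct bools" by (simp add: bools_def)
  have P: "concat (map (\<lambda>a. concat (map (\<lambda>b. map (\<lambda>c. (a, b, c)) zs) ys)) xs) =
    concat (map (\<lambda>x. map (Pair x) (concat (map (\<lambda>x. map (Pair x) zs) ys))) xs)"
    for xs :: "'a list" and ys :: "'b list" and zs :: "'c list"
    by (simp add: map_concat comp_def)
  have "distinct states" unfolding states_def P by (intro p b)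
  then show ?thesis unfolding configs_def P by (intro p)
qed

lemma kind_not_KTree0: "kind_of c \<noteq> KTree 0"
proof (cases "kind_of c = KOther")
  case False
  then have "(kind_of c, c) \<in> set kinded" using set_configs by (auto simp: kinded_def)
  then show ?thesis using check by (auto simp: check_all_def list_all_iff)
qed simp


definition star :: "nat \<Rightarrow> complex set set" where
  "star i = {{u i, u j} | j. j \<in> idx \<and> j \<noteq> i}"

lemma cs_of_star: "i \<in> idx \<Longrightarrow> star i \<subseteq> EG 0 \<and> cs_of (star i) = (i \<noteq> 1, i \<noteq> 2, i \<noteq> 3)"
proof -
  assume i: "i \<in> idx"
  have "star 1 = {{u 1, u 2}, {u 1, u 3}}" "star 2 = {{u 1, u 2}, {u 2, u 3}}" "star 3 = {{u 1, u 3}, {u 2, u 3}}"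
    unfolding star_def by (auto simp: idx_def insert_commute)
  then show ?thesis
    using i EG0_distinct EG0_distinct[symmetric] by (elim idx_cases) (simp_all add: cs_of_def EG0)
qed

lemma cs_of_single:
  "cs_of {} = (False, False, False)" "cs_of {{u 2, u 3}} = (True, False, False)"
  "cs_of {{u 1, u 3}} = (False, True, False)" "cs_of {{u 1, u 2}} = (False, False, True)"
  using EG0_distinct EG0_distinct[symmetric] by (simp_all add: cs_of_def)

lemma Tr1_tree:
  assumes g: "g \<subseteq> EG 1" and t: "g \<in> STrees 1"
  shows "\<exists>i\<in>idx. kind_of (config_of g) = KTree i \<and> Tr1 g = star i"
proof -
  obtain s1 s2 s3 where cfg: "config_of g = (s1, s2, s3)" by (cases "config_of g")
  obtain L ac where L: "edge_components (es1 s1 @ es2 s2 @ es3 s3) = (L, ac)" by fastforce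
  have all: "ac" "list_all (joined L V1) verts" using config_STree[OF g cfg L] t by auto
  have ac: "acyclic_graph g" and conn: "\<And>x y. x \<in> VG 1 \<Longrightarrow> y \<in> VG 1 \<Longrightarrow> reach g x y"
    using t by (auto simp: STrees_def)
  have loop: "{x} \<notin> g" for x using g EG_no_loop by blast
  define D where "D i j \<longleftrightarrow> walk_edges (tpath g (u i) (u j)) \<subseteq> sector i \<union> sector j" for i j
  have D: "D i j \<longleftrightarrow> reach (g \<inter> (sector i \<union> sector j)) (u i) (u j)" if "i \<in> idx" "j \<in> idx" for i j
    unfolding D_def by (rule tpath_subgraph[OF ac loop conn]) (use that u_in_VG1 in auto)
  have sym: "D i j = D j i" if "i \<in> idx" "j \<in> idx" for i j
    unfolding D[OF that] D[OF that(2,1)] using reach_sym by (metis Un_commute)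
  have d: "joined (fst (edge_components (es1 s1 @ es2 s2))) V1 V2 = D 1 2"
    "joined (fst (edge_components (es1 s1 @ es3 s3))) V1 V3 = D 1 3"
    "joined (fst (edge_components (es2 s2 @ es3 s3))) V2 V3 = D 2 3"
    using edge_components_correct[OF simple_es(2)[of s1 s2]] edge_components_correct[OF simple_es(3)[of s1 s3]]
      edge_components_correct[OF simple_es(4)[of s2 s3]]
    by (simp_all add: D idx_def edges_of_append config_edges[OF cfg] Int_Un_distrib)
  have kind: "kind_of (config_of g) =
    (if D 1 2 \<and> D 1 3 \<and> \<not> D 2 3 then KTree 1 else if D 1 2 \<and> D 2 3 \<and> \<not> D 1 3 then KTree 2
       else if D 1 3 \<and> D 2 3 \<and> \<not> D 1 2 then KTree 3 else KTree 0)"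
    unfolding cfg kind_of_def using L all by (simp only: prod.case Let_def d if_True if_False simp_thms)
  define P where "P i \<longleftrightarrow> i \<in> idx \<and> (\<forall>j\<in>idx - {i}. D i j)" for i
  have T: "Tr1 g = star (SOME i. P i)"
    using t unfolding Tr1_def P_def D_def sector_def star_def by (simp add: Let_def)
  have dd: "idx - {1} = {2, 3}" "idx - {2} = {1, 3}" "idx - {3} = {1, 2}" by (auto simp: idx_def)
  have P: "P 1 \<longleftrightarrow> D 1 2 \<and> D 1 3" "P 2 \<longleftrightarrow> D 1 2 \<and> D 2 3" "P 3 \<longleftrightarrow> D 1 3 \<and> D 2 3"
  proof -
    have i: "1 \<in> idx" "2 \<in> idx" "3 \<in> idx" by (simp_all add: idx_def)
    show "P 1 \<longleftrightarrow> D 1 2 \<and> D 1 3" "P 2 \<longleftrightarrow> D 1 2 \<and> D 2 3" "P 3 \<longleftrightarrow> D 1 3 \<and> D 2 3"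
      using sym[OF i(1,2)] sym[OF i(1,3)] sym[OF i(2,3)] i by (simp_all add: P_def dd)
  qed
  have Pidx: "P i \<Longrightarrow> i = 1 \<or> i = 2 \<or> i = 3" for i by (auto simp: P_def idx_def)
  \<comment> \<open>This makes the centre unique, so the choice in \<open>Tr1\<close> has a single
    candidate.\<close>
  have nk: "kind_of (config_of g) \<noteq> KTree 0" by (rule kind_not_KTree0)
  consider "D 1 2 \<and> D 1 3 \<and> \<not> D 2 3" | "D 1 2 \<and> D 2 3 \<and> \<not> D 1 3" | "D 1 3 \<and> D 2 3 \<and> \<not> D 1 2"
  proof -
    have "(D 1 2 \<and> D 1 3 \<and> \<not> D 2 3) \<or> (D 1 2 \<and> D 2 3 \<and> \<not> D 1 3) \<or> (D 1 3 \<and> D 2 3 \<and> \<not> D 1 2)"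
      using nk unfolding kind by (simp split: if_splits)
    then show ?thesis using that by blast
  qed
  then show ?thesis
  proof cases
    case 1
    then have "(SOME i. P i) = 1" using P Pidx by (intro some_equality) auto
    then show ?thesis using 1 T kind by (auto simp: idx_def)
  next
    case 2
    then have "(SOME i. P i) = 2" using P Pidx by (intro some_equality) auto
    then show ?thesis using 2 T kind by (auto simp: idx_def)
  next
    case 3
    then have "(SOME i. P i) = 3" using P Pidx by (intro some_equality) auto
    then show ?thesis using 3 T kind by (auto simp: idx_def)
  qed
qed

text \<open>\<open>KOther\<close> collects the three-component forests together with all graphs
  outside \<open>Q_1\<close>; on both, \<open>Tr1\<close> gives the edgeless graph.\<close>

lemma Tr1_nontree:
  assumes g: "g \<subseteq> EG 1" and t: "g \<notin> STrees 1"
  shows "(\<exists>i\<in>idx. kind_of (config_of g) = KForest i \<and> g \<in> SForests 1 i \<and> Tr1 g \<subseteq> EG 0 \<and>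
       cs_of (Tr1 g) = (i = 1, i = 2, i = 3)) \<or>
    kind_of (config_of g) = KOther \<and> Tr1 g = {}"
proof -
  obtain s1 s2 s3 where cfg: "config_of g = (s1, s2, s3)" by (cases "config_of g")
  obtain L ac where L: "edge_components (es1 s1 @ es2 s2 @ es3 s3) = (L, ac)" by fastforce
  define T where "T = list_all (joined L V1) verts"
  define S where "S = list_all (\<lambda>v. joined L V1 v \<or> joined L V2 v \<or> joined L V3 v) verts"
  have nT: "\<not> (ac \<and> T)" using config_STree[OF g cfg L] t unfolding T_def by blast
  note F = config_SForest[OF g cfg L, folded S_def]
  have F1: "g \<in> SForests 1 1 \<longleftrightarrow> ac \<and> S \<and> joined L V2 V3 \<and> \<not> joined L V1 V2" using F[of 1] by (simp add: idx_def)
  have F2: "g \<in> SForests 1 2 \<longleftrightarrow> ac \<and> S \<and> joined L V1 V3 \<and> \<not> joined L V1 V2" using F[of 2] by (simp add: idx_def)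
  have F3: "g \<in> SForests 1 3 \<longleftrightarrow> ac \<and> S \<and> joined L V1 V2 \<and> \<not> joined L V1 V3" using F[of 3] by (simp add: idx_def)
  have kind: "kind_of (config_of g) = (if g \<in> SForests 1 1 then KForest 1 else if g \<in> SForests 1 2 then KForest 2
      else if g \<in> SForests 1 3 then KForest 3 else KOther)"
  proof (cases ac)
    case True
    then have "\<not> T" using nT by simp
    then show ?thesis unfolding cfg kind_of_def prod.case L F1 F2 F3 T_def[symmetric] S_def[symmetric]
      using True by (simp del: joined.simps)
  next
    case False
    then show ?thesis unfolding cfg kind_of_def prod.case L F1 F2 F3 by (simp del: joined.simps)
  qed
  have Tr: "Tr1 g = (if g \<in> SForests 1 1 then {{u 2, u 3}} else if g \<in> SForests 1 2 then {{u 1, u 3}}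
     else if g \<in> SForests 1 3 then {{u 1, u 2}} else {})"
    using t unfolding Tr1_def by simp
  have i: "1 \<in> idx" "2 \<in> idx" "3 \<in> idx" by (simp_all add: idx_def)
  show ?thesis
  proof (cases "g \<in> SForests 1 1")
    case True
    then show ?thesis using kind Tr i by (intro disjI1 bexI[of _ 1]) (simp_all add: cs_of_single EG0)
  next
    case n1: False
    show ?thesis
    proof (cases "g \<in> SForests 1 2")
      case True
      then show ?thesis using n1 kind Tr i by (intro disjI1 bexI[of _ 2]) (simp_all add: cs_of_single EG0)
    next
      case n2: False
      show ?thesis
      proof (cases "g \<in> SForests 1 3")
        case True
        then show ?thesis using n1 n2 kind Tr i by (intro disjI1 bexI[of _ 3]) (simp_all add: cs_of_single EG0)
      next
        case False
        then show ?thesis using n1 n2 kind Tr by simp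
      qed
    qed
  qed
qed

lemma Tr1_state:
  assumes "g \<subseteq> EG 1"
  shows "Tr1 g \<subseteq> EG 0" "cs_of (Tr1 g) = state_of (kind_of (config_of g))"
proof -
  have "Tr1 g \<subseteq> EG 0 \<and> cs_of (Tr1 g) = state_of (kind_of (config_of g))"
  proof (cases "g \<in> STrees 1")
    case True
    then obtain i where "i \<in> idx" "kind_of (config_of g) = KTree i" "Tr1 g = star i"
      using Tr1_tree[OF assms] by blast
    then show ?thesis using cs_of_star by simp
  next
    case False
    then show ?thesis using Tr1_nontree[OF assms] cs_of_single(1) by fastforce
  qed
  then show "Tr1 g \<subseteq> EG 0" "cs_of (Tr1 g) = state_of (kind_of (config_of g))" by auto
qed

text \<open>These facts allow \<open>g\<close> to replace \<open>g'\<close> inside a cell: the same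
  corners are connected, no cycle is created inside, and no vertex is cut off from all corners. An
  empty trace is excluded because it also belongs to graphs outside \<open>Q_1\<close>.\<close>

lemma Tr1_eq_connectivity:
  assumes g: "g \<subseteq> EG 1" "g' \<subseteq> EG 1" "Tr1 g = Tr1 g'" "Tr1 g \<noteq> {}"
  shows "acyclic_graph g" "\<And>a b. a \<in> idx \<Longrightarrow> b \<in> idx \<Longrightarrow> reach g (u a) (u b) \<longleftrightarrow> reach g' (u a) (u b)"
    "\<And>x. x \<in> VG 1 \<Longrightarrow> \<exists>j\<in>idx. reach g x (u j)"
proof -
  have ne: "state_of (kind_of (config_of g)) = state_of (kind_of (config_of g'))"
    "kind_of (config_of g) \<noteq> KOther" "kind_of (config_of g') \<noteq> KOther"
    using Tr1_state(2)[OF g(1)] Tr1_state(2)[OF g(2)] Tr1_state(1)[OF g(1)] Tr1_state(1)[OF g(2)]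
      cs_of_inj[of "Tr1 g" "{}"] cs_of_inj[of "Tr1 g'" "{}"] cs_of_single(1) g(3,4) by auto
  have cl: "(\<exists>i\<in>idx. kind_of (config_of h) = KTree i \<and> h \<in> STrees 1) \<or>
      (\<exists>i\<in>idx. kind_of (config_of h) = KForest i \<and> h \<in> SForests 1 i)"
    if "h \<subseteq> EG 1" "kind_of (config_of h) \<noteq> KOther" for h
    using Tr1_tree[OF that(1)] Tr1_nontree[OF that(1)] that(2) by blast
  have st: "state_of (KTree i) \<noteq> state_of (KForest j)" "state_of (KForest i) = state_of (KForest j) \<Longrightarrow> i = j"
    if "i \<in> idx" "j \<in> idx" for i j
    using that by (auto simp: idx_def)
  consider "g \<in> STrees 1" "g' \<in> STrees 1" | i where "i \<in> idx" "g \<in> SForests 1 i" "g' \<in> SForests 1 i"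
  proof -
    obtain i k where ik: "i \<in> idx" "kind_of (config_of g) = k i"
      "(k = KTree \<and> g \<in> STrees 1) \<or> (k = KForest \<and> g \<in> SForests 1 i)"
      using cl[OF g(1) ne(2)] by blast
    obtain j l where jl: "j \<in> idx" "kind_of (config_of g') = l j"
      "(l = KTree \<and> g' \<in> STrees 1) \<or> (l = KForest \<and> g' \<in> SForests 1 j)"
      using cl[OF g(2) ne(3)] by blast
    have eq: "state_of (k i) = state_of (l j)" using ne(1) ik(2) jl(2) by simp
    show ?thesis using ik(3) jl(3)
    proof (elim disjE conjE)
      assume "k = KTree" "g \<in> STrees 1" "l = KTree" "g' \<in> STrees 1"
      then show ?thesis using that(1) by blast
    next
      assume "k = KForest" "g \<in> SForests 1 i" "l = KForest" "g' \<in> SForests 1 j"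
      then show ?thesis using that(2) eq st(2)[OF ik(1) jl(1)] ik(1) by blast
    next
      assume "k = KTree" "l = KForest"
      then show ?thesis using eq st(1)[OF ik(1) jl(1)] by simp
    next
      assume "k = KForest" "l = KTree"
      then show ?thesis using eq[symmetric] st(1)[OF jl(1) ik(1)] by simp
    qed
  qed
  then have "acyclic_graph g \<and> (\<forall>a\<in>idx. \<forall>b\<in>idx. reach g (u a) (u b) \<longleftrightarrow> reach g' (u a) (u b)) \<and>
    (\<forall>x\<in>VG 1. \<exists>j\<in>idx. reach g x (u j))"
  proof cases
    case 1
    then have "acyclic_graph g" "\<And>x y. x \<in> VG 1 \<Longrightarrow> y \<in> VG 1 \<Longrightarrow> reach g x y \<and> reach g' x y"
      unfolding STrees_def by blast+
    moreover have "1 \<in> idx" by (simp add: idx_def)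
    ultimately show ?thesis using u_in_VG1 by blast
  next
    case 2
    have "reach h (u a) (u b) \<longleftrightarrow> a = b \<or> (a \<noteq> i \<and> b \<noteq> i)" if "h \<in> SForests 1 i" "a \<in> idx" "b \<in> idx" for h a b
    proof -
      have p: "\<And>j k. j \<in> idx - {i} \<Longrightarrow> k \<in> idx - {i} \<Longrightarrow> reach h (u j) (u k)"
        "\<And>j. j \<in> idx - {i} \<Longrightarrow> \<not> reach h (u i) (u j)"
        using that(1) unfolding SForests_def by blast+
      show ?thesis
      proof (cases "a = i")
        case True
        then show ?thesis using p(2)[of b] that by (cases "b = i") auto
      next
        case False
        then show ?thesis using p(1)[of a b] p(2)[of a] reach_sym[of h "u a" "u i"] that
          by (cases "b = i") auto
      qed
    qed
    note eq = this
    have "\<forall>a\<in>idx. \<forall>b\<in>idx. reach g (u a) (u b) \<longleftrightarrow> reach g' (u a) (u b)"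
      using eq[OF 2(2)] eq[OF 2(3)] by blast
    then show ?thesis using 2(2) unfolding SForests_def by blast
  qed
  then show "acyclic_graph g" "\<And>a b. a \<in> idx \<Longrightarrow> b \<in> idx \<Longrightarrow> reach g (u a) (u b) \<longleftrightarrow> reach g' (u a) (u b)"
    "\<And>x. x \<in> VG 1 \<Longrightarrow> \<exists>j\<in>idx. reach g x (u j)" by blast+
qed


lemma kind_of_range:
  "kind_of c \<in> {KTree 0, KTree 1, KTree 2, KTree 3, KForest 1, KForest 2, KForest 3, KOther}"
proof -
  obtain s1 s2 s3 where c: "c = (s1, s2, s3)" by (cases c)
  obtain L ac where L: "edge_components (es1 s1 @ es2 s2 @ es3 s3) = (L, ac)" by fastforce
  have if_range: "(if P then x else y) \<in> R" if "x \<in> R" "y \<in> R" for P R and x y :: kind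
    using that by simp
  show ?thesis unfolding c kind_of_def prod.case L Let_def by (intro if_range) simp_all
qed

section \<open>Mean offspring of a crossing and the eigenvector\<close>

definition crossing_weight :: "(nat \<Rightarrow> real) \<Rightarrow> cs \<times> cs \<times> cs \<Rightarrow> nat \<Rightarrow> nat \<Rightarrow> real" where
  "crossing_weight h c a b = (\<Sum>(i, x, z)\<leftarrow>expand c a b. h (ctype (comp_state c i) x z))"

text \<open>A positive eigenvector, for the eigenvalue \<open>alpha_bar\<close>, of the matrix of mean offspring numbers.\<close>

definition hval :: "nat \<Rightarrow> real" where
  "hval y = (if y = 2 then alpha_bar - 5/3 else if y = 1 then (alpha_bar - 1/3) / alpha_bar
     else (alpha_bar + 1/3) / (2 * alpha_bar))"

text \<open>The matrix of mean offspring has the rows (1, 1/2, 1/2), (4/3, 2/3, 1), (4/5, 2/5, 1).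
  Its first column is twice the second, so one eigenvalue is 0; the others are the roots of x^2 -
  (8/3) x + 13/15, and \<open>alpha_bar\<close> is the larger one.\<close>

lemma alpha_bar_square: "alpha_bar * alpha_bar = 8/3 * alpha_bar - 13/15"
  by (simp add: alpha_bar_def field_simps)

lemma alpha_bar_gt: "alpha_bar > 2"
proof -
  have "sqrt 205 > 14" by (rule real_less_rsqrt) simp
  then show ?thesis by (simp add: alpha_bar_def)
qed

lemma hval_pos: "hval y > 0"
  using alpha_bar_gt by (simp add: hval_def)

lemma crossing_weight_counts:
  "(\<Sum>c\<leftarrow>l. crossing_weight h c a b) = h 0 * count_type 0 a b l + h 1 * count_type 1 a b l + h 2 * count_type 2 a b l"
proof (induction l)
  case (Cons c l)
  have "(\<Sum>(i, x, z)\<leftarrow>its. h (ctype (comp_state c i) x z)) =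
    h 0 * length (filter (\<lambda>(i, x, z). ctype (comp_state c i) x z = 0) its) +
    h 1 * length (filter (\<lambda>(i, x, z). ctype (comp_state c i) x z = 1) its) +
    h 2 * length (filter (\<lambda>(i, x, z). ctype (comp_state c i) x z = 2) its)" for its
  proof (induction its)
    case (Cons p its)
    obtain i x z where p: "p = (i, x, z)" by (cases p)
    have "ctype (comp_state c i) x z = 0 \<or> ctype (comp_state c i) x z = 1 \<or> ctype (comp_state c i) x z = 2"
      by (simp add: ctype_def)
    then show ?case using Cons by (auto simp: p algebra_simps)
  qed simp
  then show ?case using Cons by (simp add: count_type_def crossing_weight_def algebra_simps)
qed (simp add: count_type_def)

definition fibre :: "cs \<Rightarrow> (cs \<times> cs \<times> cs) set" where
  "fibre s = {c. state_of (kind_of c) = s}"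

text \<open>Read off from \<open>check\<close>. Nonemptiness of the fibre rules out states that are
  not a trace, such as the full triangle.\<close>

lemma fibre_facts:
  assumes s: "conn s a b" and ab: "a \<in> idx" "b \<in> idx" "a \<noteq> b" and ne: "fibre s \<noteq> {}"
  shows "c \<in> fibre s \<Longrightarrow> (i, x, z) \<in> set (expand c a b) \<Longrightarrow> conn (comp_state c i) x z"
    "(\<Sum>c\<in>fibre s. crossing_weight hval c a b) = card (fibre s) * (alpha_bar * hval (ctype s a b))"
    "3 * (\<Sum>c\<in>fibre s. corner_weight c a b) \<le> 2 * kappa (ctype s a b) * card (fibre s)"
proof -
  define l where "l = map snd (filter (\<lambda>(k, c). state_of k = s) kinded)"
  have sn: "s \<noteq> (False, False, False)" using s by (auto simp: conn_def split: if_splits)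
  have leq: "l = filter (\<lambda>c. state_of (kind_of c) = s) configs"
    using sn unfolding l_def kinded_def
    by (simp add: filter_map comp_def) (rule arg_cong2[where f = filter]; auto simp: fun_eq_iff)
  have l: "set l = fibre s" "distinct l"
    unfolding leq using set_configs distinct_configs by (auto simp: fibre_def)
  obtain c0 where "state_of (kind_of c0) = s" using ne by (auto simp: fibre_def)
  \<comment> \<open>The kinds other than \<open>KOther\<close> give the three trees and the three
    single-edge forests of \<open>G_0\<close>; \<open>KOther\<close> is impossible because the
    edgeless graph connects no two corners.\<close>
  then have "s \<in> set [(False, True, True), (True, False, True), (True, True, False),
        (True, False, False), (False, True, False), (False, False, True)]"
    using kind_of_range[of c0] kind_not_KTree0[of c0] sn by auto
  then have "check_kind kinded s" using check unfolding check_all_def list_all_iff by blast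
  moreover have "(a, b) \<in> set pairs" using ab by (auto simp: pairs_def idx_def)
  ultimately have "check_one (ctype s a b) a b l"
    using s unfolding check_kind_def list_all_iff l_def by fastforce
  then have c1: "if ctype s a b = 2 then (length l, count_type 0 a b l, count_type 1 a b l, count_type 2 a b l) = (30, 24, 12, 30)
      else if ctype s a b = 1 then (length l, count_type 0 a b l, count_type 1 a b l, count_type 2 a b l) = (18, 24, 12, 18)
      else (length l, count_type 0 a b l, count_type 1 a b l, count_type 2 a b l) = (18, 18, 9, 9)"
    and c2: "3 * sum_list (map (\<lambda>c. corner_weight c a b) l) \<le> 2 * kappa (ctype s a b) * length l"
    and c3: "list_all (\<lambda>c. list_all (\<lambda>(i, x, z). conn (comp_state c i) x z) (expand c a b)) l"
    unfolding check_one_def by blast+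
  show "c \<in> fibre s \<Longrightarrow> (i, x, z) \<in> set (expand c a b) \<Longrightarrow> conn (comp_state c i) x z"
    using c3 unfolding list_all_iff l(1) by fastforce
  have len: "card (fibre s) = length l" using l by (metis distinct_card)
  show "3 * (\<Sum>c\<in>fibre s. corner_weight c a b) \<le> 2 * kappa (ctype s a b) * card (fibre s)"
    using c2 sum.distinct_set_conv_list[OF l(2), of "\<lambda>c. corner_weight c a b"] len l(1) by simp
  have "(\<Sum>c\<in>fibre s. crossing_weight hval c a b) =
    hval 0 * count_type 0 a b l + hval 1 * count_type 1 a b l + hval 2 * count_type 2 a b l"
    unfolding l(1)[symmetric] sum.distinct_set_conv_list[OF l(2)] by (rule crossing_weight_counts)
  also have "\<dots> = length l * (alpha_bar * hval (ctype s a b))"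
  proof -
    have y: "ctype s a b = 0 \<or> ctype s a b = 1 \<or> ctype s a b = 2" by (simp add: ctype_def)
    have p: "alpha_bar \<noteq> 0" using alpha_bar_gt by simp
    have h0: "hval 0 = (alpha_bar + 1/3) / (2 * alpha_bar)" and h1: "hval 1 = (alpha_bar - 1/3) / alpha_bar"
      and h2: "hval 2 = alpha_bar - 5/3" by (simp_all add: hval_def)
    \<comment> \<open>The eigenvector equations: the coefficients are the counts in
      \<open>check_one\<close> divided by the number 18 or 30 of preimages.\<close>
    have e0: "alpha_bar * hval 0 = hval 0 + hval 1 / 2 + hval 2 / 2"
      using p alpha_bar_square unfolding h0 h1 h2 by (simp add: field_simps)
    have e1: "alpha_bar * hval 1 = 4/3 * hval 0 + 2/3 * hval 1 + hval 2"
      using p alpha_bar_square unfolding h0 h1 h2 by (simp add: field_simps)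
    have e2: "alpha_bar * hval 2 = 4/5 * hval 0 + 2/5 * hval 1 + hval 2"
      using p alpha_bar_square unfolding h0 h1 h2 by (simp add: field_simps)
    show ?thesis using y
    proof (elim disjE)
      assume "ctype s a b = 0"
      then show ?thesis using c1 e0 by simp
    next
      assume "ctype s a b = 1"
      then show ?thesis using c1 e1 by simp
    next
      assume "ctype s a b = 2"
      then show ?thesis using c1 e2 by simp
    qed
  qed
  finally show "(\<Sum>c\<in>fibre s. crossing_weight hval c a b) = card (fibre s) * (alpha_bar * hval (ctype s a b))"
    by (simp add: len)
qed

section \<open>Exchanging the inside of a cell\<close>

lemma reach_image: "reach g x y \<Longrightarrow> reach ((`) f ` g) (f x) (f y)"
proof (induction rule: reach_induct)
  case (step y z)
  have "{f y, f z} \<in> (`) f ` g" using imageI[OF step.hyps(2), of "(`) f"] by simp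
  then show ?case using step.IH reach_edge reach_trans by blast
qed simp

text \<open>A cycle of the image is pulled back along the inverse of f, which is possible because
  each of its vertices lies on an edge and hence in the range of f.\<close>

lemma acyclic_graph_image:
  assumes ac: "acyclic_graph g" and f: "inj f"
  shows "acyclic_graph ((`) f ` g)"
proof (rule ccontr)
  assume "\<not> ?thesis"
  then obtain xs where xs: "length xs \<ge> 3" "distinct xs" "walk ((`) f ` g) xs" "{last xs, hd xs} \<in> (`) f ` g"
    unfolding acyclic_graph_def by blast
  define ys where "ys = map (inv f) xs"
  have pull: "{inv f p, inv f q} \<in> g" if pq: "{p, q} \<in> (`) f ` g" for p q
  proof -
    obtain e where e: "e \<in> g" "{p, q} = f ` e" using pq by blast
    have "inv f ` {p, q} = e" unfolding e(2) using f by (simp add: image_image)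
    then show ?thesis using e(1) by simp
  qed
  have rng: "x \<in> range f" if x: "x \<in> set xs" for x
  proof -
    obtain i where i: "i < length xs" "x = xs ! i" using x by (auto simp: in_set_conv_nth)
    have "\<exists>y. {x, y} \<in> (`) f ` g"
    proof (cases "Suc i < length xs")
      case True
      then have "{x, xs ! Suc i} \<in> (`) f ` g" using xs(3) i by (simp add: walk_def)
      then show ?thesis by blast
    next
      case False
      then have "x = last xs" using i by (metis Suc_lessI diff_Suc_1 last_conv_nth list.size(3) not_less_zero)
      then show ?thesis using xs(4) by blast
    qed
    then show ?thesis by blast
  qed
  have "distinct ys" unfolding ys_def distinct_map using xs(2) rng by (auto intro: inj_on_subset[OF inj_on_inv_into])
  moreover have "walk g ys" using xs(3) pull by (auto simp: walk_def ys_def)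
  moreover have "xs \<noteq> []" using xs(1) by auto
  then have "{last ys, hd ys} \<in> g" using pull[OF xs(4)] by (simp add: ys_def last_map hd_map)
  moreover have "length ys \<ge> 3" using xs(1) by (simp add: ys_def)
  ultimately show False using ac unfolding acyclic_graph_def by blast
qed

text \<open>Here \<open>Out\<close> is the part of a graph outside a cell, and g, g' are two fillings of the cell.\<close>

lemma reach_transfer:
  assumes f: "inj f"
    and Out: "\<And>x y. {x, y} \<in> Out \<Longrightarrow> x \<in> f ` VG 1 \<Longrightarrow> \<exists>c\<in>idx. x = f (u c)"
    and g: "g \<subseteq> EG 1"
    and gg: "\<And>a b. a \<in> idx \<Longrightarrow> b \<in> idx \<Longrightarrow> reach g (u a) (u b) \<Longrightarrow> reach g' (u a) (u b)"
    and x: "x \<in> f ` VG 1 \<Longrightarrow> \<exists>c\<in>idx. x = f (u c)"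
    and r: "reach (Out \<union> (`) f ` g) x y"
    and y: "y \<in> f ` VG 1 \<Longrightarrow> \<exists>c\<in>idx. y = f (u c)"
  shows "reach (Out \<union> (`) f ` g') x y"
proof -
  let ?R = "reach (Out \<union> (`) f ` g')"
  have inside: "?R (f (u a)) (f (u b))" if "a \<in> idx" "b \<in> idx" "reach g (u a) (u b)" for a b
    using reach_mono[OF reach_image[OF gg[OF that]]] by blast
  \<comment> \<open>A vertex v inside the cell may be reached by the old filling but not by the new
    one. For such v the invariant keeps only a corner that the new graph reaches and from which the
    old filling leads to v.\<close>
  have main: "(y \<notin> f ` VG 1 \<longrightarrow> ?R x y) \<and>
    (\<forall>v\<in>VG 1. y = f v \<longrightarrow> (\<exists>c\<in>idx. reach g (u c) v \<and> ?R x (f (u c))))"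
    using r
  proof (induction rule: reach_induct)
    case refl
    show ?case
    proof (intro conjI impI ballI)
      fix v assume v: "v \<in> VG 1" "x = f v"
      then obtain c where c: "c \<in> idx" "x = f (u c)" using x by blast
      then have "v = u c" using v(2) f by (simp add: inj_eq)
      then show "\<exists>c\<in>idx. reach g (u c) v \<and> ?R x (f (u c))" using c by (intro bexI[of _ c]) auto
    qed simp
  next
    case (step y z)
    consider "{y, z} \<in> Out" | "{y, z} \<in> (`) f ` g" using step.hyps by blast
    then show ?case
    proof cases
      case 1
      have xy: "?R x y"
      proof (cases "y \<in> f ` VG 1")
        case True
        then obtain d where d: "d \<in> idx" "y = f (u d)" using Out 1 by blast
        then obtain c where "c \<in> idx" "reach g (u c) (u d)" "?R x (f (u c))" using step.IH u_in_VG1 by blast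
        then show ?thesis using inside[of c d] d reach_trans by blast
      qed (use step.IH in blast)
      moreover have "?R y z" using 1 by (intro reach_edge) blast
      ultimately have xz: "?R x z" by (rule reach_trans)
      have "\<exists>c\<in>idx. reach g (u c) v \<and> ?R x (f (u c))" if v: "v \<in> VG 1" "z = f v" for v
      proof -
        have "{z, y} \<in> Out" using 1 by (simp add: insert_commute)
        then obtain e where e: "e \<in> idx" "z = f (u e)" using Out v by blast
        then have "v = u e" using v f by (simp add: inj_eq)
        then show ?thesis using e xz by (intro bexI[of _ e]) auto
      qed
      then show ?thesis using xz by blast
    next
      case 2
      then obtain e where e: "e \<in> g" "{y, z} = f ` e" by blast
      then obtain p q where pq: "e = {p, q}" "p \<in> VG 1" "q \<in> VG 1" using g EG_edge by blast
      then have "{y, z} = {f p, f q}" using e by simp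
      then have "(y = f p \<and> z = f q) \<or> (y = f q \<and> z = f p)" by (auto simp: doubleton_eq_iff)
      then obtain p' q' where p': "y = f p'" "z = f q'" "{p', q'} = e" "p' \<in> VG 1" "q' \<in> VG 1"
        using pq by (auto simp: insert_commute)
      then obtain c where c: "c \<in> idx" "reach g (u c) p'" "?R x (f (u c))" using step.IH by blast
      have "reach g p' q'" using p'(3) e(1) by (intro reach_edge) simp
      then have "reach g (u c) q'" using c(2) reach_trans by blast
      moreover have "v = q'" if "z = f v" for v using that p'(2) f by (simp add: inj_eq)
      ultimately show ?thesis using c p'(2,5) by blast
    qed
  qed
  show ?thesis
  proof (cases "y \<in> f ` VG 1")
    case True
    then obtain d where d: "d \<in> idx" "y = f (u d)" using y by blast
    then obtain c where "c \<in> idx" "reach g (u c) (u d)" "?R x (f (u c))" using main u_in_VG1 by blast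
    then show ?thesis using inside[of c d] d reach_trans by blast
  qed (use main in blast)
qed

definition outside :: "nat \<Rightarrow> nat list \<Rightarrow> complex set set \<Rightarrow> complex set set" where
  "outside n w t = (\<Union>v\<in>words n - {w}. (`) (psiw v) ` sub 1 v t)"

definition exchange :: "nat \<Rightarrow> nat list \<Rightarrow> complex set set \<Rightarrow> complex set set \<Rightarrow> complex set set" where
  "exchange n w g t = (\<Union>v\<in>words n. (`) (psiw v) ` (if v = w then g else sub 1 v t))"

lemma STrees_subset: "t \<in> STrees n \<Longrightarrow> t \<subseteq> EG n"
  by (simp add: STrees_def)

lemma finite_STrees: "finite (STrees n)"
  by (rule finite_subset[of _ "Pow (EG n)"]) (auto simp: STrees_def finite_EG)

lemma sub_cover:
  assumes "t \<subseteq> EG (n + m)"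
  shows "t = (\<Union>v\<in>words n. (`) (psiw v) ` sub m v t)"
proof
  show "t \<subseteq> (\<Union>v\<in>words n. (`) (psiw v) ` sub m v t)"
  proof
    fix e assume "e \<in> t"
    moreover from this have "e \<in> (\<Union>w\<in>words n. (`) (psiw w) ` EG m)" using assms EG_words by blast
    ultimately show "e \<in> (\<Union>v\<in>words n. (`) (psiw v) ` sub m v t)" by (auto simp: sub_def)
  qed
qed (auto simp: sub_def)

lemma sub_cover_Suc: "t \<subseteq> EG (Suc n) \<Longrightarrow> t = (\<Union>v\<in>words n. (`) (psiw v) ` sub 1 v t)"
  unfolding Suc_eq_plus1 by (rule sub_cover)

lemma EG_Suc_words: "EG (Suc n) = (\<Union>w\<in>words n. (`) (psiw w) ` EG 1)"
  unfolding Suc_eq_plus1 by (rule EG_words)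

lemma VG_Suc_words: "VG (Suc n) = (\<Union>w\<in>words n. psiw w ` VG 1)"
  unfolding Suc_eq_plus1 by (rule VG_words)

lemma exchange_eq: "w \<in> words n \<Longrightarrow> exchange n w g t = outside n w t \<union> (`) (psiw w) ` g"
  by (auto simp: exchange_def outside_def split: if_splits)

lemma outside_eq: "w \<in> words n \<Longrightarrow> t \<subseteq> EG (Suc n) \<Longrightarrow> t = outside n w t \<union> (`) (psiw w) ` sub 1 w t"
proof -
  assume w: "w \<in> words n" and t: "t \<subseteq> EG (Suc n)"
  have "t = (\<Union>v\<in>words n. (`) (psiw v) ` sub 1 v t)" by (rule sub_cover_Suc[OF t])
  also have "\<dots> = outside n w t \<union> (`) (psiw w) ` sub 1 w t" unfolding outside_def using w by blast
  finally show ?thesis .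
qed

lemma sub_exchange:
  assumes "g \<subseteq> EG 1" "v \<in> words n"
  shows "sub 1 v (exchange n w g t) = (if v = w then g else sub 1 v t)"
  unfolding exchange_def using assms sub_subset
  by (subst sub_Union[OF assms(2)]) auto

lemma exchange_exchange:
  assumes "t \<subseteq> EG (Suc n)" "g \<subseteq> EG 1"
  shows "exchange n w (sub 1 w t) (exchange n w g t) = t"
proof -
  have "exchange n w (sub 1 w t) (exchange n w g t) =
      (\<Union>v\<in>words n. (`) (psiw v) ` (if v = w then sub 1 w t else sub 1 v t))"
    unfolding exchange_def[of n w "sub 1 w t"] using sub_exchange[OF assms(2)] by (intro SUP_cong) auto
  also have "\<dots> = (\<Union>v\<in>words n. (`) (psiw v) ` sub 1 v t)" by (intro SUP_cong) auto
  also have "\<dots> = t" by (rule sub_cover_Suc[OF assms(1), symmetric])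
  finally show ?thesis .
qed

text \<open>An edge outside w lies in another cell of the same level, which meets the cell w in a
  corner at most.\<close>

lemma outside_corner:
  assumes w: "w \<in> words n" and e: "{x, y} \<in> outside n w t" and x: "x \<in> psiw w ` VG 1"
  shows "\<exists>c\<in>idx. x = psiw w (u c)"
proof -
  obtain v e' where v: "v \<in> words n" "v \<noteq> w" "e' \<in> EG 1" "{x, y} = psiw v ` e'"
    using e sub_subset unfolding outside_def by blast
  have VT: "VG 1 \<subseteq> Tri"
  proof -
    have "vpos z \<in> Tri" for z by (cases z) (simp_all add: u_in_Tri psi_in_Tri idx_def)
    then show ?thesis unfolding VG1 by blast
  qed
  have "e' \<subseteq> Tri" using EG_edge[OF v(3)] by blast
  then have "x \<in> cell v" using v(4) unfolding cell_def by blast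
  moreover have "x \<in> cell w" using x VT unfolding cell_def by blast
  ultimately show ?thesis using cell_inter_corner[of w v x] v(1,2) w wordsD by metis
qed

text \<open>Both properties are obtained from \<open>reach_transfer\<close>, used in opposite
  directions. Connectedness passes from \<open>t\<close> to the new graph after each inner vertex
  has been moved to a corner. A cycle of the new graph has an edge outside the cell, since the
  filling is acyclic; the connection of the ends of this edge without the edge passes back to
  \<open>t\<close>, where the edge is a bridge.\<close>

lemma exchange_STrees:
  assumes t: "t \<in> STrees (Suc n)" and w: "w \<in> words n" and g': "g' \<subseteq> EG 1"
    and Tr: "Tr1 g' = Tr1 (sub 1 w t)" "Tr1 g' \<noteq> {}"
  shows "exchange n w g' t \<in> STrees (Suc n)"
proof -
  define g where "g = sub 1 w t"
  define Out where "Out = outside n w t"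
  let ?f = "psiw w"
  define t' where "t' = exchange n w g' t"
  have g: "g \<subseteq> EG 1" unfolding g_def by (rule sub_subset)
  have tO: "t = Out \<union> (`) ?f ` g" unfolding Out_def g_def using w STrees_subset[OF t] by (rule outside_eq)
  have t'Out: "t' = Out \<union> (`) ?f ` g'" unfolding t'_def Out_def using w by (rule exchange_eq)
  have f: "inj ?f" by (simp add: inj_def psiw_inj)
  have disj: "e \<notin> (`) ?f ` EG 1" if "e \<in> Out" for e
  proof
    assume "e \<in> (`) ?f ` EG 1"
    then obtain e1 where "e1 \<in> EG 1" "e = ?f ` e1" by blast
    moreover obtain v e2 where "v \<in> words n" "v \<noteq> w" "e2 \<in> EG 1" "e = psiw v ` e2"
      using \<open>e \<in> Out\<close> sub_subset unfolding Out_def outside_def by blast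
    ultimately show False using edge_cell_unique[of v n w e2 1 e1 1] w by simp
  qed
  have OE: "Out \<subseteq> EG (Suc n)" using tO STrees_subset[OF t] by blast
  have Oc: "\<exists>c\<in>idx. x = ?f (u c)" if "{x, y} \<in> Out" "x \<in> ?f ` VG 1" for x y
    using outside_corner[OF w] that unfolding Out_def by blast
  note ga = Tr1_eq_connectivity[OF g' g Tr[folded g_def]]
  have t'E: "t' \<subseteq> EG (Suc n)"
  proof -
    have "(`) ?f ` EG 1 \<subseteq> EG (Suc n)" using EG_Suc_words[of n] w by blast
    then show ?thesis using OE g' unfolding t'Out by blast
  qed
  have tac: "acyclic_graph t" and tconn: "\<And>x y. x \<in> VG (Suc n) \<Longrightarrow> y \<in> VG (Suc n) \<Longrightarrow> reach t x y"
    using t by (auto simp: STrees_def)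
  have "reach t' x y" if x: "x \<in> VG (Suc n)" and y: "y \<in> VG (Suc n)" for x y
  proof -
    have uV: "?f (u c) \<in> VG (Suc n)" if "c \<in> idx" for c
    proof -
      have "u c \<in> VG 1" using that by (rule u_in_VG1)
      then show ?thesis using VG_Suc_words[of n] w by blast
    qed
    have near: "\<exists>x'\<in>VG (Suc n). reach t' x x' \<and> (x' \<in> ?f ` VG 1 \<longrightarrow> (\<exists>c\<in>idx. x' = ?f (u c)))"
      if "x \<in> VG (Suc n)" for x
    proof (cases "x \<in> ?f ` VG 1")
      case True
      then obtain v where v: "v \<in> VG 1" "x = ?f v" by blast
      then obtain c where c: "c \<in> idx" "reach g' v (u c)" using ga(3) by blast
      then have "reach t' x (?f (u c))" using reach_mono[OF reach_image[OF c(2), of ?f]] v t'Out by blast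
      then show ?thesis using uV c(1) by blast
    next
      case False
      then show ?thesis using that by (intro bexI[of _ x]) auto
    qed
    obtain x' where x': "x' \<in> VG (Suc n)" "reach t' x x'" "x' \<in> ?f ` VG 1 \<longrightarrow> (\<exists>c\<in>idx. x' = ?f (u c))"
      using near[OF x] by blast
    obtain y' where y': "y' \<in> VG (Suc n)" "reach t' y y'" "y' \<in> ?f ` VG 1 \<longrightarrow> (\<exists>c\<in>idx. y' = ?f (u c))"
      using near[OF y] by blast
    have r: "reach (Out \<union> (`) ?f ` g) x' y'" using tconn[OF x'(1) y'(1)] tO by simp
    have "reach t' x' y'" unfolding t'Out
      by (rule reach_transfer[OF f _ g _ _ r]) (use Oc ga(2) x'(3) y'(3) in blast)+
    then show ?thesis using x'(2) y'(2) reach_sym reach_trans by meson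
  qed
  moreover have "acyclic_graph t'"
  proof (rule ccontr)
    assume "\<not> acyclic_graph t'"
    then obtain C where C: "C \<subseteq> t'" "\<not> acyclic_graph C"
      "\<And>e. e \<in> C \<Longrightarrow> \<exists>x y. e = {x, y} \<and> x \<noteq> y \<and> reach (t' - {e}) x y"
      using not_acyclic_cycle_edge by blast
    have "acyclic_graph ((`) ?f ` g')" using acyclic_graph_image[OF ga(1) f] .
    then have "\<not> C \<subseteq> (`) ?f ` g'" using C(2) acyclic_graph_mono by blast
    then obtain e where e: "e \<in> C" "e \<in> Out" using C(1) t'Out by blast
    then obtain x y where xy: "e = {x, y}" "x \<noteq> y" "reach (t' - {e}) x y" using C(3) by blast
    have "t' - {e} = (Out - {e}) \<union> (`) ?f ` g'" "t - {e} = (Out - {e}) \<union> (`) ?f ` g"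
      unfolding tO t'Out using disj[OF e(2)] g g' by blast+
    note eq = this
    have yx: "{y, x} \<in> Out" using e(2) xy(1) by (simp add: insert_commute)
    have "reach (t - {e}) x y" unfolding eq
      by (rule reach_transfer[OF f _ g' _ _ xy(3)[unfolded eq]])
        (use Oc[of x y] Oc[of y x] Oc ga(2) e(2) xy(1) yx in blast)+
    then show False using acyclic_graph_bridge[OF tac, of x y] xy e(2) tO by blast
  qed
  ultimately show ?thesis using t'E unfolding STrees_def t'_def by blast
qed


section \<open>The law of the filling of a cell given the trace\<close>

lemma sub_Tr: "w \<in> words n \<Longrightarrow> sub 0 w (Tr n t) = Tr1 (sub 1 w t)"
  unfolding Tr_def piw_eq by (rule sub_Union, assumption, rule Tr1_state(1)[OF sub_subset])

lemma Tr_exchange: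
  assumes "g \<subseteq> EG 1" "Tr1 g = Tr1 (sub 1 w t)"
  shows "Tr n (exchange n w g t) = Tr n t"
  unfolding Tr_def piw_eq using assms by (intro SUP_cong) (auto simp: sub_exchange)

definition st :: "nat list \<Rightarrow> complex set set \<Rightarrow> cs" where
  "st w t = cs_of (sub 0 w t)"

definition cfg :: "nat list \<Rightarrow> complex set set \<Rightarrow> cs \<times> cs \<times> cs" where
  "cfg w t = config_of (sub 1 w t)"

lemma st_snoc: "i \<in> idx \<Longrightarrow> st (w @ [i]) t = comp_state (cfg w t) i"
  by (elim idx_cases) (simp_all add: st_def sub_snoc cfg_def config_of_def idx_def)

lemma cfg_fibre: "w \<in> words n \<Longrightarrow> cfg w t \<in> fibre (st w (Tr n t))"
  by (simp add: fibre_def cfg_def st_def sub_Tr Tr1_state(2)[OF sub_subset])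

lemma words_1: "words 1 = {[1], [2], [3]}"
  unfolding One_nat_def words_Suc by (auto simp: idx_def One_nat_def)

text \<open>Through this bijection the counts of configurations in \<open>check\<close> become
  counts of subgraphs of \<open>G_1\<close>.\<close>

lemma config_of_bij: "bij_betw config_of (Pow (EG 1)) UNIV"
proof (rule bij_betwI')
  fix g h assume gh: "g \<in> Pow (EG 1)" "h \<in> Pow (EG 1)"
  show "config_of g = config_of h \<longleftrightarrow> g = h"
  proof
    assume eq: "config_of g = config_of h"
    have "sub 0 [1] g = sub 0 [1] h" "sub 0 [2] g = sub 0 [2] h" "sub 0 [3] g = sub 0 [3] h"
      by (rule cs_of_inj[OF sub_subset sub_subset], use eq in \<open>simp add: config_of_def\<close>)+
    then have "sub 0 v g = sub 0 v h" if "v \<in> words 1" for v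
      using that unfolding words_1 by blast
    moreover have "g = (\<Union>v\<in>words 1. (`) (psiw v) ` sub 0 v g)" "h = (\<Union>v\<in>words 1. (`) (psiw v) ` sub 0 v h)"
      using sub_cover[of g 1 0] sub_cover[of h 1 0] gh by simp_all
    ultimately show "g = h" by (metis (no_types, lifting) SUP_cong)
  qed simp
next
  fix c :: "cs \<times> cs \<times> cs"
  obtain s1 s2 s3 where c: "c = (s1, s2, s3)" by (cases c)
  obtain S1 S2 S3 where S: "S1 \<subseteq> EG 0" "cs_of S1 = s1" "S2 \<subseteq> EG 0" "cs_of S2 = s2" "S3 \<subseteq> EG 0" "cs_of S3 = s3"
    using cs_of_surj by meson
  define F where "F v = (if v = [1] then S1 else if v = [2] then S2 else S3)" for v :: "nat list"
  define g where "g = (\<Union>v\<in>words 1. (`) (psiw v) ` F v)"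
  have FE: "F v \<subseteq> EG 0" for v using S by (simp add: F_def)
  have "sub 0 v g = F v" if "v \<in> words 1" for v unfolding g_def by (rule sub_Union[OF that FE])
  then have "config_of g = c" by (simp add: config_of_def words_1 F_def S c)
  moreover have "g \<subseteq> EG (1 + 0)" unfolding EG_words g_def using FE by blast
  ultimately show "\<exists>g\<in>Pow (EG 1). c = config_of g" by (intro bexI[of _ g]) auto
qed simp

definition ext :: "nat \<Rightarrow> complex set set \<Rightarrow> complex set set set" where
  "ext n t0 = {t \<in> STrees (Suc n). Tr n t = t0}"

lemma finite_ext [simp]: "finite (ext n t0)"
  unfolding ext_def using finite_STrees by auto

text \<open>Replacing the inside of the cell w by g while remembering the old inside is an involution on
  pairs (t, g), so that given the trace the inside of w is uniform and independent of the rest.\<close>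

lemma fibre_average:
  assumes w: "w \<in> words n" and s: "st w t0 \<noteq> (False, False, False)"
    and H: "\<And>t g. t \<in> ext n t0 \<Longrightarrow> g \<subseteq> EG 1 \<Longrightarrow> H (exchange n w g t) = H t"
  shows "real (card (fibre (st w t0))) * (\<Sum>t\<in>ext n t0. \<phi> (cfg w t) * H t) =
    (\<Sum>c\<in>fibre (st w t0). \<phi> c) * (\<Sum>t\<in>ext n t0. H t)"
proof -
  define P where "P = {g. g \<subseteq> EG 1 \<and> Tr1 g = sub 0 w t0}"
  have finP: "finite P" by (rule finite_subset[of _ "Pow (EG 1)"]) (auto simp: P_def finite_EG)
  have bij: "bij_betw config_of P (fibre (st w t0))"
  proof -
    have "P = {g \<in> Pow (EG 1). config_of g \<in> fibre (st w t0)}"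
    proof (intro set_eqI)
      fix g
      show "g \<in> P \<longleftrightarrow> g \<in> {g \<in> Pow (EG 1). config_of g \<in> fibre (st w t0)}"
      proof (cases "g \<subseteq> EG 1")
        case True
        have "Tr1 g = sub 0 w t0 \<longleftrightarrow> cs_of (Tr1 g) = cs_of (sub 0 w t0)"
          using cs_of_inj[OF Tr1_state(1)[OF True] sub_subset] by metis
        then show ?thesis
          unfolding P_def fibre_def st_def mem_Collect_eq Tr1_state(2)[OF True] using True by simp
      next
        case False
        then show ?thesis by (simp add: P_def)
      qed
    qed
    then have P: "P \<subseteq> Pow (EG 1)" and im: "config_of ` P = fibre (st w t0) \<inter> config_of ` Pow (EG 1)" by auto
    show ?thesis unfolding bij_betw_def
    proof
      show "inj_on config_of P" using config_of_bij P unfolding bij_betw_def by (blast intro: inj_on_subset)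
      show "config_of ` P = fibre (st w t0)" using im config_of_bij unfolding bij_betw_def by simp
    qed
  qed
  have card: "card (fibre (st w t0)) = card P" using bij_betw_same_card[OF bij] by simp
  have sumP: "(\<Sum>c\<in>fibre (st w t0). \<phi> c) = (\<Sum>g\<in>P. \<phi> (config_of g))"
    using sum.reindex_bij_betw[OF bij, of \<phi>] by simp
  have ne: "sub 0 w t0 \<noteq> {}" using s cs_of_single(1) by (auto simp: st_def)
  have TrP: "Tr1 (sub 1 w t) = sub 0 w t0" if "t \<in> ext n t0" for t
    using that sub_Tr[OF w, of t] by (auto simp: ext_def)
  have ex: "exchange n w g t \<in> ext n t0" if "t \<in> ext n t0" "g \<in> P" for t g
    using that TrP[OF that(1)] ne exchange_STrees[of t n w g] Tr_exchange[of g w t n] w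
    by (simp add: ext_def P_def)
  have sP: "sub 1 w t \<in> P" if "t \<in> ext n t0" for t using TrP[OF that] sub_subset by (simp add: P_def)
  have xx: "exchange n w (sub 1 w t) (exchange n w g t) = t" "sub 1 w (exchange n w g t) = g"
    if "t \<in> ext n t0" "g \<in> P" for t g
    using that exchange_exchange[of t n g w] sub_exchange[of g w n w t] w STrees_subset
    by (auto simp: ext_def P_def)
  have HP: "H (exchange n w g t) = H t" if "t \<in> ext n t0" "g \<in> P" for t g
    using H that by (simp add: P_def)
  have "real (card P) * (\<Sum>t\<in>ext n t0. \<phi> (cfg w t) * H t) =
      (\<Sum>(t, g)\<in>ext n t0 \<times> P. \<phi> (cfg w t) * H t)"
    by (simp add: sum.cartesian_product[symmetric] sum_distrib_left mult_ac)
  also have "\<dots> = (\<Sum>(t, g)\<in>ext n t0 \<times> P. \<phi> (config_of g) * H t)"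
    by (rule sum.reindex_bij_witness[where i = "\<lambda>(t, g). (exchange n w g t, sub 1 w t)"
        and j = "\<lambda>(t, g). (exchange n w g t, sub 1 w t)"])
      (use xx ex sP HP in \<open>auto simp: cfg_def\<close>)
  also have "\<dots> = (\<Sum>g\<in>P. \<phi> (config_of g)) * (\<Sum>t\<in>ext n t0. H t)"
    by (simp add: sum_product sum.cartesian_product[symmetric] mult.commute sum.swap[of _ P])
  finally show ?thesis unfolding card sumP .
qed

section \<open>The sequence of cells crossed by the path\<close>

type_synonym item = "nat list \<times> nat \<times> nat"

definition children :: "complex set set \<Rightarrow> item \<Rightarrow> item list" where
  "children t = (\<lambda>(w, a, b). map (\<lambda>(i, x, z). (w @ [i], x, z)) (expand (cfg w t) a b))"

text \<open>The item (w, a, b) says that the path from \<open>u 1\<close> to \<open>u 2\<close> crosses the cell w,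
  entering it at corner a and leaving it at corner b.\<close>

fun itin :: "nat \<Rightarrow> complex set set \<Rightarrow> item list" where
  "itin 0 t = [([], 1, 2)]"
| "itin (Suc n) t = concat (map (children t) (itin n (Tr n t)))"

definition steps_of :: "complex set set \<Rightarrow> item \<Rightarrow> item list" where
  "steps_of t = (\<lambda>(w, a, b). if opp (st w t) (third a b) then [(w, a, b)]
     else [(w, a, third a b), (w, third a b, b)])"

definition steps :: "nat \<Rightarrow> complex set set \<Rightarrow> item list" where
  "steps n t = concat (map (steps_of t) (itin n t))"

definition start :: "item \<Rightarrow> complex" where "start = (\<lambda>(w, a, b). psiw w (u a))"
definition finish :: "item \<Rightarrow> complex" where "finish = (\<lambda>(w, a, b). psiw w (u b))"

fun chain :: "complex \<Rightarrow> item list \<Rightarrow> complex \<Rightarrow> bool" where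
  "chain p [] q \<longleftrightarrow> p = q"
| "chain p (s # r) q \<longleftrightarrow> start s = p \<and> chain (finish s) r q"

lemma chain_append: "chain p (xs @ ys) q \<longleftrightarrow> (\<exists>m. chain p xs m \<and> chain m ys q)"
  by (induction xs arbitrary: p) auto

lemma chain_concat_map:
  assumes "chain p xs q" "\<And>s. s \<in> set xs \<Longrightarrow> chain (start s) (f s) (finish s)"
  shows "chain p (concat (map f xs)) q"
  using assms
proof (induction xs arbitrary: p)
  case (Cons s r)
  have "chain (start s) (f s) (finish s)" by (rule Cons.prems(2)) simp
  moreover have "chain (finish s) (concat (map f r)) q" using Cons.prems by (intro Cons.IH) simp_all
  moreover have "start s = p" using Cons.prems(1) by simp
  ultimately show ?case by (auto simp: chain_append)
qed simp

definition vertex_list :: "item list \<Rightarrow> complex \<Rightarrow> complex list" where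
  "vertex_list S q = map start S @ [q]"

lemma chain_nth:
  assumes "chain p S q" "i < length S"
  shows "vertex_list S q ! i = start (S ! i)" "vertex_list S q ! Suc i = finish (S ! i)"
proof -
  show "vertex_list S q ! i = start (S ! i)" using assms(2) by (simp add: vertex_list_def nth_append)
  show "vertex_list S q ! Suc i = finish (S ! i)"
    using assms
  proof (induction S arbitrary: p i)
    case (Cons s r)
    show ?case
    proof (cases i)
      case 0
      then show ?thesis using Cons.prems by (cases r) (auto simp: vertex_list_def)
    next
      case (Suc j)
      then show ?thesis using Cons.IH[of "finish s" j] Cons.prems by (simp add: vertex_list_def)
    qed
  qed simp
qed

lemma chain_hd: "chain p S q \<Longrightarrow> hd (vertex_list S q) = p"
  by (cases S) (simp_all add: vertex_list_def)

definition valid_step :: "nat \<Rightarrow> complex set set \<Rightarrow> item \<Rightarrow> bool" where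
  "valid_step n t = (\<lambda>(w, x, y). w \<in> words n \<and> x \<in> idx \<and> y \<in> idx \<and> x \<noteq> y \<and> {psiw w (u x), psiw w (u y)} \<in> t)"

text \<open>Steps in different cells use different edges, so a step can be undone immediately only
  by a step in the same cell. This relation excludes that case.\<close>

definition no_return :: "item \<Rightarrow> item \<Rightarrow> bool" where
  "no_return = (\<lambda>(w, x, y) (w', x', y'). w = w' \<longrightarrow> x \<noteq> y')"

text \<open>A chain of tree edges without backtracking is simple by
  \<open>nonbacktracking_distinct\<close>, and simple paths in a tree are unique. So the path of the
  tree is identified without being followed edge by edge.\<close>

lemma chain_path:
  assumes t: "t \<in> STrees n" and ch: "chain p S q" and v: "\<And>s. s \<in> set S \<Longrightarrow> valid_step n t s"
    and nb: "successively no_return S"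
  shows "tpath t p q = vertex_list S q" "distinct (vertex_list S q)"
proof -
  have len: "length (vertex_list S q) = Suc (length S)" by (simp add: vertex_list_def)
  have ac: "acyclic_graph t" and tE: "t \<subseteq> EG n" using t by (auto simp: STrees_def)
  have loop: "{x} \<notin> t" for x using tE EG_no_loop by blast
  have w: "walk t (vertex_list S q)" unfolding walk_def len
  proof (intro conjI allI impI)
    fix i assume "Suc i < Suc (length S)"
    then have i: "i < length S" by simp
    obtain w x y where s: "S ! i = (w, x, y)" by (cases "S ! i")
    then have "{psiw w (u x), psiw w (u y)} \<in> t" using v[OF nth_mem[OF i]] by (simp add: valid_step_def)
    then show "{vertex_list S q ! i, vertex_list S q ! Suc i} \<in> t"
      by (simp add: chain_nth[OF ch i] s start_def finish_def)
  qed (simp add: vertex_list_def)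
  show d: "distinct (vertex_list S q)"
  proof (rule nonbacktracking_distinct[OF ac loop w])
    fix i assume "i + 2 < length (vertex_list S q)"
    then have i: "i < length S" "Suc i < length S" by (simp_all add: len)
    obtain w x y where s: "S ! i = (w, x, y)" by (cases "S ! i")
    obtain w' x' y' where s': "S ! Suc i = (w', x', y')" by (cases "S ! Suc i")
    have vs: "w \<in> words n" "x \<in> idx" "y \<in> idx" "x \<noteq> y" "w' \<in> words n" "x' \<in> idx" "y' \<in> idx" "x' \<noteq> y'"
      using v[OF nth_mem[OF i(1)]] v[OF nth_mem[OF i(2)]] s s' by (auto simp: valid_step_def)
    have nb': "w = w' \<longrightarrow> x \<noteq> y'" using nb i(2) s s' by (auto simp: successively_conv_nth no_return_def)
    show "vertex_list S q ! i \<noteq> vertex_list S q ! (i + 2)"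
    proof
      assume eq: "vertex_list S q ! i = vertex_list S q ! (i + 2)"
      have mid: "psiw w (u y) = psiw w' (u x')"
        using chain_nth(2)[OF ch i(1)] chain_nth(1)[OF ch i(2)] s s' by (simp add: start_def finish_def)
      have ends: "psiw w (u x) = psiw w' (u y')"
        using eq chain_nth(1)[OF ch i(1)] chain_nth(2)[OF ch i(2)] s s' by (simp add: start_def finish_def)
      have "psiw w ` {u x, u y} = psiw w' ` {u y', u x'}" using mid ends by simp
      moreover have "{u x, u y} \<in> EG 0" "{u y', u x'} \<in> EG 0" using vs EG0_iff by metis+
      ultimately have "w = w'" using edge_cell_unique[OF vs(1) vs(5)] by blast
      then show False using nb' ends u_inj[OF vs(2) vs(7)] by (simp add: psiw_inj)
    qed
  qed
  show "tpath t p q = vertex_list S q"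
    using tpath_eq[OF ac loop w d] chain_hd[OF ch] by (simp add: vertex_list_def)
qed

text \<open>If the direct edge and one of the other two edges are missing, then \<open>u 1\<close>
  or \<open>u 2\<close> has no neighbour at all.\<close>

lemma STrees_0_conn: "t \<in> STrees 0 \<Longrightarrow> conn (st [] t) 1 2"
proof (rule ccontr)
  assume t: "t \<in> STrees 0" and nc: "\<not> conn (st [] t) 1 2"
  have s: "sub 0 [] t = t" using STrees_subset[OF t] by (auto simp: sub_def)
  have n12: "{u 1, u 2} \<notin> t" and n3: "{u 1, u 3} \<notin> t \<or> {u 2, u 3} \<notin> t"
    using nc by (auto simp: conn_def st_def s cs_of_def third_def)
  have V: "u 1 \<in> VG 0" "u 2 \<in> VG 0" by (simp_all add: VG.simps)
  have isolated: "y = x" if "reach t x y" "\<And>z. {x, z} \<notin> t" for x y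
    using that(1)
  proof (induction rule: reach_induct)
    case (step y z)
    then show ?case using that(2)[of z] by simp
  qed simp
  have e: "\<exists>a\<in>idx. z = u a \<and> a \<noteq> c" if cz: "{u c, z} \<in> t" "c \<in> idx" for c z
  proof -
    have "{u c, z} \<in> EG 0" using cz(1) STrees_subset[OF t] by blast
    then obtain a b where ab: "a \<in> idx" "b \<in> idx" "a \<noteq> b" "{u c, z} = {u a, u b}"
      unfolding EG0_iff by blast
    then consider "u c = u a" "z = u b" | "u c = u b" "z = u a" by (auto simp: doubleton_eq_iff)
    then show ?thesis
    proof cases
      case 1
      then show ?thesis using u_inj[OF cz(2) ab(1)] ab by blast
    next
      case 2
      then show ?thesis using u_inj[OF cz(2) ab(2)] ab by blast
    qed
  qed
  have "{u 1, z} \<notin> t" if "{u 1, u 3} \<notin> t" for z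
    using e[of 1 z] that n12 by (auto simp: idx_def)
  moreover have "{u 2, z} \<notin> t" if "{u 2, u 3} \<notin> t" for z
    using e[of 2 z] that n12 by (auto simp: idx_def insert_commute)
  moreover have "reach t (u 1) (u 2)" "reach t (u 2) (u 1)" using t V by (auto simp: STrees_def)
  ultimately have "u 1 = u 2" using isolated n3 by metis
  then show False using u_distinct by simp
qed

lemma expand_facts:
  assumes "a \<in> idx" "b \<in> idx" "a \<noteq> b" "(i, x, z) \<in> set (expand c a b)"
  shows "i \<in> idx" "x \<in> idx" "z \<in> idx" "x \<noteq> z"
  using assms third_third[OF assms(1-3)] unfolding expand_def by (auto split: if_splits)

lemma expand_distinct:
  assumes "a \<in> idx" "b \<in> idx" "a \<noteq> b"
  shows "distinct (map fst (expand c a b))"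
  using third_third[OF assms] assms(3) by (auto simp: expand_def)

lemma expand_nonempty [simp]: "expand c a b \<noteq> []"
  by (simp add: expand_def)

definition valid_item :: "nat \<Rightarrow> complex set set \<Rightarrow> item \<Rightarrow> bool" where
  "valid_item n t = (\<lambda>(w, a, b). w \<in> words n \<and> a \<in> idx \<and> b \<in> idx \<and> a \<noteq> b \<and> conn (st w t) a b)"

lemma children_valid:
  assumes "valid_item n (Tr n t) s" "s' \<in> set (children t s)"
  shows "valid_item (Suc n) t s'"
proof -
  obtain w a b where s: "s = (w, a, b)" by (cases s)
  have v: "w \<in> words n" "a \<in> idx" "b \<in> idx" "a \<noteq> b" "conn (st w (Tr n t)) a b"
    using assms(1) by (auto simp: s valid_item_def)
  obtain i x z where s': "(i, x, z) \<in> set (expand (cfg w t) a b)" "s' = (w @ [i], x, z)"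
    using assms(2) by (auto simp: children_def s)
  note e = expand_facts[OF v(2-4) s'(1)]
  have "conn (comp_state (cfg w t) i) x z"
    by (rule fibre_facts(1)[OF v(5) v(2-4) _ cfg_fibre[OF v(1)] s'(1)]) (use cfg_fibre[OF v(1)] in blast)
  then show ?thesis using e v(1) s' by (simp add: valid_item_def words_snoc st_snoc)
qed

lemma children_distinct:
  "valid_item n t' s \<Longrightarrow> distinct (map fst (children t s))"
proof -
  assume v: "valid_item n t' s"
  obtain w a b where s: "s = (w, a, b)" by (cases s)
  have "map fst (children t s) = map (\<lambda>i. w @ [i]) (map fst (expand (cfg w t) a b))"
    by (simp add: children_def s comp_def case_prod_beta)
  then show ?thesis using expand_distinct[of a b "cfg w t"] v s
    by (simp add: valid_item_def distinct_map inj_on_def)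
qed

lemma children_chain:
  assumes "valid_item n t' s" shows "chain (start s) (children t s) (finish s)"
proof -
  obtain w a b where s: "s = (w, a, b)" by (cases s)
  show ?thesis using psi_u_commute
    by (simp add: s children_def expand_def start_def finish_def psiw_append third_third)
qed

lemma children_word: "s' \<in> set (children t s) \<Longrightarrow> \<exists>i. fst s' = fst s @ [i]"
  by (auto simp: children_def split: prod.splits)

lemma steps_of_word: "s' \<in> set (steps_of t s) \<Longrightarrow> fst s' = fst s"
  by (auto simp: steps_of_def split: prod.splits if_splits)

lemma steps_of_chain: "chain (start s) (steps_of t s) (finish s)"
  by (cases s) (simp add: steps_of_def start_def finish_def)

lemma steps_of_nonempty [simp]: "steps_of t s \<noteq> []"
  by (cases s) (simp add: steps_of_def)

lemma steps_of_valid: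
  assumes "valid_item n t s" "s' \<in> set (steps_of t s)" shows "valid_step n t s'"
proof -
  obtain w a b where s: "s = (w, a, b)" by (cases s)
  have v: "w \<in> words n" "a \<in> idx" "b \<in> idx" "a \<noteq> b" "conn (st w t) a b"
    using assms(1) by (auto simp: s valid_item_def)
  let ?c = "third a b"
  note th = third_third[OF v(2-4)]
  have *: "opp (st w t) (third x y) \<longleftrightarrow> {psiw w (u x), psiw w (u y)} \<in> t"
    if "x \<in> idx" "y \<in> idx" "x \<noteq> y" for x y
  proof -
    have "{u x, u y} \<in> EG 0" using that EG0_iff by blast
    then show ?thesis unfolding st_def opp_cs_of[OF that] by (simp add: sub_def)
  qed
  show ?thesis
  proof (cases "opp (st w t) ?c")
    case True
    then show ?thesis using assms(2) v *[OF v(2-4)] by (simp add: s steps_of_def valid_step_def)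
  next
    case False
    then have "opp (st w t) a" "opp (st w t) b" using v(5) by (auto simp: conn_def)
    then have "{psiw w (u ?c), psiw w (u b)} \<in> t" "{psiw w (u a), psiw w (u ?c)} \<in> t"
      using *[OF th(1) v(3) th(3)] *[OF v(2) th(1) th(2)[symmetric]] th by auto
    then show ?thesis using False assms(2) v th by (auto simp: s steps_of_def valid_step_def)
  qed
qed

lemma successively_steps:
  assumes "distinct (map fst its)" "\<And>s. s \<in> set its \<Longrightarrow> valid_item n t s"
  shows "successively no_return (concat (map (steps_of t) its))"
  using assms
proof (induction its)
  case (Cons s its)
  obtain w a b where s: "s = (w, a, b)" by (cases s)
  have "a \<noteq> b" using Cons.prems(2)[of s] by (simp add: s valid_item_def)
  then have 1: "successively no_return (steps_of t s)"
    by (simp add: steps_of_def s no_return_def)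
  have 2: "fst (last (steps_of t s)) \<noteq> fst (hd (concat (map (steps_of t) its)))"
    if ne: "concat (map (steps_of t) its) \<noteq> []"
  proof -
    have "fst (last (steps_of t s)) = fst s" using steps_of_word last_in_set steps_of_nonempty by blast
    moreover have "fst (hd (concat (map (steps_of t) its))) \<in> fst ` set its"
    proof -
      obtain s2 where s2: "s2 \<in> set its" "hd (concat (map (steps_of t) its)) \<in> set (steps_of t s2)"
        using hd_in_set[OF ne] by auto
      then show ?thesis using steps_of_word[OF s2(2)] by (metis imageI)
    qed
    moreover have "fst s \<notin> fst ` set its" using Cons.prems(1) by simp
    ultimately show ?thesis by metis
  qed
  have 3: "successively no_return (concat (map (steps_of t) its))"
  proof (rule Cons.IH)
    show "distinct (map fst its)" using Cons.prems(1) by simp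
    show "\<And>s. s \<in> set its \<Longrightarrow> valid_item n t s" by (rule Cons.prems(2)) simp
  qed
  have R: "no_return p q" if "fst p \<noteq> fst q" for p q :: item
    using that by (cases p; cases q) (simp add: no_return_def)
  show ?case unfolding list.map concat.simps successively_append_iff using 1 3 R[OF 2] by blast
qed simp

text \<open>The assumption is discharged for a consistent sequence of uniform spanning trees in
  \<open>consistent_trees\<close>.\<close>

locale trace_trees =
  assumes Tr_STrees: "t \<in> STrees (Suc n) \<Longrightarrow> Tr n t \<in> STrees n"
begin

text \<open>Distinctness of the words says that the path crosses every cell at most once. It is
  inherited because a crossing passes through each subcell at most once and different cells have
  different subcells.\<close>

lemma itin_facts:
  "t \<in> STrees n \<Longrightarrow> (\<forall>s\<in>set (itin n t). valid_item n t s) \<and> distinct (map fst (itin n t)) \<and>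
    chain (u 1) (itin n t) (u 2)"
proof (induction n arbitrary: t)
  case 0
  then show ?case using STrees_0_conn by (simp add: valid_item_def idx_def start_def finish_def)
next
  case (Suc n)
  note IH = Suc.IH[OF Tr_STrees[OF Suc.prems]]
  have v: "\<And>s. s \<in> set (itin n (Tr n t)) \<Longrightarrow> valid_item n (Tr n t) s" using IH by blast
  have d: "distinct (map fst (concat (map (children t) its)))"
    if "distinct (map fst its)" "\<And>s. s \<in> set its \<Longrightarrow> valid_item n (Tr n t) s" for its
    using that
  proof (induction its)
    case (Cons s its)
    have "fst s' \<notin> fst ` set (concat (map (children t) its))" if "s' \<in> set (children t s)" for s'
    proof
      assume "fst s' \<in> fst ` set (concat (map (children t) its))"
      then obtain s2 s2' where "s2 \<in> set its" "s2' \<in> set (children t s2)" "fst s2' = fst s'" by auto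
      moreover from this have "fst s2 = fst s" using children_word[of s2' t s2] children_word[OF that] by auto
      ultimately show False using Cons.prems(1) by (auto simp: image_iff)
    qed
    moreover have "distinct (map fst (children t s))"
      by (rule children_distinct) (rule Cons.prems(2), simp)
    moreover have "distinct (map fst (concat (map (children t) its)))"
    proof (rule Cons.IH)
      show "distinct (map fst its)" using Cons.prems(1) by simp
      show "\<And>s. s \<in> set its \<Longrightarrow> valid_item n (Tr n t) s" by (rule Cons.prems(2)) simp
    qed
    ultimately show ?case unfolding list.map concat.simps map_append distinct_append set_map by blast
  qed simp
  have "chain (u 1) (itin (Suc n) t) (u 2)"
    unfolding itin.simps
  proof (rule chain_concat_map)
    show "chain (u 1) (itin n (Tr n t)) (u 2)" using IH by blast
    show "\<And>s. s \<in> set (itin n (Tr n t)) \<Longrightarrow> chain (start s) (children t s) (finish s)"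
      by (rule children_chain) (rule v)
  qed
  moreover have "\<forall>s\<in>set (itin (Suc n) t). valid_item (Suc n) t s" using children_valid v by fastforce
  ultimately show ?case using d[of "itin n (Tr n t)"] IH v by simp
qed

text \<open>This ties the itinerary to the path of the tree; afterwards lengths and positions on the
  path are counted in \<open>steps\<close>.\<close>

lemma steps_facts:
  assumes t: "t \<in> STrees n"
  shows "chain (u 1) (steps n t) (u 2)" "\<And>s. s \<in> set (steps n t) \<Longrightarrow> valid_step n t s"
    "tpath t (u 1) (u 2) = vertex_list (steps n t) (u 2)"
    "distinct (vertex_list (steps n t) (u 2))"
proof -
  note I = itin_facts[OF t]
  show ch: "chain (u 1) (steps n t) (u 2)"
    unfolding steps_def by (rule chain_concat_map) (use I steps_of_chain in auto)
  show v: "\<And>s. s \<in> set (steps n t) \<Longrightarrow> valid_step n t s"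
    unfolding steps_def using I steps_of_valid by fastforce
  have "successively no_return (steps n t)"
    unfolding steps_def by (rule successively_steps) (use I in auto)
  from chain_path[OF t ch v this]
  show "tpath t (u 1) (u 2) = vertex_list (steps n t) (u 2)" "distinct (vertex_list (steps n t) (u 2))"
    by auto
qed

end

section \<open>Moment bounds\<close>

lemma finite_fibre [simp]: "finite (fibre s)"
  by (rule finite_subset[of _ "set configs"]) (use set_configs in auto)

lemma cfg_exchange: "g \<subseteq> EG 1 \<Longrightarrow> v \<in> words n \<Longrightarrow> v \<noteq> w \<Longrightarrow> cfg v (exchange n w g t) = cfg v t"
  by (simp add: cfg_def sub_exchange)

definition crossing :: "complex set set \<Rightarrow> item \<Rightarrow> real" where
  "crossing t = (\<lambda>(w, a, b). crossing_weight hval (cfg w t) a b)"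

definition weight :: "complex set set \<Rightarrow> item \<Rightarrow> real" where
  "weight t = (\<lambda>(w, a, b). hval (ctype (st w t) a b))"

lemma alpha_bar_less: "alpha_bar < 7/3"
proof -
  have "sqrt 205 < 15" by (rule real_less_lsqrt) simp_all
  then show ?thesis by (simp add: alpha_bar_def)
qed

lemma hval_bounds: "hval y \<le> 1" "1 / 3 \<le> hval y"
  using alpha_bar_gt alpha_bar_less by (auto simp: hval_def field_simps)

lemma children_weight:
  assumes "valid_item n t0 s"
  shows "(\<Sum>s'\<leftarrow>children t s. weight t s') = crossing t s"
proof -
  obtain w a b where s: "s = (w, a, b)" by (cases s)
  have ab: "a \<in> idx" "b \<in> idx" "a \<noteq> b" using assms by (auto simp: s valid_item_def)
  have "(\<Sum>s'\<leftarrow>children t s. weight t s') =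
     (\<Sum>(i, x, z)\<leftarrow>expand (cfg w t) a b. hval (ctype (st (w @ [i]) t) x z))"
    by (simp add: s children_def weight_def comp_def split_def)
  also have "\<dots> = (\<Sum>(i, x, z)\<leftarrow>expand (cfg w t) a b. hval (ctype (comp_state (cfg w t) i) x z))"
  proof (intro arg_cong[where f = sum_list] map_cong refl)
    fix p assume p: "p \<in> set (expand (cfg w t) a b)"
    obtain i x z where "p = (i, x, z)" by (cases p)
    then show "(case p of (i, x, z) \<Rightarrow> hval (ctype (st (w @ [i]) t) x z)) =
      (case p of (i, x, z) \<Rightarrow> hval (ctype (comp_state (cfg w t) i) x z))"
      using expand_facts(1)[OF ab, of i x z "cfg w t"] p st_snoc by simp
  qed
  finally show ?thesis by (simp add: crossing_def crossing_weight_def s)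
qed

lemma crossing_bounds: "0 \<le> crossing t s" "crossing t s \<le> 3"
proof -
  obtain w a b where s: "s = (w, a, b)" by (cases s)
  let ?f = "\<lambda>(i, x, z). hval (ctype (comp_state (cfg w t) i) x z)"
  have f: "0 \<le> ?f p" "?f p \<le> 1" for p using hval_pos[THEN less_imp_le] hval_bounds(1) by (auto split: prod.splits)
  have l: "length (expand (cfg w t) a b) \<le> 3" by (simp add: expand_def)
  have "0 \<le> (\<Sum>p\<leftarrow>xs. ?f p) \<and> (\<Sum>p\<leftarrow>xs. ?f p) \<le> real (length xs)" for xs
  proof (induction xs)
    case (Cons p xs)
    then show ?case using f[of p] by (simp del: split_paired_All)
  qed simp
  from this[of "expand (cfg w t) a b"] show "0 \<le> crossing t s" "crossing t s \<le> 3"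
    using l by (simp_all add: crossing_def crossing_weight_def s)
qed

text \<open>A conditional expectation given the trace, written as a sum over extensions. The
  eigenvector makes the mean weight of the children exactly \<open>alpha_bar\<close> times the
  weight of the parent, and a factor \<open>H\<close> that ignores the inside of the cell comes out
  by independence.\<close>

lemma crossing_average:
  assumes v: "valid_item n t0 s"
    and H: "\<And>t g. t \<in> ext n t0 \<Longrightarrow> g \<subseteq> EG 1 \<Longrightarrow> H (exchange n (fst s) g t) = H t"
  shows "(\<Sum>t\<in>ext n t0. crossing t s * H t) = alpha_bar * weight t0 s * (\<Sum>t\<in>ext n t0. H t)"
proof (cases "ext n t0 = {}")
  case False
  obtain w a b where s: "s = (w, a, b)" by (cases s)
  have w: "w \<in> words n" and ab: "a \<in> idx" "b \<in> idx" "a \<noteq> b" and c: "conn (st w t0) a b"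
    using v by (auto simp: s valid_item_def)
  have ns: "st w t0 \<noteq> (False, False, False)" using c by (auto simp: conn_def split: if_splits)
  have ne: "fibre (st w t0) \<noteq> {}"
    using False cfg_fibre[OF w] by (auto simp: ext_def)
  then have pos: "real (card (fibre (st w t0))) > 0" by (simp add: card_gt_0_iff)
  have "real (card (fibre (st w t0))) * (\<Sum>t\<in>ext n t0. crossing_weight hval (cfg w t) a b * H t) =
    (\<Sum>c\<in>fibre (st w t0). crossing_weight hval c a b) * (\<Sum>t\<in>ext n t0. H t)"
    by (rule fibre_average[OF w ns, of H "\<lambda>c. crossing_weight hval c a b"]) (use H in \<open>auto simp: s\<close>)
  also have "\<dots> = real (card (fibre (st w t0))) * (alpha_bar * weight t0 s * (\<Sum>t\<in>ext n t0. H t))"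
    using fibre_facts(2)[OF c ab ne] by (simp add: weight_def s)
  finally show ?thesis using pos ne by (simp add: crossing_def s)
qed simp

lemma corner_average:
  assumes v: "valid_item n t0 (w, a, b)"
  shows "3 * (\<Sum>t\<in>ext n t0. real (corner_weight (cfg w t) a b)) \<le>
    2 * real (kappa (ctype (st w t0) a b)) * real (card (ext n t0))"
proof (cases "ext n t0 = {}")
  case False
  have w: "w \<in> words n" and ab: "a \<in> idx" "b \<in> idx" "a \<noteq> b" and c: "conn (st w t0) a b"
    using v by (auto simp: valid_item_def)
  have ns: "st w t0 \<noteq> (False, False, False)" using c by (auto simp: conn_def split: if_splits)
  have ne: "fibre (st w t0) \<noteq> {}"
    using False cfg_fibre[OF w] by (auto simp: ext_def)
  then have pos: "real (card (fibre (st w t0))) > 0" by (simp add: card_gt_0_iff)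
  define N E S k C where NE: "N = real (card (fibre (st w t0)))"
    "E = (\<Sum>t\<in>ext n t0. real (corner_weight (cfg w t) a b))"
    "S = (\<Sum>c\<in>fibre (st w t0). real (corner_weight c a b))"
    "k = real (kappa (ctype (st w t0) a b))" "C = real (card (ext n t0))"
  have "real (card (fibre (st w t0))) * (\<Sum>t\<in>ext n t0. real (corner_weight (cfg w t) a b) * 1) =
    (\<Sum>c\<in>fibre (st w t0). real (corner_weight c a b)) * (\<Sum>t\<in>ext n t0. 1)"
    by (rule fibre_average[OF w ns, of "\<lambda>_. 1" "\<lambda>c. real (corner_weight c a b)"]) simp
  moreover have "3 * (\<Sum>c\<in>fibre (st w t0). real (corner_weight c a b)) \<le>
      2 * real (kappa (ctype (st w t0) a b)) * real (card (fibre (st w t0)))"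
    using of_nat_mono[OF fibre_facts(3)[OF c ab ne], where ?'a = real] by simp
  ultimately have "N * E = S * C" "3 * S \<le> 2 * k * N" by (simp_all add: NE)
  then have "N * (3 * E) \<le> N * (2 * k * C)"
    using mult_right_mono[of "3 * S" "2 * k * N" C] by (simp add: NE(5) mult_ac)
  then show ?thesis using pos by (simp add: NE)
qed simp

definition part :: "nat list \<Rightarrow> nat \<Rightarrow> complex set set \<Rightarrow> item list" where
  "part v n t = filter (\<lambda>s. take (length v) (fst s) = v) (itin n t)"

text \<open>With the eigenvector as weights, \<open>mass v n\<close> divided by
  \<open>alpha_bar ^ n\<close> has the martingale property in n from the level of v on; see
  \<open>mass_average\<close>.\<close>

definition mass :: "nat list \<Rightarrow> nat \<Rightarrow> complex set set \<Rightarrow> real" where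
  "mass v n t = (\<Sum>s\<leftarrow>part v n t. weight t s)"

lemma weight_bounds: "weight t s \<le> 1" "1 / 3 \<le> weight t s"
  using hval_bounds by (auto simp: weight_def split: prod.splits)

lemma mass_ge: "real (length (part v n t)) \<le> 3 * mass v n t"
proof -
  have "real (length xs) \<le> 3 * (\<Sum>s\<leftarrow>xs. weight t s)" for xs
  proof (induction xs)
    case (Cons s xs)
    then show ?case using weight_bounds(2)[of t s] by simp
  qed simp
  then show ?thesis by (simp add: mass_def)
qed

lemma sum_list_filter_partition:
  fixes f :: "'a \<Rightarrow> real"
  assumes "finite W" "\<And>x. x \<in> set xs \<Longrightarrow> h x \<in> W"
  shows "(\<Sum>v\<in>W. \<Sum>x\<leftarrow>filter (\<lambda>x. h x = v) xs. f x) = (\<Sum>x\<leftarrow>xs. f x)"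
  using assms(2)
proof (induction xs)
  case (Cons x xs)
  have "(\<Sum>v\<in>W. \<Sum>x\<leftarrow>filter (\<lambda>x. h x = v) (x # xs). f x) =
    (\<Sum>v\<in>W. (if v = h x then f x else 0) + (\<Sum>x\<leftarrow>filter (\<lambda>x. h x = v) xs. f x))"
    by (intro sum.cong refl) auto
  also have "\<dots> = f x + (\<Sum>x\<leftarrow>xs. f x)"
    using Cons assms(1) by (simp add: sum.distrib)
  finally show ?case by simp
qed simp

lemma sum_square_bound:
  fixes C q :: "'a \<Rightarrow> 'a \<Rightarrow> real"
  assumes "finite S" "\<And>s s'. s \<in> S \<Longrightarrow> s' \<in> S \<Longrightarrow> s \<noteq> s' \<Longrightarrow> C s s' \<le> q s s'"
    "\<And>s. s \<in> S \<Longrightarrow> C s s \<le> q s s + B"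
  shows "(\<Sum>s\<in>S. \<Sum>s'\<in>S. C s s') \<le> (\<Sum>s\<in>S. \<Sum>s'\<in>S. q s s') + B * card S"
proof -
  have "(\<Sum>s\<in>S. \<Sum>s'\<in>S. C s s') \<le> (\<Sum>s\<in>S. \<Sum>s'\<in>S. q s s' + (if s' = s then B else 0))"
    using assms(2,3) by (intro sum_mono) auto
  also have "\<dots> = (\<Sum>s\<in>S. \<Sum>s'\<in>S. q s s') + B * card S"
    using assms(1) by (simp add: sum.distrib mult.commute)
  finally show ?thesis .
qed

text \<open>The smallest cell at the corner c of the cell w is crossed without touching that corner. If this
  persisted at all levels, the limit curve could reach the corner without the discrete paths doing so.\<close>

definition corner_items :: "nat list \<Rightarrow> nat \<Rightarrow> nat \<Rightarrow> complex set set \<Rightarrow> item list" where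
  "corner_items w c n t = filter (\<lambda>(w', a, b). w' = w @ replicate (n - length w) c \<and> c \<noteq> a \<and> c \<noteq> b) (itin n t)"

definition corner_mass :: "nat list \<Rightarrow> nat \<Rightarrow> nat \<Rightarrow> complex set set \<Rightarrow> real" where
  "corner_mass w c n t = (\<Sum>(w', a, b)\<leftarrow>corner_items w c n t. real (kappa (ctype (st w' t) a b)))"

context trace_trees begin

lemma part_facts:
  assumes "t \<in> STrees n"
  shows "distinct (part v n t)" "\<And>s. s \<in> set (part v n t) \<Longrightarrow> valid_item n t s"
    "inj_on fst (set (part v n t))"
  using itin_facts[OF assms] by (auto simp: part_def distinct_map intro: inj_on_subset)

lemma part_Suc:
  assumes "t \<in> STrees (Suc n)" "length v \<le> n"
  shows "part v (Suc n) t = concat (map (children t) (part v n (Tr n t)))"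
proof -
  have v: "\<And>s. s \<in> set (itin n (Tr n t)) \<Longrightarrow> valid_item n (Tr n t) s"
    using itin_facts[OF Tr_STrees[OF assms(1)]] by blast
  have "filter (\<lambda>s. take (length v) (fst s) = v) (concat (map (children t) its)) =
    concat (map (children t) (filter (\<lambda>s. take (length v) (fst s) = v) its))"
    if "\<And>s. s \<in> set its \<Longrightarrow> valid_item n (Tr n t) s" for its
    using that
  proof (induction its)
    case (Cons s its)
    have "length (fst s) = n" using Cons.prems[of s] wordsD(1) by (cases s) (auto simp: valid_item_def)
    then have *: "take (length v) (fst s') = take (length v) (fst s)" if "s' \<in> set (children t s)" for s'
      using children_word[OF that] assms(2) by auto
    have "filter (\<lambda>s. take (length v) (fst s) = v) (children t s) =
       (if take (length v) (fst s) = v then children t s else [])"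
      using * by (auto intro!: filter_True filter_False)
    moreover have "filter (\<lambda>s. take (length v) (fst s) = v) (concat (map (children t) its)) =
      concat (map (children t) (filter (\<lambda>s. take (length v) (fst s) = v) its))"
      by (rule Cons.IH) (rule Cons.prems, simp)
    ultimately show ?case by simp
  qed simp
  from this[OF v] show ?thesis by (simp add: part_def)
qed

lemma mass_Suc:
  assumes "t \<in> STrees (Suc n)" "length v \<le> n"
  shows "mass v (Suc n) t = (\<Sum>s\<in>set (part v n (Tr n t)). crossing t s)"
proof -
  note p = part_facts[OF Tr_STrees[OF assms(1)], where v = v]
  have "mass v (Suc n) t = (\<Sum>s\<leftarrow>part v n (Tr n t). \<Sum>s'\<leftarrow>children t s. weight t s')"
  proof -
    have "(\<Sum>s'\<leftarrow>concat (map (children t) its). weight t s') = (\<Sum>s\<leftarrow>its. \<Sum>s'\<leftarrow>children t s. weight t s')" for its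
      by (induction its) auto
    then show ?thesis by (simp add: mass_def part_Suc[OF assms])
  qed
  also have "\<dots> = (\<Sum>s\<leftarrow>part v n (Tr n t). crossing t s)"
    by (intro arg_cong[where f = sum_list] map_cong refl children_weight[OF p(2)])
  also have "\<dots> = (\<Sum>s\<in>set (part v n (Tr n t)). crossing t s)"
    by (rule sum_list_distinct_conv_sum_set[OF p(1)])
  finally show ?thesis .
qed

lemma mass_set: "t \<in> STrees n \<Longrightarrow> mass v n t = (\<Sum>s\<in>set (part v n t). weight t s)"
  unfolding mass_def by (rule sum_list_distinct_conv_sum_set[OF part_facts(1)])

lemma ext_STrees: "t \<in> ext n t0 \<Longrightarrow> t \<in> STrees (Suc n)" "t \<in> ext n t0 \<Longrightarrow> Tr n t = t0"
  by (simp_all add: ext_def)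

lemma mass_average:
  assumes t0: "t0 \<in> STrees n" and v: "length v \<le> n"
  shows "(\<Sum>t\<in>ext n t0. mass v (Suc n) t) = alpha_bar * mass v n t0 * card (ext n t0)"
proof -
  have "(\<Sum>t\<in>ext n t0. mass v (Suc n) t) = (\<Sum>t\<in>ext n t0. \<Sum>s\<in>set (part v n t0). crossing t s)"
    using mass_Suc ext_STrees v by (intro sum.cong) auto
  also have "\<dots> = (\<Sum>s\<in>set (part v n t0). \<Sum>t\<in>ext n t0. crossing t s * 1)"
    by (subst sum.swap) simp
  also have "\<dots> = (\<Sum>s\<in>set (part v n t0). alpha_bar * weight t0 s * (\<Sum>t\<in>ext n t0. 1))"
    using part_facts(2)[OF t0] by (intro sum.cong crossing_average) auto
  also have "\<dots> = alpha_bar * mass v n t0 * card (ext n t0)"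
    by (simp add: mass_set[OF t0] sum_distrib_left sum_distrib_right)
  finally show ?thesis .
qed

text \<open>Crossings of different cells are conditionally independent, so their mixed terms are
  products of means. The diagonal terms cost at most 9 each because \<open>crossing\<close> is at
  most 3.\<close>

lemma mass_square_average:
  assumes t0: "t0 \<in> STrees n" and v: "length v \<le> n"
  shows "(\<Sum>t\<in>ext n t0. (mass v (Suc n) t)\<^sup>2) \<le>
    (alpha_bar\<^sup>2 * (mass v n t0)\<^sup>2 + 9 * length (part v n t0)) * card (ext n t0)"
proof -
  let ?S = "set (part v n t0)" and ?N = "real (card (ext n t0))"
  note p = part_facts[OF t0, where v = v]
  define C where "C s s' = (\<Sum>t\<in>ext n t0. crossing t s * crossing t s')" for s s'
  define q where "q s s' = alpha_bar\<^sup>2 * (weight t0 s * weight t0 s') * ?N" for s s'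
  have "(\<Sum>t\<in>ext n t0. (mass v (Suc n) t)\<^sup>2) = (\<Sum>t\<in>ext n t0. \<Sum>s\<in>?S. \<Sum>s'\<in>?S. crossing t s * crossing t s')"
    using mass_Suc ext_STrees v by (intro sum.cong) (auto simp: power2_eq_square sum_product)
  also have "\<dots> = (\<Sum>s\<in>?S. \<Sum>s'\<in>?S. C s s')"
    unfolding C_def by (subst sum.swap, rule sum.cong[OF refl], rule sum.swap)
  also have "\<dots> \<le> (\<Sum>s\<in>?S. \<Sum>s'\<in>?S. q s s') + (9 * ?N) * card ?S"
  proof (rule sum_square_bound)
    fix s s' assume s: "s \<in> ?S" "s' \<in> ?S" "s \<noteq> s'"
    have fne: "fst s' \<noteq> fst s" using p(3) s by (auto dest: inj_onD)
    have w': "fst s' \<in> words n" using p(2)[OF s(2)] by (cases s') (auto simp: valid_item_def)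
    \<comment> \<open>An exchange in the cell of s leaves the cell of s' unchanged, so the factor of
      s' can serve as \<open>H\<close>.\<close>
    have inv: "crossing (exchange n (fst s) g t) s' = crossing t s'" if "g \<subseteq> EG 1" for g t
      using cfg_exchange[OF that w' fne] by (cases s') (simp add: crossing_def)
    have "C s s' = alpha_bar * weight t0 s * (\<Sum>t\<in>ext n t0. crossing t s' * 1)"
      unfolding C_def using crossing_average[OF p(2)[OF s(1)], of "\<lambda>t. crossing t s'"] inv by simp
    also have "(\<Sum>t\<in>ext n t0. crossing t s' * 1) = alpha_bar * weight t0 s' * (\<Sum>t\<in>ext n t0. 1)"
      by (rule crossing_average[OF p(2)[OF s(2)]]) simp
    finally show "C s s' \<le> q s s'" by (simp add: q_def power2_eq_square mult_ac)
  next
    fix s assume "s \<in> ?S"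
    have "C s s \<le> (\<Sum>t\<in>ext n t0. 3 * 3)"
      unfolding C_def using crossing_bounds by (intro sum_mono mult_mono) auto
    moreover have "0 \<le> q s s" using weight_bounds(2)[of t0 s] by (simp add: q_def)
    ultimately show "C s s \<le> q s s + 9 * ?N" by simp
  qed simp
  also have "(\<Sum>s\<in>?S. \<Sum>s'\<in>?S. q s s') = alpha_bar\<^sup>2 * (mass v n t0)\<^sup>2 * ?N"
    unfolding q_def mass_set[OF t0] power2_eq_square[of "\<Sum>s\<in>?S. weight t0 s"]
    by (simp only: sum_product sum_distrib_left sum_distrib_right) (rule sum.swap)
  finally show ?thesis using distinct_card[OF p(1)] by (simp add: algebra_simps)
qed

lemma corner_mass_ge:
  assumes "corner_items w c n t \<noteq> []" shows "1 \<le> corner_mass w c n t"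
proof -
  have k: "1 \<le> real (kappa y)" for y by (simp add: kappa_def)
  have "0 \<le> (\<Sum>(w', a, b)\<leftarrow>xs. real (kappa (ctype (st w' t) a b)))" for xs
    by (rule sum_list_nonneg) auto
  then show ?thesis using assms k unfolding corner_mass_def
    by (cases "corner_items w c n t") (auto intro!: add_increasing2)
qed

lemma corner_mass_Suc:
  assumes t: "t \<in> STrees (Suc n)" and n: "length w \<le> n" and c: "c \<in> idx"
  shows "corner_mass w c (Suc n) t =
    (\<Sum>(w', a, b)\<leftarrow>corner_items w c n (Tr n t). real (corner_weight (cfg w' t) a b))"
proof -
  define W where "W = w @ replicate (n - length w) c"
  have W': "w @ replicate (Suc n - length w) c = W @ [c]"
    using n by (simp add: W_def Suc_diff_le replicate_append_same)
  define Q where "Q = (\<lambda>(w', x, z). w' = W @ [c] \<and> c \<noteq> x \<and> c \<noteq> z)"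
  define f where "f = (\<lambda>(w', x, z). real (kappa (ctype (st w' t) x z)))"
  define R where "R = (\<lambda>(w', a, b). w' = W \<and> c \<noteq> a \<and> c \<noteq> b)"
  define g where "g = (\<lambda>(w', a, b). real (corner_weight (cfg w' t) a b))"
  have one: "(\<Sum>s'\<leftarrow>children t s. if Q s' then f s' else 0) = (if R s then g s else 0)"
    if s: "s \<in> set (itin n (Tr n t))" for s
  proof -
    obtain w' a b where s': "s = (w', a, b)" by (cases s)
    have "valid_item n (Tr n t) s" using itin_facts[OF Tr_STrees[OF t]] s by blast
    then have ab: "a \<in> idx" "b \<in> idx" "a \<noteq> b" by (simp_all add: valid_item_def s')
    note th = third_third[OF ab]
    have "(\<Sum>s'\<leftarrow>children t s. if Q s' then f s' else 0) =
      (\<Sum>p\<leftarrow>expand (cfg w' t) a b. case p of (i, x, z) \<Rightarrow> if w' = W \<and> i = c \<and> c \<noteq> x \<and> c \<noteq> z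
         then real (kappa (ctype (st (w' @ [i]) t) x z)) else 0)"
      by (simp add: s' children_def comp_def split_def Q_def f_def cong: if_cong)
    also have "\<dots> = (\<Sum>p\<leftarrow>expand (cfg w' t) a b. if R s then (case p of (i, x, z) \<Rightarrow>
       real (if i = third a b \<and> third a b \<noteq> x \<and> third a b \<noteq> z then kappa (ctype (comp_state (cfg w' t) i) x z) else 0)) else 0)"
    proof (intro arg_cong[where f = sum_list] map_cong refl)
      fix p assume p: "p \<in> set (expand (cfg w' t) a b)"
      obtain i x z where p': "p = (i, x, z)" by (cases p)
      have i: "i \<in> idx" using expand_facts(1)[OF ab] p p' by blast
      \<comment> \<open>The part in subcell a starts at corner a and the part in subcell b ends at
        corner b. Hence the part in subcell c can miss the corner c only if the parent misses it
        too.\<close>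
      have abi: "(i = a \<longrightarrow> x = a) \<and> (i = b \<longrightarrow> z = b)"
        using p th ab(3) unfolding p' expand_def by (auto split: if_splits)
      have "c = third a b" if "c \<noteq> a" "c \<noteq> b" using th(7) c that by blast
      then show "(case p of (i, x, z) \<Rightarrow> if w' = W \<and> i = c \<and> c \<noteq> x \<and> c \<noteq> z
         then real (kappa (ctype (st (w' @ [i]) t) x z)) else 0) =
        (if R s then (case p of (i, x, z) \<Rightarrow>
          real (if i = third a b \<and> third a b \<noteq> x \<and> third a b \<noteq> z then kappa (ctype (comp_state (cfg w' t) i) x z) else 0)) else 0)"
        using abi st_snoc[OF i, of w' t] th unfolding p' R_def s' by auto
    qed
    also have "\<dots> = (if R s then g s else 0)"
    proof -
      have "(\<Sum>p\<leftarrow>xs. real (h p)) = real (\<Sum>p\<leftarrow>xs. h p)" for xs and h :: "nat \<times> nat \<times> nat \<Rightarrow> nat"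
        by (induction xs) auto
      note r = this
      show ?thesis
      proof (cases "R s")
        case True
        then show ?thesis by (simp add: g_def s' corner_weight_def split_def r cong: if_cong)
      qed (simp add: sum_list_triv)
    qed
    finally show ?thesis .
  qed
  have ci: "corner_items w c (Suc n) t = filter Q (itin (Suc n) t)" "corner_items w c n (Tr n t) = filter R (itin n (Tr n t))"
    unfolding corner_items_def W' Q_def R_def W_def by rule+
  have "corner_mass w c (Suc n) t = (\<Sum>s'\<leftarrow>itin (Suc n) t. if Q s' then f s' else 0)"
    unfolding corner_mass_def ci f_def[symmetric] by (rule sum_list_map_filter')
  also have "\<dots> = (\<Sum>s\<leftarrow>itin n (Tr n t). \<Sum>s'\<leftarrow>children t s. if Q s' then f s' else 0)"
  proof -
    have "(\<Sum>s'\<leftarrow>concat (map h its). F s') = (\<Sum>s\<leftarrow>its. \<Sum>s'\<leftarrow>h s. F s')"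
      for h :: "item \<Rightarrow> item list" and F :: "item \<Rightarrow> real" and its
      by (induction its) auto
    then show ?thesis by simp
  qed
  also have "\<dots> = (\<Sum>s\<leftarrow>itin n (Tr n t). if R s then g s else 0)"
    by (intro arg_cong[where f = sum_list] map_cong refl one)
  also have "\<dots> = (\<Sum>s\<leftarrow>corner_items w c n (Tr n t). g s)"
    unfolding ci by (rule sum_list_map_filter'[symmetric])
  finally show ?thesis by (simp add: g_def)
qed

end

text \<open>Equal numbers of extensions mean that the trace of a uniform spanning tree is again
  uniform.\<close>

locale uniform_trace_trees = trace_trees +
  assumes card_ext: "t0 \<in> STrees n \<Longrightarrow> card (ext n t0) * card (STrees n) = card (STrees (Suc n))"
    and STrees_nonempty: "STrees n \<noteq> {}"
begin

definition avg :: "nat \<Rightarrow> (complex set set \<Rightarrow> real) \<Rightarrow> real" where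
  "avg n F = (\<Sum>t\<in>STrees n. F t) / card (STrees n)"

lemma card_STrees_pos: "card (STrees n) > 0"
  using STrees_nonempty finite_STrees by (simp add: card_gt_0_iff)

lemma avg_mono: "(\<And>t. t \<in> STrees n \<Longrightarrow> F t \<le> G t) \<Longrightarrow> avg n F \<le> avg n G"
  unfolding avg_def by (intro divide_right_mono sum_mono) auto

lemma avg_add: "avg n (\<lambda>t. F t + G t) = avg n F + avg n G"
  by (simp add: avg_def sum.distrib add_divide_distrib)

lemma avg_cmult: "avg n (\<lambda>t. c * F t) = c * avg n F"
  by (simp add: avg_def sum_distrib_left)

text \<open>The tower property: the average is taken over the extensions of each trace before
  averaging over the traces.\<close>

lemma avg_step:
  fixes F G :: "complex set set \<Rightarrow> real"
  assumes "\<And>t0. t0 \<in> STrees n \<Longrightarrow> (\<Sum>t\<in>ext n t0. F t) \<le> G t0 * card (ext n t0)"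
  shows "avg (Suc n) F \<le> avg n G"
proof -
  have "(\<Sum>t\<in>STrees (Suc n). F t) = (\<Sum>t0\<in>STrees n. \<Sum>t\<in>ext n t0. F t)"
    unfolding ext_def by (rule sum.group[symmetric]) (use finite_STrees Tr_STrees in auto)
  also have "\<dots> \<le> (\<Sum>t0\<in>STrees n. G t0 * card (ext n t0))" by (intro sum_mono assms)
  also have "\<dots> = (\<Sum>t0\<in>STrees n. G t0 * (card (STrees (Suc n)) / card (STrees n)))"
  proof (intro sum.cong refl arg_cong2[where f = "(*)"])
    fix t0 assume "t0 \<in> STrees n"
    from card_ext[OF this] have "real (card (ext n t0)) * card (STrees n) = card (STrees (Suc n))"
      by (metis of_nat_mult)
    then show "real (card (ext n t0)) = card (STrees (Suc n)) / card (STrees n)"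
      using card_STrees_pos[of n] by (simp add: field_simps)
  qed
  also have "\<dots> = card (STrees (Suc n)) * avg n G"
    by (simp add: avg_def sum_distrib_left sum_divide_distrib mult_ac)
  finally show ?thesis using card_STrees_pos[of "Suc n"] by (simp add: avg_def field_simps)
qed

lemma avg_mass: "avg n (mass [] n) \<le> alpha_bar ^ n"
proof (induction n)
  case 0
  have "mass [] 0 t \<le> 1" for t using weight_bounds(1) by (simp add: mass_def part_def)
  then have "avg 0 (mass [] 0) \<le> avg 0 (\<lambda>t. 1)" by (intro avg_mono)
  also have "\<dots> = 1" using card_STrees_pos[of 0] by (simp add: avg_def)
  finally show ?case by simp
next
  case (Suc n)
  have "avg (Suc n) (mass [] (Suc n)) \<le> avg n (\<lambda>t. alpha_bar * mass [] n t)"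
    by (rule avg_step) (simp add: mass_average)
  also have "\<dots> = alpha_bar * avg n (mass [] n)" by (rule avg_cmult)
  also have "\<dots> \<le> alpha_bar * alpha_bar ^ n" using Suc alpha_bar_gt by (intro mult_left_mono) auto
  finally show ?case by simp
qed

lemma part_partition:
  assumes t: "t \<in> STrees n" and k: "k \<le> n"
  shows "(\<Sum>v\<in>words k. real (length (part v n t))) = length (itin n t)"
    "(\<Sum>v\<in>words k. mass v n t) = mass [] n t"
proof -
  have w: "take k (fst s) \<in> words k" if "s \<in> set (itin n t)" for s
  proof -
    have "fst s \<in> words n" using itin_facts[OF t] that by (cases s) (auto simp: valid_item_def)
    then show ?thesis using k by (auto simp: words_def dest: in_set_takeD)
  qed
  have p: "part v n t = filter (\<lambda>s. take k (fst s) = v) (itin n t)" if "v \<in> words k" for v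
    using wordsD(1)[OF that] by (simp add: part_def)
  have "(\<Sum>v\<in>words k. \<Sum>s\<leftarrow>part v n t. f s) = (\<Sum>s\<leftarrow>itin n t. f s)" for f :: "item \<Rightarrow> real"
    using sum_list_filter_partition[of "words k" "itin n t" "\<lambda>s. take k (fst s)" f] w p by simp
  from this[of "\<lambda>_. 1"] this[of "weight t"]
  show "(\<Sum>v\<in>words k. real (length (part v n t))) = length (itin n t)"
    "(\<Sum>v\<in>words k. mass v n t) = mass [] n t"
    by (simp_all add: sum_list_triv mass_def part_def)
qed

text \<open>Summing \<open>mass_square_average\<close> over the cells gives a recursion with factor
  \<open>alpha_bar\<close> squared and inhomogeneity 27 \<open>alpha_bar ^ n\<close>, where 27 = 9 *
  3 and the 3 comes from \<open>mass_ge\<close>. The subtracted term absorbs the inhomogeneity: 15 -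
  14 = 1 fits the start n = k, and the induction step needs that 14 x^2 - 14 x - 27 is nonnegative
  at x = \<open>alpha_bar\<close>, which follows from \<open>alpha_bar\<close> > 2.\<close>

lemma avg_mass_square:
  assumes "k \<le> n"
  shows "avg n (\<lambda>t. \<Sum>v\<in>words k. (mass v n t)\<^sup>2) \<le> 15 * alpha_bar ^ (2 * n) / alpha_bar ^ k - 14 * alpha_bar ^ n"
  using assms
proof (induction n rule: dec_induct)
  case base
  have "avg k (\<lambda>t. \<Sum>v\<in>words k. (mass v k t)\<^sup>2) \<le> avg k (mass [] k)"
  proof (rule avg_mono)
    fix t assume t: "t \<in> STrees k"
    \<comment> \<open>At level k the cell v contains at most one crossing, so its mass is at most 1
      and the square is at most the mass.\<close>
    have "0 \<le> mass v k t \<and> mass v k t \<le> 1" if v: "v \<in> words k" for v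
    proof -
      note p = part_facts[OF t, where v = v]
      have "fst s = v" if s: "s \<in> set (part v k t)" for s
      proof -
        have "fst s \<in> words k" using p(2)[OF s] by (cases s) (auto simp: valid_item_def)
        then show ?thesis using s v by (auto simp: part_def words_def)
      qed
      then have "card (set (part v k t)) \<le> 1" using p(3) by (auto simp: card_le_Suc0_iff_eq One_nat_def inj_on_def)
      moreover have "mass v k t \<le> (\<Sum>s\<in>set (part v k t). 1)"
        unfolding mass_set[OF t] using weight_bounds(1) by (intro sum_mono)
      moreover have "0 \<le> mass v k t" using mass_ge[of v k t] by linarith
      ultimately show ?thesis by simp
    qed
    then have "(\<Sum>v\<in>words k. (mass v k t)\<^sup>2) \<le> (\<Sum>v\<in>words k. mass v k t)"
      by (intro sum_mono) (simp add: power2_eq_square mult_left_le)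
    then show "(\<Sum>v\<in>words k. (mass v k t)\<^sup>2) \<le> mass [] k t" using part_partition(2)[OF t] by simp
  qed
  also have "\<dots> \<le> alpha_bar ^ k" by (rule avg_mass)
  also have "\<dots> = 15 * alpha_bar ^ (2 * k) / alpha_bar ^ k - 14 * alpha_bar ^ k"
    using alpha_bar_gt by (simp add: mult_2 power_add)
  finally show ?case .
next
  case (step n)
  have "avg (Suc n) (\<lambda>t. \<Sum>v\<in>words k. (mass v (Suc n) t)\<^sup>2) \<le>
    avg n (\<lambda>t. alpha_bar\<^sup>2 * (\<Sum>v\<in>words k. (mass v n t)\<^sup>2) + 27 * mass [] n t)"
  proof (rule avg_step)
    fix t0 assume t0: "t0 \<in> STrees n"
    have "(\<Sum>t\<in>ext n t0. \<Sum>v\<in>words k. (mass v (Suc n) t)\<^sup>2) = (\<Sum>v\<in>words k. \<Sum>t\<in>ext n t0. (mass v (Suc n) t)\<^sup>2)"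
      by (rule sum.swap)
    also have "\<dots> \<le> (\<Sum>v\<in>words k. (alpha_bar\<^sup>2 * (mass v n t0)\<^sup>2 + 9 * length (part v n t0)) * card (ext n t0))"
      using wordsD(1) step by (intro sum_mono mass_square_average[OF t0]) auto
    also have "\<dots> = (alpha_bar\<^sup>2 * (\<Sum>v\<in>words k. (mass v n t0)\<^sup>2) + 9 * length (itin n t0)) * card (ext n t0)"
      by (simp only: sum_distrib_right[symmetric] sum.distrib sum_distrib_left[symmetric] of_nat_mult
          part_partition(1)[OF t0 \<open>k \<le> n\<close>])
    also have "\<dots> \<le> (alpha_bar\<^sup>2 * (\<Sum>v\<in>words k. (mass v n t0)\<^sup>2) + 27 * mass [] n t0) * card (ext n t0)"
      using mass_ge[of "[]" n t0] by (intro mult_right_mono) (simp_all add: part_def)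
    finally show "(\<Sum>t\<in>ext n t0. \<Sum>v\<in>words k. (mass v (Suc n) t)\<^sup>2) \<le>
      (alpha_bar\<^sup>2 * (\<Sum>v\<in>words k. (mass v n t0)\<^sup>2) + 27 * mass [] n t0) * card (ext n t0)" .
  qed
  also have "\<dots> = alpha_bar\<^sup>2 * avg n (\<lambda>t. \<Sum>v\<in>words k. (mass v n t)\<^sup>2) + 27 * avg n (mass [] n)"
    by (simp only: avg_add avg_cmult)
  also have "\<dots> \<le> alpha_bar\<^sup>2 * (15 * alpha_bar ^ (2 * n) / alpha_bar ^ k - 14 * alpha_bar ^ n) + 27 * alpha_bar ^ n"
    using step.IH avg_mass[of n] by (intro add_mono mult_left_mono) auto
  also have "\<dots> = 15 * alpha_bar ^ (2 * Suc n) / alpha_bar ^ k - 14 * alpha_bar ^ Suc n - (14 * alpha_bar\<^sup>2 - 14 * alpha_bar - 27) * alpha_bar ^ n"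
    using alpha_bar_gt by (simp add: power2_eq_square algebra_simps)
  also have "\<dots> \<le> 15 * alpha_bar ^ (2 * Suc n) / alpha_bar ^ k - 14 * alpha_bar ^ Suc n"
  proof -
    have "2 * (alpha_bar - 1) \<le> alpha_bar * (alpha_bar - 1)" using alpha_bar_gt by (intro mult_right_mono) auto
    then have "0 \<le> 14 * alpha_bar\<^sup>2 - 14 * alpha_bar - 27"
      using alpha_bar_gt by (simp add: power2_eq_square algebra_simps)
    then show ?thesis using alpha_bar_gt by (simp add: mult_nonneg_nonneg)
  qed
  finally show ?case .
qed

lemma avg_corner_mass:
  assumes c: "c \<in> idx"
  shows "length w \<le> n \<Longrightarrow> avg n (corner_mass w c n) \<le> avg (length w) (corner_mass w c (length w)) * (2/3) ^ (n - length w)"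
proof (induction n rule: dec_induct)
  case (step n)
  have "avg (Suc n) (corner_mass w c (Suc n)) \<le> avg n (\<lambda>t. 2/3 * corner_mass w c n t)"
  proof (rule avg_step)
    fix t0 assume t0: "t0 \<in> STrees n"
    have sw: "(\<Sum>t\<in>T. \<Sum>s\<leftarrow>xs. F s t) = (\<Sum>s\<leftarrow>xs. \<Sum>t\<in>T. F s t)"
      for T and xs :: "item list" and F :: "item \<Rightarrow> complex set set \<Rightarrow> real"
      by (induction xs) (simp_all add: sum.distrib)
    have "(\<Sum>t\<in>ext n t0. corner_mass w c (Suc n) t) =
      (\<Sum>t\<in>ext n t0. \<Sum>s\<leftarrow>corner_items w c n t0. case s of (w', a, b) \<Rightarrow> real (corner_weight (cfg w' t) a b))"
      using corner_mass_Suc[OF _ _ c] step ext_STrees by (intro sum.cong refl) auto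
    also have "\<dots> = (\<Sum>s\<leftarrow>corner_items w c n t0. \<Sum>t\<in>ext n t0. case s of (w', a, b) \<Rightarrow> real (corner_weight (cfg w' t) a b))"
      by (rule sw)
    also have "\<dots> \<le> (\<Sum>s\<leftarrow>corner_items w c n t0. case s of (w', a, b) \<Rightarrow>
        real (kappa (ctype (st w' t0) a b)) * (2/3 * card (ext n t0)))"
    proof (rule sum_list_mono)
      fix s assume s: "s \<in> set (corner_items w c n t0)"
      obtain w' a b where s': "s = (w', a, b)" by (cases s)
      have "valid_item n t0 s" using s itin_facts[OF t0] by (auto simp: corner_items_def)
      from corner_average[OF this[unfolded s']]
      show "(\<Sum>t\<in>ext n t0. case s of (w', a, b) \<Rightarrow> real (corner_weight (cfg w' t) a b)) \<le>
        (case s of (w', a, b) \<Rightarrow> real (kappa (ctype (st w' t0) a b)) * (2/3 * card (ext n t0)))"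
        by (simp add: s' field_simps)
    qed
    also have "\<dots> = 2/3 * corner_mass w c n t0 * card (ext n t0)"
    proof -
      have "(\<Sum>s\<leftarrow>xs. case s of (w', a, b) \<Rightarrow> real (kappa (ctype (st w' t0) a b)) * (2/3 * N)) =
        2/3 * (\<Sum>(w', a, b)\<leftarrow>xs. real (kappa (ctype (st w' t0) a b))) * N" for xs and N :: real
        by (induction xs) (auto simp: algebra_simps)
      then show ?thesis unfolding corner_mass_def .
    qed
    finally show "(\<Sum>t\<in>ext n t0. corner_mass w c (Suc n) t) \<le> 2/3 * corner_mass w c n t0 * card (ext n t0)" .
  qed
  also have "\<dots> = 2/3 * avg n (corner_mass w c n)" by (rule avg_cmult)
  also have "\<dots> \<le> avg (length w) (corner_mass w c (length w)) * (2/3) ^ (Suc n - length w)"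
    using step by (simp add: Suc_diff_le)
  finally show ?case .
qed simp

end

section \<open>Self-intersections of the limit curve\<close>

text \<open>\<open>f m\<close> is the number of the block that contributes entry m of the
  concatenation.\<close>

lemma concat_block_index:
  "\<exists>f. (\<forall>m<length (concat xss). f m < length xss \<and> concat xss ! m \<in> set (xss ! f m)) \<and>
     (\<forall>m m'. m \<le> m' \<longrightarrow> m' < length (concat xss) \<longrightarrow> f m \<le> (f m' :: nat))"
proof (induction xss)
  case Nil
  show ?case by simp
next
  case (Cons xs xss)
  then obtain f where f: "\<And>m. m < length (concat xss) \<Longrightarrow> f m < length xss \<and> concat xss ! m \<in> set (xss ! f m)"
    "\<And>m m'. m \<le> m' \<Longrightarrow> m' < length (concat xss) \<Longrightarrow> f m \<le> (f m' :: nat)" by blast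
  define g where "g m = (if m < length xs then 0 else Suc (f (m - length xs)))" for m
  have "g m < length (xs # xss) \<and> concat (xs # xss) ! m \<in> set ((xs # xss) ! g m)"
    if "m < length (concat (xs # xss))" for m
    using f(1)[of "m - length xs"] that by (auto simp: g_def nth_append)
  moreover have "g m \<le> g m'" if "m \<le> m'" "m' < length (concat (xs # xss))" for m m'
    using f(2)[of "m - length xs" "m' - length xs"] that by (auto simp: g_def)
  ultimately show ?case by blast
qed

text \<open>A corner of the whole triangle lies in only one of the three half-size triangles, and it
  is the same corner there.\<close>

lemma corner_cell_word:
  "set v \<subseteq> idx \<Longrightarrow> j \<in> idx \<Longrightarrow> u j \<in> cell v \<Longrightarrow> v = replicate (length v) j"
proof (induction v)
  case (Cons i v)
  have i: "i \<in> idx" "set v \<subseteq> idx" using Cons.prems by auto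
  obtain x where x: "x \<in> Tri" "u j = psi i (psiw v x)" using Cons.prems by (auto simp: cell_def)
  have z: "psiw v x \<in> Tri" using psiw_in_Tri i x(1) by blast
  have "i = j"
  proof (rule ccontr)
    assume "i \<noteq> j"
    moreover have "psi i (psiw v x) = psi j (u j)" using x(2) psi_u_self by metis
    ultimately have "u j = u i"
      using psi_Tri_inter[OF i(1) Cons.prems(2) _ z u_in_Tri[OF Cons.prems(2)]] by blast
    then show False using u_inj[OF Cons.prems(2) i(1)] \<open>i \<noteq> j\<close> by simp
  qed
  moreover from this have "psiw v x = u j" using x(2) psi_inj psi_u_self by metis
  then have "u j \<in> cell v" unfolding cell_def using x(1) by (metis imageI)
  ultimately show ?case using Cons.IH[OF i(2) Cons.prems(2)] by simp
qed simp

lemma psiw_replicate [simp]: "psiw (replicate n c) (u c) = u c"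
  by (induction n) simp_all

lemma ereal_finite_range: "0 \<le> z \<Longrightarrow> z < ereal b \<Longrightarrow> \<exists>y. z = ereal y"
  by (cases z) auto

lemma cell_take: "set w \<subseteq> idx \<Longrightarrow> cell w \<subseteq> cell (take k w)"
  using cell_append[of "drop k w" "take k w"] set_drop_subset[of k w] by auto

text \<open>One realisation of the sequence is fixed; the results up to
  \<open>self_intersection_heavy_cells\<close> are deterministic.\<close>

locale tree_sequence = trace_trees +
  fixes \<tau> :: "nat \<Rightarrow> complex set set"
  assumes tree: "\<tau> n \<in> STrees n" and trace: "Tr n (\<tau> (Suc n)) = \<tau> n"
begin

definition items :: "nat \<Rightarrow> item list" where "items n = itin n (\<tau> n)"
definition stp :: "nat \<Rightarrow> item list" where "stp n = steps n (\<tau> n)"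
definition curve :: "nat \<Rightarrow> ereal \<Rightarrow> complex" where
  "curve n t = LI (tpath (\<tau> n) (u 1) (u 2)) (ereal (alpha_bar ^ n) * t)"

lemma items_Suc: "items (Suc n) = concat (map (children (\<tau> (Suc n))) (items n))"
  by (simp add: items_def trace)

lemma item_word: "s \<in> set (items n) \<Longrightarrow> fst s \<in> words n"
  using itin_facts[OF tree[of n]] by (cases s) (auto simp: items_def valid_item_def)

lemma item_ancestor:
  assumes "k \<le> n"
  shows "\<exists>f. (\<forall>m<length (items n). f m < length (items k) \<and> take k (fst (items n ! m)) = fst (items k ! f m)) \<and>
     (\<forall>m m'. m \<le> m' \<longrightarrow> m' < length (items n) \<longrightarrow> f m \<le> (f m' :: nat))"
  using assms
proof (induction n rule: dec_induct)
  case base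
  have "take k (fst (items k ! m)) = fst (items k ! m)" if "m < length (items k)" for m
    using item_word[OF nth_mem[OF that]] wordsD(1) by simp
  then show ?case by (intro exI[of _ id]) simp
next
  case (step n)
  obtain f where f: "\<And>m. m < length (items n) \<Longrightarrow> f m < length (items k) \<and> take k (fst (items n ! m)) = fst (items k ! f m)"
    "\<And>m m'. m \<le> m' \<Longrightarrow> m' < length (items n) \<Longrightarrow> f m \<le> (f m' :: nat)" using step.IH by blast
  obtain g where g0: "\<And>m. m < length (items (Suc n)) \<Longrightarrow> g m < length (map (children (\<tau> (Suc n))) (items n)) \<and>
      items (Suc n) ! m \<in> set (map (children (\<tau> (Suc n))) (items n) ! g m)"
    and g2: "\<And>m m'. m \<le> m' \<Longrightarrow> m' < length (items (Suc n)) \<Longrightarrow> g m \<le> (g m' :: nat)"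
    using concat_block_index[of "map (children (\<tau> (Suc n))) (items n)"]
    unfolding items_Suc[symmetric] by blast
  have g1: "g m < length (items n) \<and> items (Suc n) ! m \<in> set (children (\<tau> (Suc n)) (items n ! g m))"
    if "m < length (items (Suc n))" for m
    using g0[OF that] by auto
  note g = g1 g2
  have "f (g m) < length (items k) \<and> take k (fst (items (Suc n) ! m)) = fst (items k ! f (g m))"
    if m: "m < length (items (Suc n))" for m
  proof -
    obtain i where "fst (items (Suc n) ! m) = fst (items n ! g m) @ [i]"
      using children_word g(1)[OF m] by blast
    moreover have "length (fst (items n ! g m)) = n"
      using item_word nth_mem g(1)[OF that] wordsD(1) by blast
    ultimately show ?thesis using f(1) g(1)[OF that] step by simp
  qed
  moreover have "f (g m) \<le> f (g m')" if "m \<le> m'" "m' < length (items (Suc n))" for m m'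
    using f(2) g that by blast
  ultimately show ?case by (intro exI[of _ "f \<circ> g"]) simp
qed

lemma step_ancestor:
  assumes "k \<le> n"
  shows "\<exists>f. (\<forall>m<length (stp n). f m < length (items k) \<and> take k (fst (stp n ! m)) = fst (items k ! f m)) \<and>
     (\<forall>m m'. m \<le> m' \<longrightarrow> m' < length (stp n) \<longrightarrow> f m \<le> (f m' :: nat))"
proof -
  obtain f where f: "\<And>m. m < length (items n) \<Longrightarrow> f m < length (items k) \<and> take k (fst (items n ! m)) = fst (items k ! f m)"
    "\<And>m m'. m \<le> m' \<Longrightarrow> m' < length (items n) \<Longrightarrow> f m \<le> (f m' :: nat)" using item_ancestor[OF assms] by blast
  have S: "stp n = concat (map (steps_of (\<tau> n)) (items n))" by (simp add: stp_def steps_def items_def)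
  obtain g where g0: "\<And>m. m < length (stp n) \<Longrightarrow> g m < length (map (steps_of (\<tau> n)) (items n)) \<and>
      stp n ! m \<in> set (map (steps_of (\<tau> n)) (items n) ! g m)"
    and g2: "\<And>m m'. m \<le> m' \<Longrightarrow> m' < length (stp n) \<Longrightarrow> g m \<le> (g m' :: nat)"
    using concat_block_index[of "map (steps_of (\<tau> n)) (items n)"]
    unfolding S[symmetric] by blast
  have g1: "g m < length (items n) \<and> stp n ! m \<in> set (steps_of (\<tau> n) (items n ! g m))"
    if "m < length (stp n)" for m
    using g0[OF that] by auto
  note g = g1 g2
  have "f (g m) < length (items k) \<and> take k (fst (stp n ! m)) = fst (items k ! f (g m))"
    if "m < length (stp n)" for m
    using steps_of_word f(1) g(1)[OF that] by metis
  moreover have "f (g m) \<le> f (g m')" if "m \<le> m'" "m' < length (stp n)" for m m'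
    using f(2) g that by blast
  ultimately show ?thesis by (intro exI[of _ "f \<circ> g"]) simp
qed

text \<open>The index in \<open>items k\<close> of the crossing that contains step m of the path in
  \<open>G_n\<close>. With indices in place of cells, the fact that the order of crossings is the
  same for all finer paths becomes the monotonicity of this map.\<close>

definition anc :: "nat \<Rightarrow> nat \<Rightarrow> nat \<Rightarrow> nat" where
  "anc k n = (SOME f. (\<forall>m<length (stp n). f m < length (items k) \<and> take k (fst (stp n ! m)) = fst (items k ! f m)) \<and>
     (\<forall>m m'. m \<le> m' \<longrightarrow> m' < length (stp n) \<longrightarrow> f m \<le> (f m' :: nat)))"

lemma anc:
  assumes "k \<le> n"
  shows "m < length (stp n) \<Longrightarrow> anc k n m < length (items k)"
    "m < length (stp n) \<Longrightarrow> take k (fst (stp n ! m)) = fst (items k ! anc k n m)"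
    "m \<le> m' \<Longrightarrow> m' < length (stp n) \<Longrightarrow> anc k n m \<le> anc k n m'"
  using someI_ex[OF step_ancestor[OF assms], folded anc_def] by blast+

lemma path_eq: "tpath (\<tau> n) (u 1) (u 2) = vertex_list (stp n) (u 2)"
  using steps_facts(3)[OF tree] by (simp add: stp_def)

lemma stp_nonempty: "stp n \<noteq> []"
proof
  assume "stp n = []"
  then have "u 1 = u 2" using steps_facts(1)[OF tree[of n]] by (simp add: stp_def)
  then show False using u_distinct by simp
qed

text \<open>The index of the step being traversed at time t. After the end of the path it stays at
  the last step, whose cell contains the end point \<open>u 2\<close>.\<close>

definition pos :: "nat \<Rightarrow> ereal \<Rightarrow> nat" where
  "pos n t = (if ereal (alpha_bar ^ n) * t \<ge> ereal (length (stp n)) then length (stp n) - 1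
     else nat \<lfloor>real_of_ereal (ereal (alpha_bar ^ n) * t)\<rfloor>)"

lemma alpha_pow_pos: "alpha_bar ^ n > 0"
  using alpha_bar_gt by simp

lemma stp_cell:
  assumes "m < length (stp n)"
  shows "start (stp n ! m) \<in> cell (fst (stp n ! m))" "finish (stp n ! m) \<in> cell (fst (stp n ! m))"
    "fst (stp n ! m) \<in> words n"
proof -
  have "valid_step n (\<tau> n) (stp n ! m)" using steps_facts(2)[OF tree] assms by (simp add: stp_def)
  then show "start (stp n ! m) \<in> cell (fst (stp n ! m))" "finish (stp n ! m) \<in> cell (fst (stp n ! m))"
    "fst (stp n ! m) \<in> words n"
    using cell_corner by (cases "stp n ! m"; simp add: valid_step_def start_def finish_def)+
qed

lemma pos_cell:
  assumes "0 \<le> t"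
  shows "pos n t < length (stp n)" "curve n t \<in> cell (fst (stp n ! pos n t))"
proof -
  let ?V = "vertex_list (stp n) (u 2)" and ?x = "ereal (alpha_bar ^ n) * t"
  have len: "length ?V - 1 = length (stp n)" by (simp add: vertex_list_def)
  have ch: "chain (u 1) (stp n) (u 2)" using steps_facts(1)[OF tree] by (simp add: stp_def)
  have x0: "0 \<le> ?x" using assms alpha_pow_pos[of n] by (simp add: less_imp_le)
  have "pos n t < length (stp n) \<and> curve n t \<in> cell (fst (stp n ! pos n t))"
  proof (cases "?x \<ge> ereal (length (stp n))")
    case True
    define m where "m = length (stp n) - 1"
    have m: "m < length (stp n)" "Suc m = length (stp n)" using stp_nonempty[of n] by (auto simp: m_def)
    have "finish (stp n ! m) = u 2" using chain_nth(2)[OF ch m(1)] m(2) by (simp add: vertex_list_def nth_append)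
    moreover have "curve n t = u 2" using True len by (simp add: curve_def path_eq LI_def vertex_list_def)
    moreover have "pos n t = m" using True by (simp add: pos_def m_def)
    ultimately show ?thesis using stp_cell(2)[OF m(1)] m(1) by simp
  next
    case False
    then obtain y where y: "?x = ereal y" "0 \<le> y" "y < length (stp n)" using x0 by (cases ?x) auto
    define m where "m = nat \<lfloor>y\<rfloor>"
    have pm: "pos n t = m" using False y by (simp add: pos_def m_def)
    have m: "m < length (stp n)" "real m \<le> y" "y < real m + 1"
      using y(2,3) unfolding m_def by linarith+
    have "curve n t = of_real (real m + 1 - y) * ?V ! m + of_real (y - real m) * ?V ! Suc m"
      unfolding curve_def path_eq LI_def using False y(1) len by (simp add: Let_def m_def)
    also have "\<dots> = (real m + 1 - y) *\<^sub>R start (stp n ! m) + (y - real m) *\<^sub>R finish (stp n ! m)"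
      by (simp add: chain_nth[OF ch m(1)] scaleR_conv_of_real)
    also have "\<dots> \<in> cell (fst (stp n ! m))"
      using convex_cell stp_cell[OF m(1)] m by (intro convexD) auto
    finally show ?thesis using pm m by simp
  qed
  then show "pos n t < length (stp n)" "curve n t \<in> cell (fst (stp n ! pos n t))" by auto
qed

lemma pos_mono:
  assumes "0 \<le> s" "s \<le> t" shows "pos n s \<le> pos n t"
proof -
  let ?x = "ereal (alpha_bar ^ n) * s" and ?y = "ereal (alpha_bar ^ n) * t"
  have xy: "?x \<le> ?y" "0 \<le> ?x" using assms alpha_pow_pos[of n]
    by (auto intro!: ereal_mult_left_mono simp: less_imp_le)
  show ?thesis
  proof (cases "?y \<ge> ereal (length (stp n))")
    case True
    then show ?thesis using pos_cell(1)[OF assms(1), of n] by (simp add: pos_def)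
  next
    case False
    then have yl: "?y < ereal (length (stp n))" by (simp add: not_le)
    obtain y where y: "?y = ereal y"
      using yl ereal_finite_range[of ?y "length (stp n)"] xy order_trans[of 0 ?x ?y] by auto
    obtain x where x: "?x = ereal x"
      using ereal_finite_range[of ?x "length (stp n)"] xy yl le_less_trans[of ?x ?y] by auto
    have "x \<le> y" using xy x y by simp
    then show ?thesis using False xy x y by (simp add: pos_def nat_mono floor_mono)
  qed
qed

section \<open>From a self-intersection to a cell with many steps\<close>

lemma curve_end: "ereal (length (stp n)) \<le> ereal (alpha_bar ^ n) * t \<Longrightarrow> curve n t = u 2"
  by (simp add: curve_def path_eq LI_def vertex_list_def)

text \<open>If a closed cell does not contain p, the curves at a time with limit p eventually avoid
  it. As there are finitely many pairs of crossings of level k, eventually both positions belong to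
  crossings of cells containing p, to which \<open>good\<close> applies.\<close>

lemma cells_adjacent:
  assumes s: "0 \<le> s" and st: "s \<le> t"
    and lim: "(\<lambda>n. curve n s) \<longlonglongrightarrow> p" "(\<lambda>n. curve n t) \<longlonglongrightarrow> p"
    and good: "\<And>i j. i \<le> j \<Longrightarrow> j < length (items k) \<Longrightarrow> p \<in> cell (fst (items k ! i)) \<Longrightarrow>
      p \<in> cell (fst (items k ! j)) \<Longrightarrow> j \<le> Suc i"
  shows "\<forall>\<^sub>F n in sequentially. anc k n (pos n t) \<le> Suc (anc k n (pos n s))"
proof -
  have t: "0 \<le> t" using s st by (rule order_trans)
  have inc: "curve n r \<in> cell (fst (items k ! anc k n (pos n r)))" if "0 \<le> r" "k \<le> n" for r n
  proof -
    have m: "pos n r < length (stp n)" using pos_cell(1)[OF that(1)] .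
    have "cell (fst (stp n ! pos n r)) \<subseteq> cell (take k (fst (stp n ! pos n r)))"
      by (rule cell_take) (use stp_cell(3)[OF m] wordsD in blast)
    then show ?thesis using pos_cell(2)[OF that(1)] anc(2)[OF that(2) m] by auto
  qed
  have ev: "\<forall>\<^sub>F n in sequentially. \<not> (anc k n (pos n s) = i \<and> anc k n (pos n t) = j)"
    if j: "j < length (items k)" "\<not> j \<le> Suc i" for i j
  proof -
    have away: "\<forall>\<^sub>F n in sequentially. anc k n (pos n r) \<noteq> l"
      if l: "p \<notin> cell (fst (items k ! l))" and r: "0 \<le> r" "(\<lambda>n. curve n r) \<longlonglongrightarrow> p" for l r
    proof -
      have "\<forall>\<^sub>F n in sequentially. curve n r \<in> - cell (fst (items k ! l))"
        using topological_tendstoD[OF r(2), of "- cell (fst (items k ! l))"] closed_cell l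
        by (simp add: open_Compl)
      then show ?thesis using eventually_ge_at_top[of k]
        by eventually_elim (use inc[OF r(1)] in auto)
    qed
    have "p \<notin> cell (fst (items k ! i)) \<or> p \<notin> cell (fst (items k ! j))"
      using good[of i j] j by linarith
    then show ?thesis
    proof
      assume "p \<notin> cell (fst (items k ! i))"
      from away[OF this s lim(1)] show ?thesis by eventually_elim simp
    next
      assume "p \<notin> cell (fst (items k ! j))"
      from away[OF this t lim(2)] show ?thesis by eventually_elim simp
    qed
  qed
  define Z where "Z = {(i, j). i < length (items k) \<and> j < length (items k) \<and> \<not> j \<le> Suc i}"
  have "finite Z" by (rule finite_subset[of _ "{..<length (items k)} \<times> {..<length (items k)}"]) (auto simp: Z_def)
  then have "\<forall>\<^sub>F n in sequentially. \<forall>z\<in>Z. \<not> (anc k n (pos n s) = fst z \<and> anc k n (pos n t) = snd z)"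
    by (rule eventually_ball_finite) (use ev in \<open>auto simp: Z_def\<close>)
  then show ?thesis using eventually_ge_at_top[of k]
  proof eventually_elim
    case (elim n)
    show ?case
    proof (rule ccontr)
      assume "\<not> ?case"
      then have "(anc k n (pos n s), anc k n (pos n t)) \<in> Z"
        using anc(1)[OF elim(2)] pos_cell(1)[OF s, of n] pos_cell(1)[OF t, of n] by (simp add: Z_def)
      then show False using elim(1) by force
    qed
  qed
qed

text \<open>The factor is 6 = 2 * 3: a crossing has at most two steps, and its weight is at least
  1/3.\<close>

lemma step_count:
  assumes "v \<in> words k"
  shows "card {m. m < length (stp n) \<and> take k (fst (stp n ! m)) = v} \<le> 6 * mass v n (\<tau> n)"
proof -
  let ?P = "\<lambda>s :: item. take k (fst s) = v"
  have "length (filter ?P (concat (map (steps_of (\<tau> n)) its))) \<le> 2 * length (filter ?P its)" for its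
  proof (induction its)
    case (Cons s its)
    have "length (steps_of (\<tau> n) s) \<le> 2" by (cases s) (simp add: steps_of_def)
    then have "length (filter ?P (steps_of (\<tau> n) s)) \<le> (if ?P s then 2 else 0)"
      using steps_of_word[of _ "\<tau> n" s] length_filter_le[of ?P "steps_of (\<tau> n) s"] by auto
    then show ?case using Cons by (auto split: if_splits)
  qed simp
  from this[of "itin n (\<tau> n)"] have "length (filter ?P (stp n)) \<le> 2 * length (part v n (\<tau> n))"
    using wordsD(1)[OF assms] by (simp add: stp_def steps_def part_def)
  moreover have "card {m. m < length (stp n) \<and> ?P (stp n ! m)} = length (filter ?P (stp n))"
    by (simp add: length_filter_conv_card)
  ultimately show ?thesis using mass_ge[of v n "\<tau> n"] by linarith
qed

text \<open>Between the times s and x at least (x - s) \<open>alpha_bar ^ n\<close> step indices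
  occur, and by monotonicity of \<open>anc\<close> they belong to at most two crossings of level k.
  One of the two gets half of them, which together with the factor 6 of \<open>step_count\<close>
  gives 12. The time x is finite and lies before the end of the path, so \<open>pos\<close> is not
  cut off there.\<close>

lemma heavy_cell:
  assumes s: "0 \<le> s" "s < x" and k: "k \<le> n" and t: "ereal x \<le> t"
    and len: "alpha_bar ^ n * x < length (stp n)"
    and adj: "anc k n (pos n t) \<le> Suc (anc k n (pos n (ereal s)))"
  shows "\<exists>v\<in>words k. (x - s) / 12 * alpha_bar ^ n \<le> mass v n (\<tau> n)"
proof -
  let ?a = "alpha_bar ^ n"
  have ap: "?a > 0" by (rule alpha_pow_pos)
  have xs: "0 \<le> ?a * s" "?a * s < ?a * x" using s ap by auto
  define q q' where "q = nat \<lfloor>?a * s\<rfloor>" and "q' = nat \<lfloor>?a * x\<rfloor>"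
  have q: "pos n (ereal s) = q" "pos n (ereal x) = q'"
    using len xs by (simp_all add: pos_def q_def q'_def)
  have q'len: "q' < length (stp n)" using pos_cell(1)[of "ereal x" n] s q by simp
  \<comment> \<open>Counting both end indices makes up for the rounding down.\<close>
  have qq: "?a * (x - s) \<le> real (q' - q + 1)" and qle: "q \<le> q'"
  proof -
    have f: "\<lfloor>?a * s\<rfloor> \<le> \<lfloor>?a * x\<rfloor>" "0 \<le> \<lfloor>?a * s\<rfloor>" "0 \<le> \<lfloor>?a * x\<rfloor>"
      using xs by (auto intro: floor_mono simp del: zero_le_floor simp add: zero_le_floor[THEN iffD2])
    then show "q \<le> q'" by (simp add: q_def q'_def)
    have "real (q' - q + 1) = of_int \<lfloor>?a * x\<rfloor> - of_int \<lfloor>?a * s\<rfloor> + 1"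
      using f by (simp add: q_def q'_def of_nat_diff nat_mono)
    moreover have "?a * x < of_int \<lfloor>?a * x\<rfloor> + 1" "of_int \<lfloor>?a * s\<rfloor> \<le> ?a * s" by linarith+
    ultimately show "?a * (x - s) \<le> real (q' - q + 1)" unfolding right_diff_distrib by linarith
  qed
  let ?i = "anc k n q"
  define N where "N v = {m. m < length (stp n) \<and> take k (fst (stp n ! m)) = v}" for v
  have anc_mid: "anc k n m = ?i \<or> anc k n m = Suc ?i" if "m \<in> {q..q'}" for m
  proof -
    have "q' \<le> pos n t" using pos_mono[of "ereal x" t n] s t q by simp
    moreover have "pos n t < length (stp n)" using pos_cell(1)[of t n] s t order_trans[of 0 "ereal x" t] by simp
    ultimately have "?i \<le> anc k n m" "anc k n m \<le> anc k n (pos n t)"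
      using anc(3)[OF k] that by auto
    then show ?thesis using adj q by auto
  qed
  \<comment> \<open>If no crossing follows, \<open>v2\<close> repeats \<open>v1\<close>, so that
    both are words of level k in every case.\<close>
  define v1 v2 where "v1 = fst (items k ! ?i)" and "v2 = (if Suc ?i < length (items k) then fst (items k ! Suc ?i) else v1)"
  have sub: "{q..q'} \<subseteq> N v1 \<union> N v2"
  proof
    fix m assume m: "m \<in> {q..q'}"
    then have ml: "m < length (stp n)" using q'len by simp
    show "m \<in> N v1 \<union> N v2"
      using anc_mid[OF m] anc(1)[OF k ml] anc(2)[OF k ml] ml by (auto simp: N_def v1_def v2_def)
  qed
  have vw: "v1 \<in> words k" "v2 \<in> words k"
    using anc(1)[OF k, of q] qle q'len item_word nth_mem by (auto simp: v1_def v2_def)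
  have "real (q' - q + 1) = card {q..q'}" using qle by simp
  also have "\<dots> \<le> card (N v1 \<union> N v2)" using card_mono[OF _ sub] by (simp add: N_def)
  also have "\<dots> \<le> card (N v1) + card (N v2)" using card_Un_le of_nat_mono by fastforce
  finally have "?a * (x - s) \<le> 6 * mass v1 n (\<tau> n) + 6 * mass v2 n (\<tau> n)"
    using qq step_count[OF vw(1), of n] step_count[OF vw(2), of n] unfolding N_def by linarith
  then have "?a * (x - s) \<le> 12 * mass v1 n (\<tau> n) \<or> ?a * (x - s) \<le> 12 * mass v2 n (\<tau> n)" by linarith
  then show ?thesis using vw by (auto simp: field_simps)
qed

text \<open>The corner mass at the next level is a sum over the present corner items, so it vanishes
  if there are none; and any corner item would contribute at least 1.\<close>

lemma corner_items_persist:
  assumes c: "c \<in> idx" and "length w \<le> k" "corner_items w c k (\<tau> k) = []" "k \<le> n"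
  shows "corner_items w c n (\<tau> n) = []"
  using assms(4)
proof (induction n rule: dec_induct)
  case (step n)
  have "corner_mass w c (Suc n) (\<tau> (Suc n)) = 0"
    using corner_mass_Suc[OF tree[of "Suc n"] _ c, of w] step assms(2) trace by simp
  then show ?case using corner_mass_ge[of w c "Suc n" "\<tau> (Suc n)"] by fastforce
qed (rule assms(3))

text \<open>The points where crossings begin are vertices of the path, which visits no vertex
  twice.\<close>

lemma junctions_distinct: "distinct (vertex_list (items n) (u 2))"
proof -
  have "distinct (map start its @ [q])"
    if "distinct (map start (concat (map (steps_of t) its)) @ [q])" for its t q
    using that
  proof (induction its)
    case (Cons s its)
    have hd: "start (hd (steps_of t s)) = start s" for s
      by (cases s) (simp add: steps_of_def start_def)
    then have mem: "start s \<in> start ` set (steps_of t s)" for s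
      using steps_of_nonempty by (metis imageI hd_in_set)
    have "start s \<notin> start ` set its"
    proof
      assume "start s \<in> start ` set its"
      then obtain s2 where "s2 \<in> set its" "start s = start s2" by blast
      then have "start s \<in> start ` set (concat (map (steps_of t) its))" using mem[of s2] by fastforce
      then show False using mem[of s] Cons.prems by (auto simp: disjoint_iff)
    qed
    moreover have "start s \<noteq> q" using mem[of s] Cons.prems by auto
    ultimately show ?case using Cons by simp
  qed simp
  from this[of "\<tau> n" "itin n (\<tau> n)" "u 2"] show ?thesis
    using steps_facts(4)[OF tree[of n]] by (simp add: items_def vertex_list_def steps_def)
qed

text \<open>If p never lies in two cells of one level, the claim holds since the crossed cells are
  distinct. Otherwise p is a corner of every cell of some level m that contains it, and deeper cells
  containing p arise from these by appending the letter of that corner only. Once the corner items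
  have died out, each crossing of such a cell starts or ends at p. Since p occurs at most once among
  the junctions, at most two consecutive crossings are left.\<close>

lemma eventually_good:
  assumes corners: "\<And>w c. set w \<subseteq> idx \<Longrightarrow> c \<in> idx \<Longrightarrow> \<exists>k\<ge>length w. corner_items w c k (\<tau> k) = []"
  shows "\<exists>k0. \<forall>k\<ge>k0. \<forall>i j. i \<le> j \<longrightarrow> j < length (items k) \<longrightarrow> p \<in> cell (fst (items k ! i)) \<longrightarrow>
      p \<in> cell (fst (items k ! j)) \<longrightarrow> j \<le> Suc i"
proof (cases "\<exists>k. \<exists>w\<in>words k. \<exists>w'\<in>words k. w \<noteq> w' \<and> p \<in> cell w \<and> p \<in> cell w'")
  case False
  have "j \<le> Suc i" if "i \<le> j" "j < length (items k)" "p \<in> cell (fst (items k ! i))" "p \<in> cell (fst (items k ! j))"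
    for i j k
  proof (cases "i = j")
    case ne: False
    have "distinct (map fst (items k))" using itin_facts[OF tree[of k]] by (simp add: items_def)
    then have "fst (items k ! i) \<noteq> fst (items k ! j)"
      using that(1,2) ne nth_eq_iff_index_eq[of "map fst (items k)" i j] by simp
    moreover have "fst (items k ! i) \<in> words k" "fst (items k ! j) \<in> words k"
      using item_word that(1,2) by auto
    ultimately show ?thesis using False that(3,4) by blast
  qed simp
  then show ?thesis by blast
next
  case True
  then obtain m w1 w2 where w12: "w1 \<in> words m" "w2 \<in> words m" "w1 \<noteq> w2" "p \<in> cell w1" "p \<in> cell w2" by blast
  have corner: "\<exists>c\<in>idx. p = psiw w (u c)" if w: "w \<in> words m" "p \<in> cell w" for w
  proof -
    obtain w' where "w' \<in> words m" "w \<noteq> w'" "p \<in> cell w'" using w12 by metis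
    then show ?thesis using cell_inter_corner[of w w' p] w wordsD by metis
  qed
  obtain K where K: "\<And>w c. set w \<subseteq> idx \<Longrightarrow> c \<in> idx \<Longrightarrow> length w \<le> K w c \<and> corner_items w c (K w c) (\<tau> (K w c)) = []"
    using corners by metis
  \<comment> \<open>Only the finitely many cells of level m and their corners matter, so one level
    serves for all of them.\<close>
  define k0 where "k0 = max m (Max ((\<lambda>(w, c). K w c) ` (words m \<times> idx)))"
  have "j \<le> Suc i" if k: "k0 \<le> k" and ij: "i \<le> j" "j < length (items k)"
    "p \<in> cell (fst (items k ! i))" "p \<in> cell (fst (items k ! j))" for i j k
  proof -
    have mk: "m \<le> k" using k by (simp add: k0_def)
    have junction: "p = start s \<or> p = finish s" if s: "s \<in> set (items k)" "p \<in> cell (fst s)" for s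
    proof -
      obtain w' a b where s': "s = (w', a, b)" by (cases s)
      have w': "w' \<in> words k" using item_word[OF s(1)] s' by simp
      define w z where "w = take m w'" and "z = drop m w'"
      have wz: "w' = w @ z" "w \<in> words m" "set z \<subseteq> idx" "length z = k - m"
        using w' mk unfolding w_def z_def words_def by (auto dest: in_set_takeD in_set_dropD)
      have "p \<in> cell w" using s(2) s' wz cell_append by auto
      then obtain c where c: "c \<in> idx" "p = psiw w (u c)" using corner wz(2) by blast
      obtain y where y: "y \<in> Tri" "p = psiw w (psiw z y)"
        using s(2) by (auto simp: s' wz(1) cell_def psiw_append)
      then have "u c = psiw z y" using c by (simp add: psiw_inj)
      then have "u c \<in> cell z" using y(1) unfolding cell_def by (metis imageI)
      then have z: "z = replicate (k - m) c" using corner_cell_word[OF wz(3) c(1)] wz(4) by simp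
      have pc: "p = psiw w' (u c)" unfolding wz(1) psiw_append z using c by simp
      have sw: "set w \<subseteq> idx" "length w = m" using wz(2) wordsD by auto
      have "K w c \<le> k"
      proof -
        have "K w c \<in> (\<lambda>(w, c). K w c) ` (words m \<times> idx)" using wz(2) c(1) by force
        then have "K w c \<le> Max ((\<lambda>(w, c). K w c) ` (words m \<times> idx))" by (intro Max_ge) auto
        then show ?thesis using k by (simp add: k0_def)
      qed
      then have "corner_items w c k (\<tau> k) = []"
        using corner_items_persist[OF c(1)] K[OF sw(1) c(1)] by blast
      then have "c = a \<or> c = b"
        using s(1) unfolding s' corner_items_def items_def filter_empty_conv
        by (auto simp: sw(2) wz(1) z)
      then show ?thesis using pc by (auto simp: s' start_def finish_def)
    qed
    have ch: "chain (u 1) (items k) (u 2)" using itin_facts[OF tree[of k]] by (simp add: items_def)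
    let ?J = "vertex_list (items k) (u 2)"
    have i: "i < length (items k)" using ij by simp
    have "p = ?J ! i \<or> p = ?J ! Suc i" "p = ?J ! j \<or> p = ?J ! Suc j"
      using junction[OF nth_mem[OF i] ij(3)] junction[OF nth_mem[OF ij(2)] ij(4)]
        chain_nth[OF ch i] chain_nth[OF ch ij(2)] by auto
    then obtain i' j' where "i' = i \<or> i' = Suc i" "j' = j \<or> j' = Suc j" "?J ! i' = ?J ! j'" by metis
    moreover from this have "i' < length ?J" "j' < length ?J" using i ij(2) by (auto simp: vertex_list_def)
    ultimately show ?thesis using nth_eq_iff_index_eq[OF junctions_distinct[of k]] by fastforce
  qed
  then show ?thesis by blast
qed

theorem self_intersection_heavy_cells:
  assumes lim: "\<And>r. 0 \<le> r \<Longrightarrow> (\<lambda>n. curve n r) \<longlonglongrightarrow> X r"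
    and corners: "\<And>w c. set w \<subseteq> idx \<Longrightarrow> c \<in> idx \<Longrightarrow> \<exists>k\<ge>length w. corner_items w c k (\<tau> k) = []"
    and st: "0 \<le> s" "s < t" "t \<le> hX X" and eq: "X s = X t"
  shows "\<exists>\<epsilon>>0. \<exists>k0. \<forall>k\<ge>k0. \<exists>N. \<forall>n\<ge>N. \<exists>v\<in>words k. \<epsilon> * alpha_bar ^ n \<le> mass v n (\<tau> n)"
proof -
  \<comment> \<open>The time t may be infinite; steps are counted up to a finite time before
    it.\<close>
  obtain t' where t': "s < t'" "t' < t" using dense[OF st(2)] by blast
  obtain x where x: "t' = ereal x" using t' st(1) by (cases t') auto
  obtain y where y: "s = ereal y" using t' st(1) by (cases s) auto
  have y0: "0 \<le> y" and yx: "y < x" using st(1) t'(1) x y by auto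
  \<comment> \<open>Before \<open>hX X\<close> the limit has not yet come to rest. At the later time
    r the discrete curves therefore differ from \<open>u 2\<close> for large n, so their paths are
    unfinished at the time t'.\<close>
  have "\<exists>r\<ge>t'. X r \<noteq> u 2"
  proof (rule ccontr)
    assume "\<not> ?thesis"
    then have "t' \<in> {t. 0 \<le> t \<and> (\<forall>s. t \<le> s \<longrightarrow> X s = u 2)}" using st(1) t'(1) by auto
    then have "hX X \<le> t'" unfolding hX_def by (rule Inf_lower)
    then show False using t'(2) st(3) by simp
  qed
  then obtain r where r: "t' \<le> r" "X r \<noteq> u 2" by blast
  have "0 \<le> r" using st(1) t'(1) r(1) by simp
  have long: "\<forall>\<^sub>F n in sequentially. alpha_bar ^ n * x < length (stp n)"
    using tendsto_imp_eventually_ne[OF lim[OF \<open>0 \<le> r\<close>] r(2)]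
  proof eventually_elim
    case (elim n)
    show ?case
    proof (rule ccontr)
      assume "\<not> ?case"
      then have "ereal (length (stp n)) \<le> ereal (alpha_bar ^ n) * t'" by (simp add: x)
      also have "\<dots> \<le> ereal (alpha_bar ^ n) * r"
        using r(1) alpha_pow_pos[of n] by (intro ereal_mult_left_mono) auto
      finally show False using curve_end elim by blast
    qed
  qed
  obtain k0 where k0: "\<And>k i j. k0 \<le> k \<Longrightarrow> i \<le> j \<Longrightarrow> j < length (items k) \<Longrightarrow> X s \<in> cell (fst (items k ! i)) \<Longrightarrow>
      X s \<in> cell (fst (items k ! j)) \<Longrightarrow> j \<le> Suc i"
  proof -
    have "\<exists>k0. \<forall>k\<ge>k0. \<forall>i j. i \<le> j \<longrightarrow> j < length (items k) \<longrightarrow> X s \<in> cell (fst (items k ! i)) \<longrightarrow>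
      X s \<in> cell (fst (items k ! j)) \<longrightarrow> j \<le> Suc i"
      by (rule eventually_good) (rule corners)
    then show ?thesis using that by blast
  qed
  have "\<exists>N. \<forall>n\<ge>N. \<exists>v\<in>words k. (x - y) / 12 * alpha_bar ^ n \<le> mass v n (\<tau> n)" if "k0 \<le> k" for k
  proof -
    have "0 \<le> t" "s \<le> t" using st by auto
    have l2: "(\<lambda>n. curve n t) \<longlonglongrightarrow> X s" using lim[OF \<open>0 \<le> t\<close>] eq by simp
    have "\<forall>\<^sub>F n in sequentially. anc k n (pos n t) \<le> Suc (anc k n (pos n s))"
      by (rule cells_adjacent[OF st(1) \<open>s \<le> t\<close> lim[OF st(1)] l2]) (use k0 that in blast)
    then have "\<forall>\<^sub>F n in sequentially. \<exists>v\<in>words k. (x - y) / 12 * alpha_bar ^ n \<le> mass v n (\<tau> n)"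
      using long eventually_ge_at_top[of k]
    proof eventually_elim
      case (elim n)
      show ?case
        by (rule heavy_cell[OF y0 yx elim(3) _ elim(2)]) (use t'(2) x y elim(1) in auto)
    qed
    then show ?thesis by (simp add: eventually_sequentially)
  qed
  then show ?thesis using yx by (intro exI[of _ "(x - y) / 12"]) auto
qed

end

section \<open>The measure-theoretic part\<close>

text \<open>A connected spanning subgraph with the fewest edges has no cycle. Nonemptiness is what
  makes \<open>pmf_of_set\<close> the uniform distribution.\<close>

lemma STrees_nonempty: "STrees n \<noteq> {}"
proof -
  have conn: "\<forall>x\<in>VG n. \<forall>y\<in>VG n. reach (EG n) x y" for n
  proof (induction n)
    case 0
    have "reach (EG 0) (u a) (u b)" if "a \<in> idx" "b \<in> idx" for a b
    proof (cases "a = b")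
      case False
      then have "{u a, u b} \<in> EG 0" using that EG0_iff by blast
      then show ?thesis by (rule reach_edge)
    qed simp
    moreover have "VG 0 = u ` idx" by (simp add: VG.simps idx_def)
    ultimately show ?case by simp
  next
    case (Suc n)
    have uV: "u c \<in> VG n" if "c \<in> idx" for c
      using that by (induction n) (auto simp: VG.simps idx_def intro: rev_image_eqI)
    have part: "reach (EG (Suc n)) (psi i x) (psi i y)" if "i \<in> idx" "x \<in> VG n" "y \<in> VG n" for i x y
    proof -
      have "reach ((`) (psi i) ` EG n) (psi i x) (psi i y)" using Suc that by (intro reach_image) auto
      then show ?thesis by (rule reach_mono) (use that(1) in \<open>auto simp: EG.simps\<close>)
    qed
    have to1: "reach (EG (Suc n)) x (u 1)" if "x \<in> VG (Suc n)" for x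
    proof -
      have one: "1 \<in> idx" by (simp add: idx_def)
      obtain i y where i: "i \<in> idx" "y \<in> VG n" "x = psi i y" using \<open>x \<in> VG (Suc n)\<close> by (auto simp: VG.simps)
      have "reach (EG (Suc n)) x (psi i (u 1))" unfolding i(3) using part i(1,2) uV one by blast
      moreover have "reach (EG (Suc n)) (psi 1 (u i)) (psi 1 (u 1))" using part one i(1) uV by blast
      ultimately show ?thesis using psi_u_commute[of i 1] reach_trans by (metis psi_u_self)
    qed
    show ?case
    proof (intro ballI)
      fix x y assume "x \<in> VG (Suc n)" "y \<in> VG (Suc n)"
      then show "reach (EG (Suc n)) x y" by (intro reach_trans[OF to1 reach_sym[OF to1]])
    qed
  qed
  define F where "F = {E. E \<subseteq> EG n \<and> (\<forall>x\<in>VG n. \<forall>y\<in>VG n. reach E x y)}"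
  have "EG n \<in> F" using conn by (simp add: F_def)
  then obtain E where E: "E \<in> F" "\<And>E'. E' \<in> F \<Longrightarrow> card E \<le> card E'"
    using ex_has_least_nat[of "\<lambda>E. E \<in> F" "EG n" card] by blast
  have finE: "finite E" using E(1) finite_EG finite_subset by (auto simp: F_def)
  have "acyclic_graph E"
  proof (rule ccontr)
    assume "\<not> acyclic_graph E"
    then obtain C where C: "C \<subseteq> E" "\<not> acyclic_graph C"
      "\<And>e. e \<in> C \<Longrightarrow> \<exists>x y. e = {x, y} \<and> x \<noteq> y \<and> reach (E - {e}) x y"
      using not_acyclic_cycle_edge by blast
    have "C \<noteq> {}"
    proof
      assume "C = {}"
      then obtain xs where xs: "length xs \<ge> 3" "walk {} xs" using C(2) by (auto simp: acyclic_graph_def)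
      then have "Suc 0 < length xs" by simp
      then show False using xs(2) by (auto simp: walk_def)
    qed
    then obtain x y where xy: "{x, y} \<in> E" "reach (E - {{x, y}}) x y" using C(1,3) by blast
    have "reach (E - {{x, y}}) a b" if "reach E a b" for a b
      using that
    proof (induction rule: reach_induct)
      case (step c d)
      have "reach (E - {{x, y}}) c d"
      proof (cases "{c, d} = {x, y}")
        case True
        then show ?thesis using xy(2) reach_sym by (auto simp: doubleton_eq_iff)
      next
        case False
        then show ?thesis using step.hyps by (intro reach_edge) auto
      qed
      then show ?case using step.IH reach_trans by blast
    qed simp
    then have "E - {{x, y}} \<in> F" using E(1) by (auto simp: F_def)
    then have "card E \<le> card (E - {{x, y}})" by (rule E(2))
    moreover have "card (E - {{x, y}}) < card E" using finE xy(1) by (rule card_Diff1_less)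
    ultimately show False by simp
  qed
  then show ?thesis using E(1) by (auto simp: STrees_def F_def)
qed

text \<open>Continuity from below: the intersections increase with N, and each is contained in some
  \<open>A n\<close> with n at least m.\<close>

lemma (in prob_space) prob_eventually_le:
  fixes A :: "nat \<Rightarrow> 'a set"
  assumes A: "\<And>n. A n \<in> events" and b: "\<And>n. m \<le> n \<Longrightarrow> prob (A n) \<le> b"
  shows "(\<Union>N. \<Inter>n\<in>{N..}. A n) \<in> events" "prob (\<Union>N. \<Inter>n\<in>{N..}. A n) \<le> b"
proof -
  have I: "(\<Inter>n\<in>{N..}. A n) \<in> events" for N using A by (intro sets.countable_INT') (auto intro: countableI_type)
  then show "(\<Union>N. \<Inter>n\<in>{N..}. A n) \<in> events" by blast
  have L: "(\<lambda>N. prob (\<Inter>n\<in>{N..}. A n)) \<longlonglongrightarrow> prob (\<Union>N. \<Inter>n\<in>{N..}. A n)"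
  proof (rule finite_Lim_measure_incseq)
    show "incseq (\<lambda>N. \<Inter>n\<in>{N..}. A n)" by (rule incseq_SucI) force
  qed (use I in auto)
  have "prob (\<Inter>n\<in>{N..}. A n) \<le> b" for N
  proof -
    have "prob (\<Inter>n\<in>{N..}. A n) \<le> prob (A (max m N))" using A by (intro finite_measure_mono) auto
    then show ?thesis using b[of "max m N"] by simp
  qed
  then show "prob (\<Union>N. \<Inter>n\<in>{N..}. A n) \<le> b" by (intro LIMSEQ_le_const2[OF L]) blast
qed

lemma (in prob_space) prob_eventually_0:
  fixes A :: "nat \<Rightarrow> 'a set"
  assumes A: "\<And>n. A n \<in> events" and b: "\<And>n. m \<le> n \<Longrightarrow> prob (A n) \<le> b n" and lim: "b \<longlonglongrightarrow> 0"
  shows "AE \<omega> in M. \<exists>n\<ge>m. \<omega> \<notin> A n"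
proof -
  have I: "(\<Inter>n\<in>{m..}. A n) \<in> events" using A by (intro sets.countable_INT') (auto intro: countableI_type)
  have "prob (\<Inter>n\<in>{m..}. A n) \<le> 0"
  proof (rule LIMSEQ_le_const[OF lim])
    have "prob (\<Inter>n\<in>{m..}. A n) \<le> b n" if "n \<ge> m" for n
      using finite_measure_mono[of "\<Inter>n\<in>{m..}. A n" "A n"] A b[OF that] that by fastforce
    then show "\<exists>N. \<forall>n\<ge>N. prob (\<Inter>n\<in>{m..}. A n) \<le> b n" by blast
  qed
  then have "emeasure M (\<Inter>n\<in>{m..}. A n) = 0" by (simp add: emeasure_eq_measure measure_le_0_iff)
  then have "(\<Inter>n\<in>{m..}. A n) \<in> null_sets M" using I by blast
  then show ?thesis by (rule AE_I') blast
qed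

locale consistent_trees =
  fixes M :: "'a measure" and T :: "nat \<Rightarrow> 'a \<Rightarrow> complex set set"
  assumes consistent: "consistent_UST M T"
begin

sublocale prob_space M using consistent by (simp add: consistent_UST_def)

lemma T_event: "{\<omega> \<in> space M. P (T n \<omega>)} \<in> events"
proof -
  have "T n \<in> measurable M (count_space UNIV)" using consistent by (simp add: consistent_UST_def)
  then have "T n -` {t. P t} \<inter> space M \<in> events" by (rule measurable_sets) simp
  then show ?thesis by (simp add: vimage_def Int_def conj_commute)
qed

lemma T_prob: "prob {\<omega> \<in> space M. P (T n \<omega>)} = card {t \<in> STrees n. P t} / card (STrees n)"
proof -
  have m: "T n \<in> measurable M (count_space UNIV)"
    and d: "distr M (count_space UNIV) (T n) = measure_pmf (pmf_of_set (STrees n))"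
    using consistent by (auto simp: consistent_UST_def)
  have "measure (distr M (count_space UNIV) (T n)) {t. P t} = prob (T n -` {t. P t} \<inter> space M)"
    using m by (rule measure_distr) simp
  also have "T n -` {t. P t} \<inter> space M = {\<omega> \<in> space M. P (T n \<omega>)}" by auto
  finally show ?thesis
    unfolding d using measure_pmf_of_set[OF STrees_nonempty finite_STrees, of n "{t. P t}"]
    by (simp add: Int_def)
qed

lemma T_trace: "\<omega> \<in> space M \<Longrightarrow> Tr n (T (Suc n) \<omega>) = T n \<omega>"
  using consistent by (simp add: consistent_UST_def)

lemma cardS: "real (card (STrees n)) > 0"
  using STrees_nonempty finite_STrees by (simp add: card_gt_0_iff)

text \<open>The variable \<open>T n\<close> is the trace of \<open>T (Suc n)\<close>. Comparing the
  two uniform laws gives a purely combinatorial identity.\<close>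

lemma trace_prob: "card {t \<in> STrees (Suc n). P (Tr n t)} / card (STrees (Suc n)) =
    card {t \<in> STrees n. P t} / card (STrees n)"
proof -
  have "{\<omega> \<in> space M. P (T n \<omega>)} = {\<omega> \<in> space M. P (Tr n (T (Suc n) \<omega>))}" using T_trace by auto
  then show ?thesis using T_prob[of P n] T_prob[of "\<lambda>t. P (Tr n t)" "Suc n"] by simp
qed

text \<open>Every spanning tree of \<open>G_{n+1}\<close> has positive probability, hence so has its
  trace, which must then be a spanning tree of \<open>G_n\<close>. The number of extensions of a
  given tree follows by comparing the probability of that tree under both laws.\<close>

sublocale uniform_trace_trees
proof
  show "Tr n t \<in> STrees n" if "t \<in> STrees (Suc n)" for t n
  proof (rule ccontr)
    assume no: "Tr n t \<notin> STrees n"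
    have e: "{t' \<in> STrees n. t' = Tr n t} = {}" using no by auto
    have "real (card {t' \<in> STrees (Suc n). Tr n t' = Tr n t}) / card (STrees (Suc n)) = 0"
      unfolding trace_prob[of n "\<lambda>t'. t' = Tr n t"] e by simp
    then have "card {t' \<in> STrees (Suc n). Tr n t' = Tr n t} = 0" using cardS[of "Suc n"] by simp
    then show False using that finite_STrees by (auto simp: card_eq_0_iff)
  qed
  show "card (ext n t0) * card (STrees n) = card (STrees (Suc n))" if "t0 \<in> STrees n" for t0 n
  proof -
    have e: "{t \<in> STrees n. t = t0} = {t0}" using that by auto
    have "card (ext n t0) / card (STrees (Suc n)) = 1 / card (STrees n)"
      unfolding ext_def trace_prob[of n "\<lambda>t. t = t0"] e by simp
    then have "real (card (ext n t0)) * card (STrees n) = card (STrees (Suc n))"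
      using cardS[of n] cardS[of "Suc n"] by (simp add: field_simps)
    then show ?thesis by (metis of_nat_mult of_nat_eq_iff)
  qed
  show "STrees n \<noteq> {}" for n by (rule STrees_nonempty)
qed

text \<open>Markov's inequality with threshold 1.\<close>

lemma prob_le_avg:
  assumes "\<And>t. t \<in> STrees n \<Longrightarrow> P t \<Longrightarrow> 1 \<le> F t" "\<And>t. t \<in> STrees n \<Longrightarrow> 0 \<le> F t"
  shows "prob {\<omega> \<in> space M. P (T n \<omega>)} \<le> avg n F"
proof -
  have "real (card {t \<in> STrees n. P t}) = (\<Sum>t\<in>STrees n. if P t then 1 else 0)"
    using finite_STrees by (simp add: sum.If_cases Int_def)
  also have "\<dots> \<le> (\<Sum>t\<in>STrees n. F t)" using assms by (intro sum_mono) auto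
  finally show ?thesis unfolding T_prob avg_def by (intro divide_right_mono) auto
qed

lemma AE_tree: "AE \<omega> in M. \<forall>n. T n \<omega> \<in> STrees n"
proof (subst AE_all_countable, rule allI)
  fix n
  have "prob {\<omega> \<in> space M. T n \<omega> \<in> STrees n} = 1" using T_prob[of "\<lambda>t. t \<in> STrees n" n] cardS[of n] by simp
  then show "AE \<omega> in M. T n \<omega> \<in> STrees n" using prob_Collect_eq_1[OF T_event[of "\<lambda>t. t \<in> STrees n" n]] by simp
qed

lemma AE_corner:
  "AE \<omega> in M. \<forall>w. \<forall>c\<in>idx. \<exists>k\<ge>length w. corner_items w c k (T k \<omega>) = []"
proof -
  have "AE \<omega> in M. \<exists>k\<ge>length w. corner_items w c k (T k \<omega>) = []" if c: "c \<in> idx" for w c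
  proof -
    define A where "A k = {\<omega> \<in> space M. corner_items w c k (T k \<omega>) \<noteq> []}" for k
    have "AE \<omega> in M. \<exists>k\<ge>length w. \<omega> \<notin> A k"
    proof (rule prob_eventually_0)
      show "A k \<in> events" for k unfolding A_def by (rule T_event)
      fix k assume k: "length w \<le> k"
      have "prob (A k) \<le> avg k (corner_mass w c k)" unfolding A_def
      proof (rule prob_le_avg)
        show "0 \<le> corner_mass w c k t" for t
          unfolding corner_mass_def by (rule sum_list_nonneg) auto
      qed (rule corner_mass_ge)
      also have "\<dots> \<le> avg (length w) (corner_mass w c (length w)) * (2/3) ^ (k - length w)"
        by (rule avg_corner_mass[OF c k])
      finally show "prob (A k) \<le> avg (length w) (corner_mass w c (length w)) * (2/3) ^ (k - length w)" .
    next
      have "(\<lambda>k. avg (length w) (corner_mass w c (length w)) * (2/3) ^ k) \<longlonglongrightarrow> avg (length w) (corner_mass w c (length w)) * 0"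
        by (intro tendsto_intros LIMSEQ_power_zero) simp
      then show "(\<lambda>k. avg (length w) (corner_mass w c (length w)) * (2/3) ^ (k - length w)) \<longlonglongrightarrow> 0"
        using LIMSEQ_offset[of "\<lambda>k. avg (length w) (corner_mass w c (length w)) * (2/3) ^ (k - length w)" "length w" 0]
        by simp
    qed
    then show ?thesis using AE_space by eventually_elim (auto simp: A_def)
  qed
  \<comment> \<open>The condition on c is moved inside, so that w and c range over countable
    types.\<close>
  then have "AE \<omega> in M. \<exists>k\<ge>length w. corner_items w c k (T k \<omega>) = [] \<or> c \<notin> idx" for w c
    by (cases "c \<in> idx") auto
  then have "AE \<omega> in M. \<forall>w c. \<exists>k\<ge>length w. corner_items w c k (T k \<omega>) = [] \<or> c \<notin> idx"
    by (simp add: AE_all_countable)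
  then show ?thesis by eventually_elim blast
qed

text \<open>Markov's inequality for the sum of squared masses. The bound does not depend on n,
  because the threshold and the masses both scale with \<open>alpha_bar ^ n\<close>.\<close>

lemma heavy_prob:
  assumes e: "\<epsilon> > 0" and k: "k \<le> n"
  shows "prob {\<omega> \<in> space M. \<exists>v\<in>words k. \<epsilon> * alpha_bar ^ n \<le> mass v n (T n \<omega>)} \<le> 15 / \<epsilon>\<^sup>2 / alpha_bar ^ k"
proof -
  define B where "B = \<epsilon> * alpha_bar ^ n"
  have B: "B > 0" using e alpha_bar_gt by (simp add: B_def)
  have "prob {\<omega> \<in> space M. \<exists>v\<in>words k. B \<le> mass v n (T n \<omega>)} \<le>
    avg n (\<lambda>t. (1 / B\<^sup>2) * (\<Sum>v\<in>words k. (mass v n t)\<^sup>2))"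
  proof (rule prob_le_avg)
    fix t assume "\<exists>v\<in>words k. B \<le> mass v n t"
    then obtain v where v: "v \<in> words k" "B \<le> mass v n t" by blast
    have "B\<^sup>2 \<le> (mass v n t)\<^sup>2" using v(2) B by (intro power_mono) auto
    also have "\<dots> \<le> (\<Sum>v\<in>words k. (mass v n t)\<^sup>2)" using v(1) by (intro member_le_sum) auto
    finally show "1 \<le> (1 / B\<^sup>2) * (\<Sum>v\<in>words k. (mass v n t)\<^sup>2)" using B by (simp add: field_simps)
  qed (simp add: sum_nonneg)
  also have "\<dots> = (1 / B\<^sup>2) * avg n (\<lambda>t. \<Sum>v\<in>words k. (mass v n t)\<^sup>2)" by (rule avg_cmult)
  also have "\<dots> \<le> (1 / B\<^sup>2) * (15 * alpha_bar ^ (2 * n) / alpha_bar ^ k)"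
  proof (rule mult_left_mono)
    have "0 \<le> 14 * alpha_bar ^ n" using alpha_bar_gt by simp
    then show "avg n (\<lambda>t. \<Sum>v\<in>words k. (mass v n t)\<^sup>2) \<le> 15 * alpha_bar ^ (2 * n) / alpha_bar ^ k"
      using avg_mass_square[OF k] by linarith
  qed simp
  also have "\<dots> = 15 / \<epsilon>\<^sup>2 / alpha_bar ^ k"
    using e alpha_bar_gt unfolding B_def power_even_eq power_mult_distrib by simp
  finally show ?thesis by (simp add: B_def)
qed

text \<open>For fixed k the event that a heavy cell exists for all large n inherits the bound of
  \<open>heavy_prob\<close>, and this tends to 0 as k grows. Since the condition weakens when
  \<epsilon> decreases, the values 1/(j+1) suffice and only countably many null sets arise.\<close>

lemma AE_no_heavy:
  "AE \<omega> in M. \<not> (\<exists>\<epsilon>>0. \<exists>k0. \<forall>k\<ge>k0. \<exists>N. \<forall>n\<ge>N. \<exists>v\<in>words k. \<epsilon> * alpha_bar ^ n \<le> mass v n (T n \<omega>))"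
proof -
  define A where "A \<epsilon> k n = {\<omega> \<in> space M. \<exists>v\<in>words k. \<epsilon> * alpha_bar ^ n \<le> mass v n (T n \<omega>)}" for \<epsilon> k n
  have Ae: "A \<epsilon> k n \<in> events" for \<epsilon> k n unfolding A_def by (rule T_event)
  have "AE \<omega> in M. \<exists>k\<ge>k0. \<omega> \<notin> (\<Union>N. \<Inter>n\<in>{N..}. A \<epsilon> k n)" if "\<epsilon> > 0" for \<epsilon> k0
  proof (rule prob_eventually_0)
    show "(\<Union>N. \<Inter>n\<in>{N..}. A \<epsilon> k n) \<in> events" for k
      by (rule prob_eventually_le(1)[of "A \<epsilon> k" k 1]) (simp_all add: Ae)
    show "prob (\<Union>N. \<Inter>n\<in>{N..}. A \<epsilon> k n) \<le> 15 / \<epsilon>\<^sup>2 / alpha_bar ^ k" for k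
      by (rule prob_eventually_le(2)[OF Ae, of k]) (unfold A_def, rule heavy_prob[OF that])
    have "(\<lambda>k. 15 / \<epsilon>\<^sup>2 * (1 / alpha_bar) ^ k) \<longlonglongrightarrow> 15 / \<epsilon>\<^sup>2 * 0"
      using alpha_bar_gt by (intro tendsto_intros LIMSEQ_power_zero) simp
    then show "(\<lambda>k. 15 / \<epsilon>\<^sup>2 / alpha_bar ^ k) \<longlonglongrightarrow> 0" by (simp add: power_one_over)
  qed
  then have "AE \<omega> in M. \<forall>j k0. \<exists>k\<ge>k0. \<omega> \<notin> (\<Union>N. \<Inter>n\<in>{N..}. A (1 / real (Suc j)) k n)"
    by (simp add: AE_all_countable)
  then show ?thesis
  proof (rule AE_mp, intro AE_I2 impI notI)
    fix \<omega> assume w: "\<omega> \<in> space M" and h: "\<forall>j k0. \<exists>k\<ge>k0. \<omega> \<notin> (\<Union>N. \<Inter>n\<in>{N..}. A (1 / real (Suc j)) k n)"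
      and ex: "\<exists>\<epsilon>>0. \<exists>k0. \<forall>k\<ge>k0. \<exists>N. \<forall>n\<ge>N. \<exists>v\<in>words k. \<epsilon> * alpha_bar ^ n \<le> mass v n (T n \<omega>)"
    obtain \<epsilon> k0 where e: "\<epsilon> > 0" "\<And>k. k0 \<le> k \<Longrightarrow> \<exists>N. \<forall>n\<ge>N. \<exists>v\<in>words k. \<epsilon> * alpha_bar ^ n \<le> mass v n (T n \<omega>)"
      using ex by blast
    obtain j where j: "1 / real (Suc j) < \<epsilon>" using nat_approx_posE[OF e(1)] by blast
    obtain k where k: "k0 \<le> k" "\<omega> \<notin> (\<Union>N. \<Inter>n\<in>{N..}. A (1 / real (Suc j)) k n)" using h by blast
    obtain N where N: "\<And>n. N \<le> n \<Longrightarrow> \<exists>v\<in>words k. \<epsilon> * alpha_bar ^ n \<le> mass v n (T n \<omega>)" using e(2)[OF k(1)] by blast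
    have "\<omega> \<in> A (1 / real (Suc j)) k n" if n: "N \<le> n" for n
    proof -
      have "1 / real (Suc j) * alpha_bar ^ n \<le> \<epsilon> * alpha_bar ^ n"
        using j alpha_bar_gt by (intro mult_right_mono) auto
      then show ?thesis using N[OF n] w order_trans unfolding A_def by blast
    qed
    then show False using k(2) by blast
  qed
qed

end

theorem mainTheorem12:
  fixes M :: "'a measure" and T :: "nat \<Rightarrow> 'a \<Rightarrow> complex set set"
    and X :: "'a \<Rightarrow> ereal \<Rightarrow> complex"
  assumes "consistent_UST M T"
    and "AE \<omega> in M. uniform_limit {0..}
           (\<lambda>n t. LI (tpath (T n \<omega>) (u 1) (u 2)) (ereal (alpha_bar ^ n) * t))
           (X \<omega>) sequentially"
  shows "AE \<omega> in M. \<forall>s t. 0 \<le> s \<and> s < t \<and> t \<le> hX (X \<omega>) \<longrightarrow> X \<omega> s \<noteq> X \<omega> t"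
proof -
  interpret consistent_trees M T using assms(1) by unfold_locales
  show ?thesis
    using AE_tree AE_corner AE_no_heavy assms(2) AE_space
  proof eventually_elim
    case (elim \<omega>)
    \<comment> \<open>Outside a null set the deterministic argument applies to the realisation at
      \<omega>, and its conclusion contradicts \<open>AE_no_heavy\<close>.\<close>
    interpret tree_sequence "\<lambda>n. T n \<omega>"
      using elim(1) T_trace[OF elim(5)] by unfold_locales auto
    have lim: "(\<lambda>n. curve n r) \<longlonglongrightarrow> X \<omega> r" if "0 \<le> r" for r
      unfolding curve_def using tendsto_uniform_limitI[OF elim(4)] that by simp
    show ?case
    proof (intro allI impI notI)
      fix s t assume st: "0 \<le> s \<and> s < t \<and> t \<le> hX (X \<omega>)" "X \<omega> s = X \<omega> t"
      have "\<exists>\<epsilon>>0. \<exists>k0. \<forall>k\<ge>k0. \<exists>N. \<forall>n\<ge>N. \<exists>v\<in>words k. \<epsilon> * alpha_bar ^ n \<le> mass v n (T n \<omega>)"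
      proof (rule self_intersection_heavy_cells[where X = "X \<omega>" and s = s and t = t])
        show "\<exists>k\<ge>length w. corner_items w c k (T k \<omega>) = []" if "c \<in> idx" for w c
          using elim(2) that by blast
      qed (use st lim in auto)
      then show False using elim(3) by blast
    qed
  qed
qed

end
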